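(* Let $D_1,D_2\subset\mathbb{R}^2$ be two disks of the same radius, with disjoint closures, given in bipolar coordinates by $D_1=\{\xi<-\xi_0\}$ and $D_2=\{\xi>\xi_0\}$ with $\xi_0>0$, and let $D_j$ have complex conductivity $k_j$, $j=1,2$. Put $\gamma=k_1\chi(D_1)+k_2\chi(D_2)+\chi(\mathbb{R}^2\setminus(D_1\cup D_2))$, $\lambda(k)=\frac{k+1}{2(k-1)}$, $\tau_j=\frac{k_j-1}{k_j+1}$ and $\tau=\tau_1\tau_2$. Let $h$ be a given harmonic function in $\mathbb{R}^2$. Then the problem $$\nabla\cdot\gamma\nabla u=0\ \text{ in }\mathbb{R}^2,\qquad u(\mathbf{x})-h(\mathbf{x})=O(|\mathbf{x}|^{-1})\ \text{ as }|\mathbf{x}|\to\infty$$ is solvable if and only if $$\tau^{-1}e^{4n\xi_0}-1\ne0,\qquad n=1,2,\ldots,$$ a condition which can be rewritten as $$\lambda(k_1)\,\lambda(k_2)\ne\Big(\pm\frac12e^{-2n\xi_0}\Big)^2,\qquad n=1,2,\ldots.$$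
   Context: Bipolar coordinates $(\xi,\theta)\in\mathbb{R}\times(-\pi,\pi]$ with parameter $\alpha>0$ are defined by $x=\alpha\frac{\sinh\xi}{\cosh\xi-\cos\theta}$, $y=\alpha\frac{\sin\theta}{\cosh\xi-\cos\theta}$; with an appropriately chosen $\alpha$ the two disks have the stated form for some $\xi_0>0$. $\chi(E)$ is the characteristic function of $E$. The equation is understood through the transmission conditions $u|_+=u|_-$ and $\partial_\nu u|_+=k_j\,\partial_\nu u|_-$ on $\partial D_j$, $j=1,2$ ($+,-$: limits from outside and inside $D_j$; $\partial_\nu$ the outward normal derivative). *)

theory Defs
  imports "HOL-Analysis.Analysis" "HOL-Library.Landau_Symbols"
begin

(* The plane is identified with the type complex; as a Euclidean space it has the
   orthonormal basis Basis = {1, \<i>}.  All derivatives below are real (Frechet)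
   derivatives, and functions on the plane are complex valued. *)

definition bipolar :: "real \<Rightarrow> real \<Rightarrow> real \<Rightarrow> complex" where
  "bipolar \<alpha> \<xi> \<theta> = Complex (\<alpha> * sinh \<xi> / (cosh \<xi> - cos \<theta>)) (\<alpha> * sin \<theta> / (cosh \<xi> - cos \<theta>))"

(* The foci -\<alpha> and \<alpha> correspond to \<xi> = -\<infinity> and \<xi> = +\<infinity>.  No pair of finite coordinates
   describes them, so they are added by hand: {\<xi> < -\<xi>0} and {\<xi> > \<xi>0} are full disks. *)

definition bipolar_left :: "real \<Rightarrow> real \<Rightarrow> complex set" where
  "bipolar_left \<alpha> \<xi>0 =
     insert (- of_real \<alpha>) {bipolar \<alpha> \<xi> \<theta> | \<xi> \<theta>. \<theta> \<in> {-pi<..pi} \<and> \<xi> < - \<xi>0}"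

definition bipolar_right :: "real \<Rightarrow> real \<Rightarrow> complex set" where
  "bipolar_right \<alpha> \<xi>0 =
     insert (of_real \<alpha>) {bipolar \<alpha> \<xi> \<theta> | \<xi> \<theta>. \<theta> \<in> {-pi<..pi} \<and> \<xi> > \<xi>0}"

definition conductivity ::
  "complex set \<Rightarrow> complex set \<Rightarrow> complex \<Rightarrow> complex \<Rightarrow> complex \<Rightarrow> complex" where
  "conductivity D1 D2 k1 k2 x =
     k1 * indicator D1 x + k2 * indicator D2 x + indicator (UNIV - (D1 \<union> D2)) x"

definition lam :: "complex \<Rightarrow> complex" where
  "lam k = (k + 1) / (2 * (k - 1))"

definition tau :: "complex \<Rightarrow> complex" where
  "tau k = (k - 1) / (k + 1)"

definition partial_deriv :: "complex \<Rightarrow> (complex \<Rightarrow> complex) \<Rightarrow> complex \<Rightarrow> complex" where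
  "partial_deriv b f x = frechet_derivative f (at x) b"

definition C2_on :: "complex set \<Rightarrow> (complex \<Rightarrow> complex) \<Rightarrow> bool" where
  "C2_on S f \<longleftrightarrow>
     (\<forall>x\<in>S. f differentiable (at x)) \<and>
     (\<forall>b\<in>Basis. (\<forall>x\<in>S. partial_deriv b f differentiable (at x)) \<and>
        (\<forall>b'\<in>Basis. continuous_on S (partial_deriv b' (partial_deriv b f))))"

definition harmonic_on :: "complex set \<Rightarrow> (complex \<Rightarrow> complex) \<Rightarrow> bool" where
  "harmonic_on S f \<longleftrightarrow>
     C2_on S f \<and> (\<forall>x\<in>S. (\<Sum>b\<in>Basis. partial_deriv b (partial_deriv b f) x) = 0)"

definition div_grad :: "(complex \<Rightarrow> complex) \<Rightarrow> (complex \<Rightarrow> complex) \<Rightarrow> complex \<Rightarrow> complex" where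
  "div_grad \<gamma> u x = (\<Sum>b\<in>Basis. partial_deriv b (\<lambda>y. \<gamma> y * partial_deriv b u y) x)"

(* sgn (x - c) is the outward unit normal, at x, of the circle with centre c through x.
   On the boundary of a disk with centre c this is the outward normal of the disk; it is
   also defined at nearby points, so that one-sided limits can be taken. *)

definition normal_deriv :: "complex \<Rightarrow> (complex \<Rightarrow> complex) \<Rightarrow> complex \<Rightarrow> complex" where
  "normal_deriv c u x = frechet_derivative u (at x) (sgn (x - c))"

(* u|+ = u|- and d_nu u|+ = k d_nu u|- at the boundary point p of the disk D with centre c;
   the limits are unrestricted limits from the open exterior and from D. *)

definition transmission_at ::
  "complex set \<Rightarrow> complex \<Rightarrow> complex \<Rightarrow> (complex \<Rightarrow> complex) \<Rightarrow> complex \<Rightarrow> bool" where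
  "transmission_at D c k u p \<longleftrightarrow>
     (\<exists>l. (u \<longlongrightarrow> l) (at p within - closure D) \<and> (u \<longlongrightarrow> l) (at p within D)) \<and>
     (\<exists>d_out d_in. (normal_deriv c u \<longlongrightarrow> d_out) (at p within - closure D) \<and>
                   (normal_deriv c u \<longlongrightarrow> d_in) (at p within D) \<and>
                   d_out = k * d_in)"

(* div (\<gamma> grad u) = 0 in the plane, for the piecewise constant \<gamma> with value k1, k2 in the
   disks D1, D2 with centres c1, c2 and value 1 elsewhere: the equation holds pointwise
   off the two circles, and the transmission conditions hold on them.  The values of u
   on the circles themselves play no role. *)

definition solves_conductivity_eq ::
  "complex set \<Rightarrow> complex \<Rightarrow> complex \<Rightarrow> complex set \<Rightarrow> complex \<Rightarrow> complex \<Rightarrow>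
   (complex \<Rightarrow> complex) \<Rightarrow> bool" where
  "solves_conductivity_eq D1 c1 k1 D2 c2 k2 u \<longleftrightarrow>
     C2_on (- (frontier D1 \<union> frontier D2)) u \<and>
     (\<forall>x \<in> - (frontier D1 \<union> frontier D2). div_grad (conductivity D1 D2 k1 k2) u x = 0) \<and>
     (\<forall>p \<in> frontier D1. transmission_at D1 c1 k1 u p) \<and>
     (\<forall>p \<in> frontier D2. transmission_at D2 c2 k2 u p)"

(* The remaining facts show that bipolar_left and bipolar_right really are disks of equal
   radius \<alpha> / sinh \<xi>0, centred at -\<alpha> coth \<xi>0 and \<alpha> coth \<xi>0. *)

lemma bipolar_denom_pos: "\<xi> \<noteq> 0 \<Longrightarrow> cosh \<xi> - cos \<theta> > (0::real)"
proof -
  assume "\<xi> \<noteq> 0"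
  then have "cosh \<xi> > 1"
    by (metis cosh_real_ge_1 cosh_real_one_iff order_le_less)
  then show ?thesis using cos_le_one[of \<theta>] by linarith
qed

lemma bipolar_surj:
  assumes a: "\<alpha> > 0" and z: "z \<noteq> of_real \<alpha>" "z \<noteq> - of_real \<alpha>"
  obtains \<xi> \<theta> where "\<theta> \<in> {-pi<..pi}" "z = bipolar \<alpha> \<xi> \<theta>"
proof -
  define w where "w = (z + of_real \<alpha>) / (z - of_real \<alpha>)"
  define \<xi> where "\<xi> = Re (Ln w)"
  define t where "t = Im (Ln w)"
  define \<theta> where "\<theta> = (if t = pi then pi else - t)"
  have w0: "w \<noteq> 0" using z by (auto simp: w_def add_eq_0_iff2)
  have w1: "w \<noteq> 1" using z a by (auto simp: w_def divide_eq_1_iff)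
  have zw: "z * (w - 1) = of_real \<alpha> * (w + 1)"
    using z by (simp add: w_def field_simps)
  have t: "-pi < t" "t \<le> pi" using mpi_less_Im_Ln[OF w0] Im_Ln_le_pi[OF w0] by (auto simp: t_def)
  have th: "\<theta> \<in> {-pi<..pi}" using t pi_gt_zero unfolding \<theta>_def by (auto simp del: pi_gt_zero)
  have cs: "cos \<theta> = cos t" "sin \<theta> = - sin t" by (auto simp: \<theta>_def)
  have wexp: "w = exp (Ln w)" using w0 by simp
  have Rew: "Re w = exp \<xi> * cos \<theta>"
    by (subst wexp) (simp add: Re_exp \<xi>_def cs(1) t_def)
  have Imw: "Im w = - exp \<xi> * sin \<theta>"
    by (subst wexp) (simp add: Im_exp \<xi>_def cs(2) t_def)
  have D: "cosh \<xi> - cos \<theta> \<noteq> 0"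
  proof
    assume D0: "cosh \<xi> - cos \<theta> = 0"
    then have x0: "\<xi> = 0" using bipolar_denom_pos[of \<xi> \<theta>] by auto
    then have c1: "cos \<theta> = 1" using D0 by simp
    then have "sin \<theta> = 0" using sin_cos_squared_add[of \<theta>] by simp
    then have "w = 1" using Rew Imw x0 c1 by (simp add: complex_eq_iff)
    then show False using w1 by simp
  qed
  have "bipolar \<alpha> \<xi> \<theta> * (w - 1) = of_real \<alpha> * (w + 1)"
  proof -
    define D where "D = cosh \<xi> - cos \<theta>"
    have E: "exp \<xi> = cosh \<xi> + sinh \<xi>" by (simp add: cosh_plus_sinh)
    have q: "sinh \<xi> * sinh \<xi> = cosh \<xi> * cosh \<xi> - 1"
      using cosh_square_eq[of \<xi>] by (simp add: power2_eq_square)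
    have q2: "sin \<theta> * sin \<theta> = 1 - cos \<theta> * cos \<theta>"
      using sin_squared_eq[of \<theta>] by (simp add: power2_eq_square)
    have r: "sinh \<xi> * ((cosh \<xi> + sinh \<xi>) * cos \<theta> - 1) + sin \<theta> * ((cosh \<xi> + sinh \<xi>) * sin \<theta>)
       = ((cosh \<xi> + sinh \<xi>) * cos \<theta> + 1) * D"
      unfolding D_def using q q2 by algebra
    have i: "- sinh \<xi> * ((cosh \<xi> + sinh \<xi>) * sin \<theta>) + sin \<theta> * ((cosh \<xi> + sinh \<xi>) * cos \<theta> - 1)
       = - ((cosh \<xi> + sinh \<xi>) * sin \<theta>) * D"
      unfolding D_def using q q2 by algebra
    have b: "bipolar \<alpha> \<xi> \<theta> = of_real (\<alpha> / D) * Complex (sinh \<xi>) (sin \<theta>)"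
      by (simp add: bipolar_def D_def complex_eq_iff)
    have "Complex (sinh \<xi>) (sin \<theta>) * (w - 1) = of_real D * (w + 1)"
    proof (rule complex_eqI)
      show "Re (Complex (sinh \<xi>) (sin \<theta>) * (w - 1)) = Re (of_real D * (w + 1))"
        using r Rew Imw unfolding E by simp algebra
      show "Im (Complex (sinh \<xi>) (sin \<theta>) * (w - 1)) = Im (of_real D * (w + 1))"
        using i Rew Imw unfolding E by simp algebra
    qed
    then have "bipolar \<alpha> \<xi> \<theta> * (w - 1) = of_real (\<alpha> / D) * (of_real D * (w + 1))"
      unfolding b by (metis mult.assoc)
    then show ?thesis using D by (simp add: D_def)
  qed
  then have "z = bipolar \<alpha> \<xi> \<theta>" using zw w1 by (metis mult_right_cancel right_minus_eq)
  then show ?thesis using th that by blast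
qed

lemma bipolar_power:
  assumes x: "\<xi> \<noteq> 0"
  shows "(cmod (bipolar \<alpha> \<xi> \<theta> - of_real m))\<^sup>2 * (cosh \<xi> - cos \<theta>) =
     (\<alpha>\<^sup>2 + m\<^sup>2) * cosh \<xi> + (\<alpha>\<^sup>2 - m\<^sup>2) * cos \<theta> - 2 * m * \<alpha> * sinh \<xi>"
proof -
  define D where "D = cosh \<xi> - cos \<theta>"
  have D: "D > 0" using bipolar_denom_pos[OF x] by (simp add: D_def)
  have s: "(sinh \<xi>)\<^sup>2 + (sin \<theta>)\<^sup>2 = (cosh \<xi> + cos \<theta>) * D"
    unfolding D_def by (simp add: cosh_square_eq sin_squared_eq algebra_simps power2_eq_square)
      (use cosh_square_eq[of \<xi>] in \<open>simp add: power2_eq_square\<close>)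
  have "(cmod (bipolar \<alpha> \<xi> \<theta> - of_real m))\<^sup>2 * D
      = ((\<alpha> * sinh \<xi> / D - m)\<^sup>2 + (\<alpha> * sin \<theta> / D)\<^sup>2) * D"
    by (simp add: cmod_power2 bipolar_def D_def)
  also have "\<dots> = \<alpha>\<^sup>2 * ((sinh \<xi>)\<^sup>2 + (sin \<theta>)\<^sup>2) / D - 2 * m * \<alpha> * sinh \<xi> + m\<^sup>2 * D"
    using D by (simp add: field_simps power2_eq_square)
  also have "\<dots> = \<alpha>\<^sup>2 * (cosh \<xi> + cos \<theta>) - 2 * m * \<alpha> * sinh \<xi> + m\<^sup>2 * D"
    unfolding s using D by simp
  finally show ?thesis by (simp add: D_def algebra_simps)
qed

lemma bipolar_in_ball_iff:
  assumes a: "\<alpha> > 0" and x0: "\<xi>0 > 0" and x: "\<xi> \<noteq> 0"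
  shows "bipolar \<alpha> \<xi> \<theta> \<in> ball (of_real (\<alpha> * cosh \<xi>0 / sinh \<xi>0)) (\<alpha> / sinh \<xi>0) \<longleftrightarrow> \<xi>0 < \<xi>"
proof -
  define D where "D = cosh \<xi> - cos \<theta>"
  have D: "D > 0" using bipolar_denom_pos[OF x] by (simp add: D_def)
  have s: "sinh \<xi>0 > 0" using x0 by simp
  define m where "m = \<alpha> * cosh \<xi>0 / sinh \<xi>0"
  have m: "m\<^sup>2 = \<alpha>\<^sup>2 + (\<alpha> / sinh \<xi>0)\<^sup>2"
    using s by (simp add: m_def power_divide power_mult_distrib cosh_square_eq field_simps)
  have "((cmod (bipolar \<alpha> \<xi> \<theta> - of_real m))\<^sup>2 - (\<alpha> / sinh \<xi>0)\<^sup>2) * D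
      = 2 * \<alpha> * (\<alpha> * cosh \<xi> - m * sinh \<xi>)"
    using bipolar_power[OF x, of \<alpha> \<theta> m] m unfolding D_def by algebra
  also have "\<alpha> * cosh \<xi> - m * sinh \<xi> = - (\<alpha> / sinh \<xi>0) * sinh (\<xi> - \<xi>0)"
    using s by (simp add: m_def sinh_diff field_simps)
  finally have e: "((cmod (bipolar \<alpha> \<xi> \<theta> - of_real m))\<^sup>2 - (\<alpha> / sinh \<xi>0)\<^sup>2) * D
      = - (2 * \<alpha> * \<alpha> / sinh \<xi>0 * sinh (\<xi> - \<xi>0))" by simp
  have "bipolar \<alpha> \<xi> \<theta> \<in> ball (of_real m) (\<alpha> / sinh \<xi>0) \<longleftrightarrow>
     (cmod (bipolar \<alpha> \<xi> \<theta> - of_real m))\<^sup>2 < (\<alpha> / sinh \<xi>0)\<^sup>2"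
    using a s by (auto simp: dist_norm norm_minus_commute intro: power_strict_mono power2_less_imp_less)
  also have "\<dots> \<longleftrightarrow> ((cmod (bipolar \<alpha> \<xi> \<theta> - of_real m))\<^sup>2 - (\<alpha> / sinh \<xi>0)\<^sup>2) * D < 0"
    using D by (simp add: mult_less_0_iff)
  also have "\<dots> \<longleftrightarrow> \<xi>0 < \<xi>"
  proof -
    have "2 * \<alpha> * \<alpha> / sinh \<xi>0 > 0" using a s by simp
    then show ?thesis unfolding e neg_less_0_iff_less by (simp only: zero_less_mult_iff) simp
  qed
  finally show ?thesis by (simp add: m_def)
qed

lemma bipolar_right_eq_ball:
  assumes a: "\<alpha> > 0" and x0: "\<xi>0 > 0"
  shows "bipolar_right \<alpha> \<xi>0 = ball (of_real (\<alpha> * cosh \<xi>0 / sinh \<xi>0)) (\<alpha> / sinh \<xi>0)"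
    (is "_ = ?B")
proof -
  have s: "sinh \<xi>0 > 0" using x0 by simp
  have ch: "1 < cosh \<xi>0" "cosh \<xi>0 < 1 + sinh \<xi>0"
  proof -
    show "1 < cosh \<xi>0" using bipolar_denom_pos[of \<xi>0 0] x0 by simp
    have "(cosh \<xi>0)\<^sup>2 < (1 + sinh \<xi>0)\<^sup>2"
      using s by (simp add: cosh_square_eq power2_sum)
    then show "cosh \<xi>0 < 1 + sinh \<xi>0" by (rule power2_less_imp_less) (use s in simp)
  qed
  have cm: "cmod (of_real m - of_real x) = \<bar>m - x\<bar>" for m x :: real
    by (metis norm_of_real of_real_diff)
  have foc: "of_real \<alpha> \<in> ?B"
  proof -
    have "\<alpha> * cosh \<xi>0 / sinh \<xi>0 - \<alpha> = \<alpha> / sinh \<xi>0 * (cosh \<xi>0 - sinh \<xi>0)"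
      using s by (simp add: field_simps)
    moreover have "0 < cosh \<xi>0 - sinh \<xi>0" by (simp add: cosh_minus_sinh)
    moreover have "\<alpha> / sinh \<xi>0 * (cosh \<xi>0 - sinh \<xi>0) < \<alpha> / sinh \<xi>0 * 1"
      using ch s a by (intro mult_strict_left_mono) auto
    ultimately have "\<bar>\<alpha> * cosh \<xi>0 / sinh \<xi>0 - \<alpha>\<bar> < \<alpha> / sinh \<xi>0"
      using a s by (simp add: abs_mult)
    then show ?thesis unfolding mem_ball dist_norm cm .
  qed
  have nfoc: "- of_real \<alpha> \<notin> ?B"
  proof -
    have "\<alpha> * cosh \<xi>0 / sinh \<xi>0 - (- \<alpha>) \<ge> \<alpha> / sinh \<xi>0"
      using s a ch by (simp add: field_simps) (smt (verit) mult_le_cancel_left1 mult_pos_pos)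
    then have "\<not> \<bar>\<alpha> * cosh \<xi>0 / sinh \<xi>0 - (- \<alpha>)\<bar> < \<alpha> / sinh \<xi>0" by linarith
    then show ?thesis unfolding mem_ball dist_norm of_real_minus[symmetric] cm .
  qed
  show ?thesis
  proof
    show "bipolar_right \<alpha> \<xi>0 \<subseteq> ?B"
      using foc bipolar_in_ball_iff[OF a x0] x0 by (auto simp: bipolar_right_def simp del: mem_ball)
    show "?B \<subseteq> bipolar_right \<alpha> \<xi>0"
    proof
      fix z assume z: "z \<in> ?B"
      show "z \<in> bipolar_right \<alpha> \<xi>0"
      proof (cases "z = of_real \<alpha>")
        case True then show ?thesis by (simp add: bipolar_right_def)
      next
        case False
        have "z \<noteq> - of_real \<alpha>" using z nfoc by blast
        then obtain \<xi> \<theta> where th: "\<theta> \<in> {-pi<..pi}" and zb: "z = bipolar \<alpha> \<xi> \<theta>"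
          using bipolar_surj[OF a False] by blast
        have "\<xi> \<noteq> 0"
        proof
          assume xi: "\<xi> = 0"
          define m where "m = \<alpha> * cosh \<xi>0 / sinh \<xi>0"
          have "\<alpha> / sinh \<xi>0 < m"
            using a s ch unfolding m_def by (intro divide_strict_right_mono) auto
          moreover have "m \<le> \<bar>Re (of_real m - z)\<bar>" by (simp add: zb xi bipolar_def)
          moreover have "\<bar>Re (of_real m - z)\<bar> \<le> cmod (of_real m - z)"
            by (rule abs_Re_le_cmod)
          moreover have "cmod (of_real m - z) < \<alpha> / sinh \<xi>0"
            using z unfolding mem_ball dist_norm m_def .
          ultimately show False by linarith
        qed
        then have "\<xi>0 < \<xi>" using z bipolar_in_ball_iff[OF a x0] unfolding zb by blast
        then show ?thesis using th zb by (auto simp: bipolar_right_def)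
      qed
    qed
  qed
qed

lemma bipolar_neg_xi: "bipolar \<alpha> (- \<xi>) \<theta> = - cnj (bipolar \<alpha> \<xi> \<theta>)"
  by (simp add: bipolar_def complex_eq_iff)

lemma bipolar_left_eq_image: "bipolar_left \<alpha> \<xi>0 = (\<lambda>z. - cnj z) ` bipolar_right \<alpha> \<xi>0"
proof -
  have "{bipolar \<alpha> \<xi> \<theta> | \<xi> \<theta>. \<theta> \<in> {-pi<..pi} \<and> \<xi> < - \<xi>0}
      = (\<lambda>z. - cnj z) ` {bipolar \<alpha> \<xi> \<theta> | \<xi> \<theta>. \<theta> \<in> {-pi<..pi} \<and> \<xi> > \<xi>0}" (is "?L = ?R")
  proof
    show "?R \<subseteq> ?L"
    proof
      fix z assume "z \<in> ?R"
      then obtain \<xi> \<theta> where *: "z = - cnj (bipolar \<alpha> \<xi> \<theta>)" "\<theta> \<in> {-pi<..pi}" "\<xi> > \<xi>0" by blast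
      then have "z = bipolar \<alpha> (- \<xi>) \<theta>" "- \<xi> < - \<xi>0"
        using bipolar_neg_xi[of \<alpha> \<xi> \<theta>] by auto
      then show "z \<in> ?L" using *(2) by blast
    qed
    show "?L \<subseteq> ?R"
    proof
      fix z assume "z \<in> ?L"
      then obtain \<xi> \<theta> where *: "z = bipolar \<alpha> \<xi> \<theta>" "\<theta> \<in> {-pi<..pi}" "\<xi> < - \<xi>0" by blast
      then have "z = - cnj (bipolar \<alpha> (- \<xi>) \<theta>)" "- \<xi> > \<xi>0"
        using bipolar_neg_xi[of \<alpha> "- \<xi>" \<theta>] by auto
      then show "z \<in> ?R" using *(2) by blast
    qed
  qed
  then show ?thesis by (simp add: bipolar_left_def bipolar_right_def)
qed

lemma bipolar_left_eq_ball:
  assumes a: "\<alpha> > 0" and x0: "\<xi>0 > 0"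
  shows "bipolar_left \<alpha> \<xi>0 = ball (- of_real (\<alpha> * cosh \<xi>0 / sinh \<xi>0)) (\<alpha> / sinh \<xi>0)"
proof -
  define m where "m = \<alpha> * cosh \<xi>0 / sinh \<xi>0"
  have d: "dist (- of_real m) (- cnj z) = dist (of_real m) z" for z :: complex
    by (metis complex_cnj_complex_of_real complex_cnj_diff complex_mod_cnj dist_minus dist_norm)
  have "(\<lambda>z. - cnj z) ` ball (of_real m) R = ball (- of_real m) R" for R
  proof
    show "(\<lambda>z. - cnj z) ` ball (of_real m) R \<subseteq> ball (- of_real m) R" using d by auto
    show "ball (- of_real m) R \<subseteq> (\<lambda>z. - cnj z) ` ball (of_real m) R"
    proof
      fix z :: complex assume "z \<in> ball (- of_real m) R"
      then have "- cnj z \<in> ball (of_real m) R" using d[of "- cnj z"] by simp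
      then show "z \<in> (\<lambda>z. - cnj z) ` ball (of_real m) R" by (force intro: image_eqI)
    qed
  qed
  then show ?thesis
    unfolding bipolar_left_eq_image bipolar_right_eq_ball[OF a x0] m_def by blast
qed

end

(*
  A function of the form f + conj g with f, g holomorphic satisfies both transmission conditions on a
  circle as soon as it has the shape G - tau(k) (G o R) outside and (1 - tau(k)) G inside, up to a
  common constant, where R is the reflection in the circle (Milne-Thomson's circle theorem).

  Solvability: put u = h + v1 + v2 outside the disks, v1 = - tau1 (h + v2) o R1 and
  v2 = - tau2 (h + v1) o R2 + const.  In the coordinate w = (z + alpha) / (z - alpha), of modulus e^xi,
  R1 o R2 is the dilation by kappa = e^(-4 xi0), so v2 must solve
  V(w) - tau V(kappa w) = given + const on a disk about 0.  On Taylor coefficients this divides by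
  1 - tau kappa^n, which is nonzero away from resonance and tends to 1.

  Non-solvability: at a resonance tau kappa^n = 1 the function phi = w^n + Q conj(w)^(-n) continues into
  the disks as a solution of the homogeneous problem.  Green's formula for a solution u with h(z) = z
  against phi has vanishing flux through both circles, hence through every large circle, whereas
  the latter flux is a nonzero multiple of the coefficient 2 alpha n of 1/z in w^n.  Writing
  phi = f + conj g turns the flux into contour integrals of f u_z and g conj(u_zbar), so that Cauchy's
  theorem moves the circles; only u and its normal derivative need to have boundary limits.
*)
theory Submission
  imports Defs "HOL-Complex_Analysis.Complex_Analysis"
begin


section \<open>Sums of holomorphic and antiholomorphic functions\<close>

text \<open>\<open>hol_plus_cnj\<close> is stable under holomorphic changes of variable and under
  circle reflections, so the functions built here are harmonic without second derivatives in new
  coordinates. On multiply connected sets it is narrower than harmonicity, since a logarithm may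
  occur. For this reason the unknown u of the second half is never split outside the disks and
  enters only through u_z and u_zbar, which are holomorphic and antiholomorphic there. Mode 0 is
  special: the divisor 1 - tau may vanish, as for k2 = -k1, and the condition on n \<ge> 1 does not
  exclude it. The circle theorem tolerates a constant added on both sides of a circle, so the
  equation for v2 is solved only up to a constant; one further constant restores the decay at
  infinity. At resonance phi must have the shape of the circle theorem at both circles, with w^n in
  the role of G on the left and Q conj(w)^(-n) on the right. The left circle determines Q; the right
  one then says tau kappa^n = 1. Thus phi is a test function that detects bad data, and h(z) = z is
  bad for every n, because its flux against phi never vanishes.\<close>

definition hol_plus_cnj :: "complex set \<Rightarrow> (complex \<Rightarrow> complex) \<Rightarrow> bool" where
  "hol_plus_cnj S \<phi> \<longleftrightarrow>
     (\<exists>f g. f holomorphic_on S \<and> g holomorphic_on S \<and> (\<forall>z\<in>S. \<phi> z = f z + cnj (g z)))"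

lemma hol_plus_cnjI:
  "f holomorphic_on S \<Longrightarrow> g holomorphic_on S \<Longrightarrow> (\<And>z. z \<in> S \<Longrightarrow> \<phi> z = f z + cnj (g z)) \<Longrightarrow> hol_plus_cnj S \<phi>"
  unfolding hol_plus_cnj_def by blast

lemma hol_plus_cnj_subset: "hol_plus_cnj S \<phi> \<Longrightarrow> T \<subseteq> S \<Longrightarrow> hol_plus_cnj T \<phi>"
  unfolding hol_plus_cnj_def by (meson holomorphic_on_subset subsetD)

lemma hol_plus_cnj_const: "hol_plus_cnj S (\<lambda>_. c)"
  by (rule hol_plus_cnjI[of "\<lambda>_. c" _ "\<lambda>_. 0"]) auto

lemma hol_plus_cnj_add:
  assumes "hol_plus_cnj S \<phi>" "hol_plus_cnj S \<psi>"
  shows "hol_plus_cnj S (\<lambda>z. \<phi> z + \<psi> z)"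
proof -
  obtain f g f' g' where "f holomorphic_on S" "g holomorphic_on S" "\<forall>z\<in>S. \<phi> z = f z + cnj (g z)"
    "f' holomorphic_on S" "g' holomorphic_on S" "\<forall>z\<in>S. \<psi> z = f' z + cnj (g' z)"
    using assms unfolding hol_plus_cnj_def by blast
  then show ?thesis
    by (intro hol_plus_cnjI[of "\<lambda>z. f z + f' z" _ "\<lambda>z. g z + g' z"] holomorphic_intros) auto
qed

lemma hol_plus_cnj_cmult:
  assumes "hol_plus_cnj S \<phi>"
  shows "hol_plus_cnj S (\<lambda>z. c * \<phi> z)"
proof -
  obtain f g where "f holomorphic_on S" "g holomorphic_on S" "\<forall>z\<in>S. \<phi> z = f z + cnj (g z)"
    using assms unfolding hol_plus_cnj_def by blast
  then show ?thesis
    by (intro hol_plus_cnjI[of "\<lambda>z. c * f z" _ "\<lambda>z. cnj c * g z"] holomorphic_intros)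
       (auto simp: algebra_simps)
qed

lemma hol_plus_cnj_compose:
  assumes "hol_plus_cnj S \<phi>" "p holomorphic_on T" "p ` T \<subseteq> S"
  shows "hol_plus_cnj T (\<lambda>z. \<phi> (p z))"
proof -
  obtain f g where fg: "f holomorphic_on S" "g holomorphic_on S" "\<forall>z\<in>S. \<phi> z = f z + cnj (g z)"
    using assms unfolding hol_plus_cnj_def by blast
  then show ?thesis
    using assms(2,3) holomorphic_on_compose_gen[OF assms(2) fg(1) assms(3)]
      holomorphic_on_compose_gen[OF assms(2) fg(2) assms(3)]
    by (intro hol_plus_cnjI[of "f \<circ> p" _ "g \<circ> p"]) auto
qed

text \<open>Conjugation exchanges the two summands: f o cnj is the conjugate of the holomorphic
  function cnj o f o cnj.\<close>

lemma hol_plus_cnj_compose_cnj: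
  assumes "hol_plus_cnj S \<phi>" "open S"
  shows "hol_plus_cnj (cnj ` S) (\<lambda>z. \<phi> (cnj z))"
proof -
  obtain f g where fg: "f holomorphic_on S" "g holomorphic_on S" "\<forall>z\<in>S. \<phi> z = f z + cnj (g z)"
    using assms unfolding hol_plus_cnj_def by blast
  have e: "cnj ` cnj ` S = S" by (simp add: image_image)
  have o: "open (cnj ` S)" 
  proof -
    have "cnj ` S = cnj -` S" by (auto intro: image_eqI[of _ cnj "cnj _"])
    then show ?thesis using open_vimage[OF assms(2), of cnj] by (simp add: continuous_on_cnj)
  qed
  have "(cnj \<circ> f \<circ> cnj) holomorphic_on cnj ` S" "(cnj \<circ> g \<circ> cnj) holomorphic_on cnj ` S"
    by (rule holomorphic_on_compose_cnj_cnj; use fg e o in simp)+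
  then show ?thesis
    by (intro hol_plus_cnjI[of "cnj \<circ> g \<circ> cnj" _ "cnj \<circ> f \<circ> cnj"]) (use fg in auto)
qed

lemma hol_plus_cnj_has_derivative:
  assumes "open S" "f holomorphic_on S" "g holomorphic_on S" "\<And>z. z \<in> S \<Longrightarrow> \<phi> z = f z + cnj (g z)" "z \<in> S"
  shows "(\<phi> has_derivative (\<lambda>h. deriv f z * h + cnj (deriv g z * h))) (at z)"
proof -
  have "(f has_derivative (\<lambda>h. deriv f z * h)) (at z)" "(g has_derivative (\<lambda>h. deriv g z * h)) (at z)"
    using assms holomorphic_derivI[of f S z] holomorphic_derivI[of g S z]
    by (auto simp: has_field_derivative_def)
  then have "((\<lambda>z. f z + cnj (g z)) has_derivative (\<lambda>h. deriv f z * h + cnj (deriv g z * h))) (at z)"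
    by (auto intro!: derivative_eq_intros)
  then show ?thesis
    by (rule has_derivative_transform_within_open[OF _ assms(1,5)]) (use assms(4) in auto)
qed

lemma hol_plus_cnj_partial_deriv:
  assumes "open S" "f holomorphic_on S" "g holomorphic_on S" "\<And>z. z \<in> S \<Longrightarrow> \<phi> z = f z + cnj (g z)" "z \<in> S"
  shows "partial_deriv b \<phi> z = deriv f z * b + cnj (deriv g z * b)"
  unfolding partial_deriv_def
  using frechet_derivative_at[OF hol_plus_cnj_has_derivative[OF assms]] by metis

lemma hol_plus_cnj_differentiable:
  "open S \<Longrightarrow> hol_plus_cnj S \<phi> \<Longrightarrow> z \<in> S \<Longrightarrow> \<phi> differentiable (at z)"
  unfolding hol_plus_cnj_def differentiable_def using hol_plus_cnj_has_derivative by metis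

lemma hol_plus_cnj_continuous_on: "hol_plus_cnj S \<phi> \<Longrightarrow> continuous_on S \<phi>"
  unfolding hol_plus_cnj_def
  by (metis (no_types, lifting) continuous_on_add continuous_on_cnj continuous_on_cong holomorphic_on_imp_continuous_on)

lemma hol_plus_cnj_partial:
  assumes "open S" "hol_plus_cnj S \<phi>"
  shows "hol_plus_cnj S (partial_deriv b \<phi>)"
proof -
  obtain f g where fg: "f holomorphic_on S" "g holomorphic_on S" "\<And>z. z \<in> S \<Longrightarrow> \<phi> z = f z + cnj (g z)"
    using assms unfolding hol_plus_cnj_def by blast
  show ?thesis
    by (rule hol_plus_cnjI[of "\<lambda>z. deriv f z * b" _ "\<lambda>z. deriv g z * b"])
       (use hol_plus_cnj_partial_deriv[OF assms(1) fg] fg assms in \<open>auto intro!: holomorphic_intros\<close>)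
qed

text \<open>The second derivative in direction b is f'' b^2 + conj (g'' b^2), and the sum of b^2
  over the basis is 1 + \<i>^2 = 0.\<close>

lemma hol_plus_cnj_harmonic:
  assumes "open S" "hol_plus_cnj S \<phi>"
  shows "harmonic_on S \<phi>"
proof -
  obtain f g where fg: "f holomorphic_on S" "g holomorphic_on S" "\<And>z. z \<in> S \<Longrightarrow> \<phi> z = f z + cnj (g z)"
    using assms unfolding hol_plus_cnj_def by blast
  have p: "partial_deriv b (partial_deriv b \<phi>) z = deriv (\<lambda>z. deriv f z * b) z * b + cnj (deriv (\<lambda>z. deriv g z * b) z * b)"
    if "z \<in> S" for z b
    by (rule hol_plus_cnj_partial_deriv[OF assms(1) _ _ hol_plus_cnj_partial_deriv[OF assms(1) fg]])
       (use that in \<open>auto intro!: holomorphic_intros fg assms\<close>)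
  have q: "deriv (\<lambda>z. deriv k z * b) z = deriv (deriv k) z * b" if "k holomorphic_on S" "z \<in> S" for k z b
    by (rule deriv_cmult_right) (use that assms holomorphic_deriv holomorphic_on_imp_differentiable_at in blast)
  have "(\<Sum>b\<in>Basis. partial_deriv b (partial_deriv b \<phi>) x) = 0" if "x \<in> S" for x
    using that fg by (simp add: p q Basis_complex_def mult.assoc)
  then show ?thesis
    unfolding harmonic_on_def C2_on_def
    using assms hol_plus_cnj_partial hol_plus_cnj_differentiable hol_plus_cnj_continuous_on by metis
qed

section \<open>Symmetry of second derivatives and the Wirtinger derivative\<close>

text \<open>The mean value inequality is applied in the direction u only, to the increment in the
  direction v. Hence f' has to exist near p, while the second derivative \<open>F\<close> enters at
  the single point p.\<close>

lemma second_difference_limit: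
  fixes f :: "'a::real_normed_vector \<Rightarrow> 'b::real_inner"
  assumes S: "open S" "p \<in> S"
    and f': "\<And>x. x \<in> S \<Longrightarrow> (f has_derivative f' x) (at x)"
    and F: "((\<lambda>x. f' x u) has_derivative F) (at p)"
  shows "((\<lambda>t::real. (f (p + t *\<^sub>R u + t *\<^sub>R v) - f (p + t *\<^sub>R u) - f (p + t *\<^sub>R v) + f p) /\<^sub>R t\<^sup>2) \<longlongrightarrow> F v) (at_right 0)"
proof (rule tendstoI)
  fix e :: real assume e: "e > 0"
  \<comment> \<open>The factor 2 pays for the remainders at both ends of the v-increment; the
    summand 1 keeps K positive when u = v = 0.\<close>
  define K where "K = 2 * (norm u + norm v) + 1"
  have K: "K > 0" by (simp add: K_def add_nonneg_pos)
  define e' where "e' = e / K / 2"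
  have e': "e' > 0" "e' * K < e" using e K by (auto simp: e'_def)
  obtain d1 where d1: "d1 > 0" "ball p d1 \<subseteq> S" using S openE by blast
  obtain d2 where d2: "d2 > 0" "\<And>y. norm (y - p) < d2 \<Longrightarrow> norm (f' y u - f' p u - F (y - p)) \<le> e' * norm (y - p)"
    using F e' unfolding has_derivative_at_alt by blast
  have linF: "linear F" using F has_derivative_linear by blast
  define d where "d = min d1 d2 / K"
  have d: "d > 0" using d1 d2 K by (simp add: d_def)
  have "dist ((f (p + t *\<^sub>R u + t *\<^sub>R v) - f (p + t *\<^sub>R u) - f (p + t *\<^sub>R v) + f p) /\<^sub>R t\<^sup>2) (F v) < e"
    if t: "t > 0" "t < d" for t :: real
  proof -
    have tK: "t * K < min d1 d2" using t K by (simp add: d_def field_simps)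
    have n1: "norm ((s * t) *\<^sub>R u + (q * t) *\<^sub>R v) \<le> t * (norm u + norm v)" if "0 \<le> s" "s \<le> 1" "0 \<le> q" "q \<le> 1" for s q
    proof -
      have "norm ((s * t) *\<^sub>R u + (q * t) *\<^sub>R v) \<le> s * t * norm u + q * t * norm v"
        using that t by (intro order_trans[OF norm_triangle_ineq]) simp
      also have "\<dots> \<le> 1 * t * norm u + 1 * t * norm v"
        using that t by (intro add_mono mult_right_mono) auto
      finally show ?thesis by (simp add: algebra_simps)
    qed
    have "t * (norm u + norm v) \<le> t * K" using t by (intro mult_left_mono) (auto simp: K_def intro: add_nonneg_nonneg)
    then have nd: "norm ((s * t) *\<^sub>R u + (q * t) *\<^sub>R v) < min d1 d2" if "0 \<le> s" "s \<le> 1" "0 \<le> q" "q \<le> 1" for s q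
      using n1[OF that] tK by linarith
    have inS: "p + (s * t) *\<^sub>R u + (q * t) *\<^sub>R v \<in> S" if "0 \<le> s" "s \<le> 1" "0 \<le> q" "q \<le> 1" for s q
      using nd[OF that] d1(2) by (auto simp: subset_iff dist_norm norm_minus_commute add.assoc)
    \<comment> \<open>Increment of f in the direction v along the segment s from p to p + t u, minus
      its linear prediction. Then k 1 - k 0 is the second difference minus t^2 F v, and the two
      first-order terms cancel in k'.\<close>
    define k where "k s = f (p + (s * t) *\<^sub>R u + (1 * t) *\<^sub>R v) - f (p + (s * t) *\<^sub>R u + (0 * t) *\<^sub>R v) - (s * t\<^sup>2) *\<^sub>R F v" for s
    define k' where "k' s = t *\<^sub>R f' (p + (s * t) *\<^sub>R u + (1 * t) *\<^sub>R v) u - t *\<^sub>R f' (p + (s * t) *\<^sub>R u + (0 * t) *\<^sub>R v) u - t\<^sup>2 *\<^sub>R F v" for s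
    have der: "(k has_derivative (\<lambda>h. h *\<^sub>R k' s)) (at s)" if s: "0 \<le> s" "s \<le> 1" for s
    proof -
      have "((\<lambda>s. f (p + (s * t) *\<^sub>R u + (q * t) *\<^sub>R v)) has_derivative (\<lambda>h. f' (p + (s * t) *\<^sub>R u + (q * t) *\<^sub>R v) ((h * t) *\<^sub>R u))) (at s)"
        if q: "0 \<le> q" "q \<le> 1" for q
      proof (rule has_derivative_compose[of "\<lambda>s. p + (s * t) *\<^sub>R u + (q * t) *\<^sub>R v"])
        show "((\<lambda>s. p + (s * t) *\<^sub>R u + (q * t) *\<^sub>R v) has_derivative (\<lambda>h. (h * t) *\<^sub>R u)) (at s)"
          by (auto intro!: derivative_eq_intros)
      qed (rule f'[OF inS[OF s q]])
      note * = this
      have lin: "f' (p + (s * t) *\<^sub>R u + (q * t) *\<^sub>R v) ((h * t) *\<^sub>R u) = (h * t) *\<^sub>R f' (p + (s * t) *\<^sub>R u + (q * t) *\<^sub>R v) u"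
        if q: "0 \<le> q" "q \<le> 1" for q h
        using linear_scale[OF has_derivative_linear[OF f'[OF inS[OF s q]]]] .
      show ?thesis
        unfolding k_def k'_def
        by (rule derivative_eq_intros *[of 1] *[of 0] refl | simp)+
           (use lin[of 1] lin[of 0] in \<open>auto simp: fun_eq_iff algebra_simps power2_eq_square\<close>)
    qed
    have "continuous_on {0..1} k"
      by (rule continuous_at_imp_continuous_on) (use der has_derivative_continuous in fastforce)
    then obtain s where s: "s \<in> {0<..<1}" "norm (k 1 - k 0) \<le> norm ((1 - 0) *\<^sub>R k' s)"
      using mvt_general[of 0 1 k "\<lambda>s h. h *\<^sub>R k' s"] der by fastforce
    have s01: "0 \<le> s" "s \<le> 1" using s by auto
    define R where "R y = f' y u - f' p u - F (y - p)" for y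
    let ?y1 = "p + (s * t) *\<^sub>R u + (1 * t) *\<^sub>R v" and ?y0 = "p + (s * t) *\<^sub>R u + (0 * t) *\<^sub>R v"
    have "?y1 - p = ?y0 - p + t *\<^sub>R v" by simp
    then have Fd: "F (?y1 - p) = F (?y0 - p) + t *\<^sub>R F v"
      by (metis linear_add[OF linF] linear_scale[OF linF])
    have "k' s = t *\<^sub>R (R ?y1 - R ?y0)"
      unfolding k'_def R_def Fd by (simp add: algebra_simps power2_eq_square)
    then have "norm (k' s) = t * norm (R ?y1 - R ?y0)" using t by simp
    also have "\<dots> \<le> t * (norm (R ?y1) + norm (R ?y0))"
      using t by (intro mult_left_mono norm_triangle_ineq4) auto
    also have "\<dots> \<le> t * (e' * (t * (norm u + norm v)) + e' * (t * (norm u + norm v)))"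
    proof (intro mult_left_mono add_mono)
      show "norm (R ?y1) \<le> e' * (t * (norm u + norm v))"
        unfolding R_def
        by (rule order_trans[OF d2(2)]) (use nd[OF s01, of 1] n1[OF s01, of 1] e' in \<open>auto simp: add.assoc\<close>)
      show "norm (R ?y0) \<le> e' * (t * (norm u + norm v))"
        unfolding R_def
        by (rule order_trans[OF d2(2)]) (use nd[OF s01, of 0] n1[OF s01, of 0] e' in \<open>auto simp: add.assoc\<close>)
    qed (use t in auto)
    also have "\<dots> \<le> t\<^sup>2 * (e' * K)"
      using e' by (simp add: K_def algebra_simps power2_eq_square)
    also have "\<dots> < t\<^sup>2 * e" using e' t by (intro mult_strict_left_mono) auto
    finally have "norm (k 1 - k 0) < t\<^sup>2 * e" using s by simp
    moreover have "k 1 - k 0 = (f (p + t *\<^sub>R u + t *\<^sub>R v) - f (p + t *\<^sub>R u) - f (p + t *\<^sub>R v) + f p) - t\<^sup>2 *\<^sub>R F v"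
      by (simp add: k_def)
    moreover have "(f (p + t *\<^sub>R u + t *\<^sub>R v) - f (p + t *\<^sub>R u) - f (p + t *\<^sub>R v) + f p) /\<^sub>R t\<^sup>2 - F v
       = ((f (p + t *\<^sub>R u + t *\<^sub>R v) - f (p + t *\<^sub>R u) - f (p + t *\<^sub>R v) + f p) - t\<^sup>2 *\<^sub>R F v) /\<^sub>R t\<^sup>2"
      using t by (simp add: scaleR_right_diff_distrib)
    moreover have "norm (y /\<^sub>R t\<^sup>2) < e" if "norm y < t\<^sup>2 * e" for y :: 'b
      using that t by (simp add: field_simps)
    ultimately show ?thesis unfolding dist_norm by metis
  qed
  then show "\<forall>\<^sub>F t in at_right 0. dist ((f (p + t *\<^sub>R u + t *\<^sub>R v) - f (p + t *\<^sub>R u) - f (p + t *\<^sub>R v) + f p) /\<^sub>R t\<^sup>2) (F v) < e"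
    unfolding eventually_at_right_field using d by blast
qed

text \<open>The second difference is unchanged when u and v are exchanged, so its limit can be
  computed in both orders. This is Schwarz's theorem in the form that needs differentiability of the
  first derivatives at p only.\<close>

lemma second_derivative_symmetric:
  fixes f :: "'a::real_normed_vector \<Rightarrow> 'b::real_inner"
  assumes S: "open S" "p \<in> S"
    and f': "\<And>x. x \<in> S \<Longrightarrow> (f has_derivative f' x) (at x)"
    and F: "((\<lambda>x. f' x u) has_derivative F) (at p)"
    and G: "((\<lambda>x. f' x v) has_derivative G) (at p)"
  shows "F v = G u"
proof -
  have "((\<lambda>t::real. (f (p + t *\<^sub>R v + t *\<^sub>R u) - f (p + t *\<^sub>R v) - f (p + t *\<^sub>R u) + f p) /\<^sub>R t\<^sup>2) \<longlongrightarrow> F v) (at_right 0)"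
    using second_difference_limit[OF S f' F, of v] by (simp add: algebra_simps)
  then show ?thesis
    using second_difference_limit[OF S f' G, of u] tendsto_unique trivial_limit_at_right_real by blast
qed


text \<open>The derivative $\partial u/\partial z$; the other one, $\partial u/\partial\bar z$, is the conjugate of dz applied to the conjugate of u.\<close>

definition dz :: "(complex \<Rightarrow> complex) \<Rightarrow> complex \<Rightarrow> complex" where
  "dz u z = (partial_deriv 1 u z - \<i> * partial_deriv \<i> u z) / 2"

lemma linear_complex_expand:
  assumes "linear (D :: complex \<Rightarrow> complex)"
  shows "D h = of_real (Re h) * D 1 + of_real (Im h) * D \<i>"
proof -
  have "D h = D (Re h *\<^sub>R 1 + Im h *\<^sub>R \<i>)"
    by (rule arg_cong[of _ _ D]) (simp add: complex_eq_iff)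
  also have "\<dots> = Re h *\<^sub>R D 1 + Im h *\<^sub>R D \<i>"
    by (simp only: linear_add[OF assms] linear_scale[OF assms])
  finally show ?thesis by (simp add: scaleR_conv_of_real)
qed

lemma has_derivative_partials:
  assumes "u differentiable (at z)"
  shows "(u has_derivative (\<lambda>h. of_real (Re h) * partial_deriv 1 u z + of_real (Im h) * partial_deriv \<i> u z)) (at z)"
proof -
  have 1: "(u has_derivative frechet_derivative u (at z)) (at z)"
    using assms frechet_derivative_works by blast
  have "frechet_derivative u (at z) = (\<lambda>h. of_real (Re h) * partial_deriv 1 u z + of_real (Im h) * partial_deriv \<i> u z)"
    unfolding partial_deriv_def using linear_complex_expand[OF has_derivative_linear[OF 1]] by blast
  then show ?thesis using 1 by simp
qed

lemma partial_deriv_cnj: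
  assumes "u differentiable (at z)"
  shows "partial_deriv b (\<lambda>x. cnj (u x)) z = cnj (partial_deriv b u z)"
proof -
  have 1: "(u has_derivative frechet_derivative u (at z)) (at z)"
    using assms frechet_derivative_works by blast
  have "((\<lambda>x. cnj (u x)) has_derivative (\<lambda>h. cnj (frechet_derivative u (at z) h))) (at z)"
    by (rule derivative_eq_intros 1 refl)+
  from frechet_derivative_at[OF this] show ?thesis unfolding partial_deriv_def by metis
qed

lemma partial_deriv_cong:
  assumes "open S" "z \<in> S" "\<And>x. x \<in> S \<Longrightarrow> f x = g x"
  shows "partial_deriv b f z = partial_deriv b g z"
proof -
  have "(f has_derivative D) (at z) \<longleftrightarrow> (g has_derivative D) (at z)" for D
    using has_derivative_transform_within_open[OF _ assms(1,2)] assms(3) by metis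
  then show ?thesis by (simp add: partial_deriv_def frechet_derivative_def)
qed

lemma differentiable_cong_open:
  fixes f :: "complex \<Rightarrow> complex"
  assumes "open S" "z \<in> S" "\<And>x. x \<in> S \<Longrightarrow> f x = g x" "f differentiable (at z)"
  shows "g differentiable (at z)"
  using assms has_derivative_transform_within_open[OF _ assms(1,2)] unfolding differentiable_def by metis

lemma harmonic_on_cnj:
  assumes "open S" "harmonic_on S u"
  shows "harmonic_on S (\<lambda>z. cnj (u z))"
proof -
  have u: "\<And>z. z \<in> S \<Longrightarrow> u differentiable (at z)"
    "\<And>z b. z \<in> S \<Longrightarrow> b \<in> Basis \<Longrightarrow> partial_deriv b u differentiable (at z)"
    "\<And>b b'. b \<in> Basis \<Longrightarrow> b' \<in> Basis \<Longrightarrow> continuous_on S (partial_deriv b' (partial_deriv b u))"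
    "\<And>z. z \<in> S \<Longrightarrow> (\<Sum>b\<in>Basis. partial_deriv b (partial_deriv b u) z) = 0"
    using assms unfolding harmonic_on_def C2_on_def by auto
  have d: "(\<lambda>x. cnj (f x)) differentiable (at z)" if "f differentiable (at z)" for f :: "complex \<Rightarrow> complex" and z
    using that unfolding differentiable_def by (blast intro: has_derivative_cnj)
  have p1: "partial_deriv b (\<lambda>x. cnj (u x)) z = cnj (partial_deriv b u z)" if "z \<in> S" for z b
    using partial_deriv_cnj u(1) that by blast
  have p2: "partial_deriv b' (partial_deriv b (\<lambda>x. cnj (u x))) z = cnj (partial_deriv b' (partial_deriv b u) z)"
    if "z \<in> S" "b \<in> Basis" for z b b'
    by (rule trans[OF partial_deriv_cong[OF assms(1) that(1) p1] partial_deriv_cnj[OF u(2)[OF that]]])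
  have s: "(\<Sum>b\<in>Basis. partial_deriv b (partial_deriv b (\<lambda>x. cnj (u x))) z) = 0" if "z \<in> S" for z
  proof -
    have "(\<Sum>b\<in>Basis. partial_deriv b (partial_deriv b (\<lambda>x. cnj (u x))) z) = cnj (\<Sum>b\<in>Basis. partial_deriv b (partial_deriv b u) z)"
      unfolding cnj_sum using p2[OF that] by (intro sum.cong) auto
    then show ?thesis using u(4) that by simp
  qed
  have c: "continuous_on S (partial_deriv b' (partial_deriv b (\<lambda>x. cnj (u x))))" if "b \<in> Basis" "b' \<in> Basis" for b b'
    by (rule continuous_on_eq[OF continuous_on_cnj[OF u(3)[OF that]]]) (simp add: p2 that)
  have e: "partial_deriv b (\<lambda>x. cnj (u x)) differentiable (at z)" if "z \<in> S" "b \<in> Basis" for z b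
    by (rule differentiable_cong_open[OF assms(1) that(1) _ d[OF u(2)[OF that]]]) (simp add: p1)
  show ?thesis
    unfolding harmonic_on_def C2_on_def using s c e d u(1) by blast
qed

lemma dz_cnj:
  assumes "u differentiable (at z)"
  shows "cnj (dz (\<lambda>x. cnj (u x)) z) = (partial_deriv 1 u z + \<i> * partial_deriv \<i> u z) / 2"
  by (simp add: dz_def partial_deriv_cnj[OF assms])

lemma has_derivative_dz:
  assumes "u differentiable (at z)"
  shows "(u has_derivative (\<lambda>h. dz u z * h + cnj (dz (\<lambda>x. cnj (u x)) z * h))) (at z)"
proof -
  have "of_real (Re h) * p + of_real (Im h) * q = (p - \<i> * q) / 2 * h + (p + \<i> * q) / 2 * cnj h" for p q h
    by (simp add: complex_eq_iff algebra_simps add_divide_distrib diff_divide_distrib)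
  then have "dz u z * h + cnj (dz (\<lambda>x. cnj (u x)) z * h)
      = of_real (Re h) * partial_deriv 1 u z + of_real (Im h) * partial_deriv \<i> u z" for h
    unfolding complex_cnj_mult dz_cnj[OF assms] unfolding dz_def by simp
  then show ?thesis using has_derivative_partials[OF assms] by presburger
qed

lemma frechet_derivative_dz:
  assumes "u differentiable (at z)"
  shows "frechet_derivative u (at z) h = dz u z * h + cnj (dz (\<lambda>x. cnj (u x)) z * h)"
  using frechet_derivative_at[OF has_derivative_dz[OF assms]] by metis

text \<open>The Cauchy-Riemann equations for u_z are Laplace's equation together with the equality
  of the mixed partial derivatives.\<close>

lemma harmonic_on_dz_holomorphic:
  assumes "open S" "harmonic_on S u"
  shows "dz u holomorphic_on S"
  unfolding holomorphic_on_def
proof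
  fix z assume z: "z \<in> S"
  have u: "\<And>z. z \<in> S \<Longrightarrow> u differentiable (at z)"
    "\<And>z b. z \<in> S \<Longrightarrow> b \<in> Basis \<Longrightarrow> partial_deriv b u differentiable (at z)"
    "\<And>z. z \<in> S \<Longrightarrow> (\<Sum>b\<in>Basis. partial_deriv b (partial_deriv b u) z) = 0"
    using assms unfolding harmonic_on_def C2_on_def by auto
  define P where "P b = frechet_derivative (partial_deriv b u) (at z)" for b
  have P: "(partial_deriv b u has_derivative P b) (at z)" if "b \<in> Basis" for b
    using u(2)[OF z that] unfolding P_def frechet_derivative_works .
  have P1: "(partial_deriv 1 u has_derivative P 1) (at z)" and Pi: "(partial_deriv \<i> u has_derivative P \<i>) (at z)"
    using P by (auto simp: Basis_complex_def)
  have lap: "P 1 1 + P \<i> \<i> = 0"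
    using u(3)[OF z] by (simp add: P_def partial_deriv_def[symmetric] Basis_complex_def)
  have sym: "P 1 \<i> = P \<i> 1"
    by (rule second_derivative_symmetric[OF assms(1) z, of u "\<lambda>x. frechet_derivative u (at x)" 1 "P 1" \<i> "P \<i>"])
       (use u(1) P1 Pi in \<open>simp_all add: partial_deriv_def[abs_def] frechet_derivative_works[symmetric]\<close>)
  have e1: "P 1 h = of_real (Re h) * P 1 1 + of_real (Im h) * P \<i> 1" for h
    using linear_complex_expand[OF has_derivative_linear[OF P1], of h] unfolding sym .
  have e2: "P \<i> h = of_real (Re h) * P \<i> 1 - of_real (Im h) * P 1 1" for h
  proof -
    have "P \<i> \<i> = - P 1 1" using lap by (simp add: add_eq_0_iff)
    then show ?thesis
      using linear_complex_expand[OF has_derivative_linear[OF Pi], of h] by (metis diff_minus_eq_add minus_diff_eq mult_minus_right uminus_add_conv_diff add.commute)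
  qed
  have "(dz u has_derivative (\<lambda>h. (P 1 h - \<i> * P \<i> h) / 2)) (at z)"
    unfolding dz_def by (rule derivative_eq_intros P1 Pi refl | simp)+
  moreover have "(P 1 h - \<i> * P \<i> h) / 2 = (P 1 1 - \<i> * P \<i> 1) / 2 * h" for h
    unfolding e1[of h] e2[of h] by (simp add: complex_eq_iff algebra_simps add_divide_distrib diff_divide_distrib)
  then have "(\<lambda>h. (P 1 h - \<i> * P \<i> h) / 2) = (\<lambda>h. (P 1 1 - \<i> * P \<i> 1) / 2 * h)" by blast
  ultimately have "(dz u has_field_derivative (P 1 1 - \<i> * P \<i> 1) / 2) (at z)"
    unfolding has_field_derivative_def by argo
  then show "dz u field_differentiable at z within S"
    using field_differentiable_at_within field_differentiable_def by blast
qed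

text \<open>Convexity gives a primitive F of the holomorphic function u_z; then u - F has vanishing
  z-derivative and is therefore antiholomorphic.\<close>

lemma harmonic_on_convex_imp_hol_plus_cnj:
  assumes "open S" "convex S" "harmonic_on S u"
  shows "hol_plus_cnj S u"
proof -
  obtain F where F: "\<And>x. x \<in> S \<Longrightarrow> (F has_field_derivative dz u x) (at x within S)"
    using holomorphic_convex_primitive'[OF assms(2,1) harmonic_on_dz_holomorphic[OF assms(1,3)]] by blast
  have F': "(F has_field_derivative dz u x) (at x)" if "x \<in> S" for x
    using F[OF that] unfolding at_within_open[OF that assms(1)] .
  define G where "G z = cnj (u z - F z)" for z
  have G: "(G has_field_derivative dz (\<lambda>x. cnj (u x)) x) (at x)" if "x \<in> S" for x
  proof -
    have "u differentiable (at x)" using assms(3) that by (auto simp: harmonic_on_def C2_on_def)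
    from has_derivative_dz[OF this] F'[OF that]
    have "(G has_derivative (\<lambda>h. cnj ((dz u x * h + cnj (dz (\<lambda>x. cnj (u x)) x * h)) - dz u x * h))) (at x)"
      unfolding G_def has_field_derivative_def by (intro has_derivative_cnj has_derivative_diff)
    then show ?thesis by (simp add: has_field_derivative_def)
  qed
  have "F holomorphic_on S" "G holomorphic_on S"
    using F' G assms(1) by (auto simp: holomorphic_on_open field_differentiable_def)
  then show ?thesis by (rule hol_plus_cnjI) (simp add: G_def)
qed

text \<open>Serves both one-sided limits on a circle: T is the side from which p is
  approached.\<close>

lemma hol_plus_cnj_tendsto_normal_deriv:
  assumes "open S" "hol_plus_cnj S \<phi>" "p \<in> S" "p \<noteq> c"
  shows "(normal_deriv c \<phi> \<longlongrightarrow> frechet_derivative \<phi> (at p) (sgn (p - c))) (at p within T)"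
proof -
  obtain f g where fg: "f holomorphic_on S" "g holomorphic_on S" "\<And>z. z \<in> S \<Longrightarrow> \<phi> z = f z + cnj (g z)"
    using assms(2) unfolding hol_plus_cnj_def by blast
  have e: "frechet_derivative \<phi> (at z) h = deriv f z * h + cnj (deriv g z * h)" if "z \<in> S" for z h
    using frechet_derivative_at[OF hol_plus_cnj_has_derivative[OF assms(1) fg that]] by metis
  have "deriv f holomorphic_on S" "deriv g holomorphic_on S" using fg assms(1) by (auto intro: holomorphic_deriv)
  then have "isCont (deriv f) p" "isCont (deriv g) p"
    using assms(1,3) by (auto dest!: holomorphic_on_imp_continuous_on simp: continuous_on_eq_continuous_at)
  then have "((\<lambda>z. deriv f z * sgn (z - c) + cnj (deriv g z * sgn (z - c))) \<longlongrightarrow>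
     deriv f p * sgn (p - c) + cnj (deriv g p * sgn (p - c))) (at p)"
    unfolding isCont_def using assms(4) by (intro tendsto_intros) auto
  then have "(normal_deriv c \<phi> \<longlongrightarrow> deriv f p * sgn (p - c) + cnj (deriv g p * sgn (p - c))) (at p)"
    by (rule Lim_transform_within_open[OF _ assms(1,3)]) (simp add: normal_deriv_def e)
  then show ?thesis
    unfolding e[OF assms(3)] by (rule tendsto_within_subset) simp
qed


section \<open>Reflection in a circle and the transmission conditions\<close>

text \<open>Inversion in the circle of centre c and radius r. Division by zero makes it fix the
  centre, where inversion would give infinity; later regions therefore omit centres.\<close>

definition circle_refl :: "complex \<Rightarrow> real \<Rightarrow> complex \<Rightarrow> complex" where
  "circle_refl c r z = c + of_real (r\<^sup>2) / cnj (z - c)"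

lemma circle_refl_fixed:
  assumes "dist c p = r" "r > 0"
  shows "circle_refl c r p = p"
proof -
  have "of_real (r\<^sup>2) = (p - c) * cnj (p - c)"
    using assms complex_norm_square[of "p - c"] by (simp only: dist_norm norm_minus_commute)
  moreover have "cnj (p - c) \<noteq> 0" using assms by auto
  ultimately show ?thesis unfolding circle_refl_def by simp
qed

lemma circle_refl_has_derivative:
  assumes "p \<noteq> c"
  shows "(circle_refl c r has_derivative (\<lambda>h. - of_real (r\<^sup>2) * cnj h / (cnj (p - c))\<^sup>2)) (at p)"
proof -
  have "((\<lambda>z. c + of_real (r\<^sup>2) / cnj (z - c)) has_derivative (\<lambda>h. - of_real (r\<^sup>2) * cnj h / (cnj (p - c))\<^sup>2)) (at p)"
    using assms
    by (auto intro!: derivative_eq_intros simp: fun_eq_iff field_simps power2_eq_square)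
  then show ?thesis by (simp add: circle_refl_def[abs_def])
qed

text \<open>The left side is the differential of the reflection applied to the unit normal, so
  reflection reverses the normal direction. With the unit vector e in place of the normal the
  formula reduces to 1 / conj e = e.\<close>

lemma circle_refl_normal:
  assumes "dist c p = r" "r > 0"
  shows "- of_real (r\<^sup>2) * cnj (sgn (p - c)) / (cnj (p - c))\<^sup>2 = - sgn (p - c)"
proof -
  have n: "norm (p - c) = r" using assms by (simp add: dist_norm norm_minus_commute)
  define e where "e = sgn (p - c)"
  have pc: "p - c = of_real r * e" using n assms by (simp add: e_def sgn_eq)
  have ne: "norm e = 1" using n assms by (auto simp: e_def norm_sgn)
  have ee: "e * cnj e = 1" using ne by (simp add: complex_norm_square[symmetric])
  have e0: "cnj e \<noteq> 0" using ne by auto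
  have "- of_real (r\<^sup>2) * cnj e / (cnj (p - c))\<^sup>2 = - (1 / cnj e)"
    unfolding pc using assms(2) e0 by (simp add: field_simps power2_eq_square)
  also have "1 / cnj e = e" using ee e0 by (simp add: field_simps)
  finally show ?thesis unfolding e_def .
qed

lemma hol_plus_cnj_circle_refl:
  assumes "hol_plus_cnj S \<phi>" "open S" "c \<notin> T" "circle_refl c r ` T \<subseteq> S"
  shows "hol_plus_cnj T (\<lambda>z. \<phi> (circle_refl c r z))"
proof -
  let ?s = "\<lambda>z. cnj c + of_real (r\<^sup>2) / (z - c)"
  have "hol_plus_cnj T (\<lambda>z. \<phi> (cnj (?s z)))"
  proof (rule hol_plus_cnj_compose[OF hol_plus_cnj_compose_cnj[OF assms(1,2)]])
    show "?s holomorphic_on T" using assms(3) by (intro holomorphic_intros) auto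
    show "?s ` T \<subseteq> cnj ` S"
    proof
      fix w assume "w \<in> ?s ` T"
      then have "cnj w \<in> S" using assms(4) by (auto simp: circle_refl_def)
      then show "w \<in> cnj ` S" by (metis complex_cnj_cnj image_eqI)
    qed
  qed
  then show ?thesis by (simp add: circle_refl_def)
qed

text \<open>The reflection fixes p and reverses the normal, so the normal derivative of the
  reflected term is minus that of G, and the factor 1 - t for values becomes 1 + t for normal
  derivatives.\<close>

lemma frechet_derivative_reflected:
  assumes p: "dist c p = r" "r > 0" and T: "open T" "p \<in> T" and G: "hol_plus_cnj T G"
    and H: "\<And>z. z \<in> T \<Longrightarrow> H z = G z - t * G (circle_refl c r z) + C"
  shows "frechet_derivative H (at p) (sgn (p - c)) = (1 + t) * frechet_derivative G (at p) (sgn (p - c))"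
proof -
  have pc: "p \<noteq> c" using p by auto
  define D where "D = frechet_derivative G (at p)"
  have D: "(G has_derivative D) (at p)"
    using hol_plus_cnj_differentiable[OF T(1) G T(2)] frechet_derivative_works D_def by blast
  have lin: "D (- x) = - D x" for x using D has_derivative_linear linear_neg by blast
  have GR: "((\<lambda>z. G (circle_refl c r z)) has_derivative (\<lambda>h. D (- of_real (r\<^sup>2) * cnj h / (cnj (p - c))\<^sup>2))) (at p)"
    by (rule has_derivative_compose[OF circle_refl_has_derivative[OF pc]]) (simp add: circle_refl_fixed[OF p] D)
  have "((\<lambda>z. G z - t * G (circle_refl c r z) + C) has_derivative
     (\<lambda>h. D h - t * D (- of_real (r\<^sup>2) * cnj h / (cnj (p - c))\<^sup>2))) (at p)"
    by (rule derivative_eq_intros D GR refl | simp)+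
  then have "(H has_derivative (\<lambda>h. D h - t * D (- of_real (r\<^sup>2) * cnj h / (cnj (p - c))\<^sup>2))) (at p)"
    by (rule has_derivative_transform_within_open[OF _ T]) (simp add: H)
  from fun_cong[OF frechet_derivative_at[OF this, symmetric], of "sgn (p - c)"]
  have "frechet_derivative H (at p) (sgn (p - c)) = D (sgn (p - c)) - t * D (- sgn (p - c))"
    unfolding circle_refl_normal[OF p] .
  then have "frechet_derivative H (at p) (sgn (p - c)) = (1 + t) * D (sgn (p - c))"
    by (simp add: lin distrib_right)
  then show ?thesis unfolding D_def .
qed

lemma frechet_derivative_cong_open:
  assumes "open S" "z \<in> S" "\<And>x. x \<in> S \<Longrightarrow> f x = g x"
  shows "frechet_derivative f (at z) = frechet_derivative g (at z)"
proof -
  have "(f has_derivative D) (at z) \<longleftrightarrow> (g has_derivative D) (at z)" for D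
    using has_derivative_transform_within_open[OF _ assms(1,2)] assms(3) by metis
  then show ?thesis by (simp add: frechet_derivative_def)
qed

text \<open>Both sides take the value (1 - tau) G + C on the circle, while their normal derivatives
  are 1 + tau and 1 - tau times that of G. The number \<open>tau k\<close> is the solution of 1 +
  tau = k (1 - tau). H and (1 - tau) G + C are smooth across the circle, which turns the one-sided
  limits of u into values at p.\<close>

lemma transmission_at_reflection:
  assumes p: "dist c p = r" "r > 0" and T: "open T" "p \<in> T" and G: "hol_plus_cnj T G"
    and H: "hol_plus_cnj T H" "\<And>z. z \<in> T \<Longrightarrow> H z = G z - tau k * G (circle_refl c r z) + C"
    and out: "\<And>z. z \<in> T \<Longrightarrow> z \<notin> cball c r \<Longrightarrow> u z = H z"
    and ins: "\<And>z. z \<in> T \<Longrightarrow> z \<in> ball c r \<Longrightarrow> u z = (1 - tau k) * G z + C"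
    and k: "k \<noteq> -1"
  shows "transmission_at (ball c r) c k u p"
proof -
  define t where "t = tau k"
  define A where "A z = (1 - t) * G z + C" for z
  have pc: "p \<noteq> c" using p by auto
  have A: "hol_plus_cnj T A"
    unfolding A_def by (intro hol_plus_cnj_add hol_plus_cnj_cmult hol_plus_cnj_const G)
  have cl: "closure (ball c r) = cball c r" using p by simp
  have ev: "\<forall>\<^sub>F z in at p within X. z \<in> T \<and> z \<in> X" for X
    using T by (auto simp: eventually_at_filter eventually_nhds)
  have con: "(f \<longlongrightarrow> f p) (at p within X)" if "hol_plus_cnj T f" for f X
    using hol_plus_cnj_continuous_on[OF that] T
    by (metis continuous_on_eq_continuous_at isCont_def tendsto_within_subset top_greatest)
  have HA: "H p = A p"
    using H(2)[OF T(2)] circle_refl_fixed[OF p] by (simp add: A_def t_def algebra_simps)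
  have 1: "(u \<longlongrightarrow> A p) (at p within - closure (ball c r))"
    using con[OF H(1)] unfolding HA
    by (rule Lim_transform_eventually) (rule eventually_mono[OF ev], use out cl in auto)
  have 2: "(u \<longlongrightarrow> A p) (at p within ball c r)"
    using con[OF A]
    by (rule Lim_transform_eventually) (rule eventually_mono[OF ev], use ins in \<open>auto simp: A_def t_def\<close>)
  have 3: "(normal_deriv c u \<longlongrightarrow> frechet_derivative H (at p) (sgn (p - c))) (at p within - closure (ball c r))"
  proof (rule Lim_transform_eventually[OF hol_plus_cnj_tendsto_normal_deriv[OF T(1) H(1) T(2) pc]], rule eventually_mono[OF ev])
    fix z assume z: "z \<in> T \<and> z \<in> - closure (ball c r)"
    have "frechet_derivative H (at z) = frechet_derivative u (at z)"
      by (rule frechet_derivative_cong_open[of "T - cball c r"]) (use z T out cl in auto)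
    then show "normal_deriv c H z = normal_deriv c u z" by (simp add: normal_deriv_def)
  qed
  have 4: "(normal_deriv c u \<longlongrightarrow> frechet_derivative A (at p) (sgn (p - c))) (at p within ball c r)"
  proof (rule Lim_transform_eventually[OF hol_plus_cnj_tendsto_normal_deriv[OF T(1) A T(2) pc]], rule eventually_mono[OF ev])
    fix z assume z: "z \<in> T \<and> z \<in> ball c r"
    have "frechet_derivative A (at z) = frechet_derivative u (at z)"
      by (rule frechet_derivative_cong_open[of "T \<inter> ball c r"]) (use z T ins in \<open>auto simp: A_def t_def\<close>)
    then show "normal_deriv c A z = normal_deriv c u z" by (simp add: normal_deriv_def)
  qed
  have "(G has_derivative frechet_derivative G (at p)) (at p)"
    using hol_plus_cnj_differentiable[OF T(1) G T(2)] frechet_derivative_works by blast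
  then have "(A has_derivative (\<lambda>h. (1 - t) * frechet_derivative G (at p) h)) (at p)"
    unfolding A_def by (auto intro!: derivative_eq_intros)
  from fun_cong[OF frechet_derivative_at[OF this, symmetric], of "sgn (p - c)"]
  have fA: "frechet_derivative A (at p) (sgn (p - c)) = (1 - t) * frechet_derivative G (at p) (sgn (p - c))" .
  have fH: "frechet_derivative H (at p) (sgn (p - c)) = (1 + t) * frechet_derivative G (at p) (sgn (p - c))"
    by (rule frechet_derivative_reflected[OF p T G]) (simp add: H(2) t_def)
  have "k + 1 \<noteq> 0" using k by (simp add: add_eq_0_iff2)
  then have "1 + t = k * (1 - t)" by (simp add: t_def tau_def field_simps)
  then have "frechet_derivative H (at p) (sgn (p - c)) = k * frechet_derivative A (at p) (sgn (p - c))"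
    unfolding fA fH by simp
  then show ?thesis unfolding transmission_at_def using 1 2 3 4 by blast
qed

section \<open>The dilation equation\<close>

text \<open>For n = 0 the divisor is 1 - t, which may vanish; the free constant c absorbs that
  coefficient, and v is chosen with v 0 = 0. The inverse divisors are bounded, so the new series
  converges on the same disk.\<close>

lemma dilation_equation_holomorphic:
  fixes \<kappa> R :: real and t :: complex
  assumes g: "g holomorphic_on ball 0 R" and \<kappa>: "0 < \<kappa>" "\<kappa> < 1"
    and nz: "\<And>n. n \<ge> 1 \<Longrightarrow> t * of_real (\<kappa> ^ n) \<noteq> 1"
  obtains v c where "v holomorphic_on ball 0 R"
    "\<And>w. w \<in> ball 0 R \<Longrightarrow> v w - t * v (of_real \<kappa> * w) = g w + c"
proof -
  define a where "a n = (deriv ^^ n) g 0 / fact n" for n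
  define d where "d n = 1 - t * of_real (\<kappa> ^ n)" for n
  define b where "b n = (if n = 0 then 0 else a n / d n)" for n
  have a: "(\<lambda>n. a n * w ^ n) sums g w" if "w \<in> ball 0 R" for w
    using holomorphic_power_series[OF g that] by (simp add: a_def)
  have d0: "d n \<noteq> 0" if "n \<ge> 1" for n using nz[OF that] by (simp add: d_def)
  have "(\<lambda>n. \<kappa> ^ n) \<longlonglongrightarrow> 0" using \<kappa> by (intro LIMSEQ_realpow_zero) auto
  from tendsto_of_real[OF this]
  have "(\<lambda>n. 1 - t * of_real (\<kappa> ^ n)) \<longlonglongrightarrow> 1 - t * of_real 0"
    by (intro tendsto_diff tendsto_mult tendsto_const)
  then have "d \<longlonglongrightarrow> 1" by (simp add: d_def[abs_def])
  then have "(\<lambda>n. inverse (d n)) \<longlonglongrightarrow> inverse 1" by (intro tendsto_inverse) auto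
  then have "Bseq (\<lambda>n. inverse (d n))" using convergent_imp_Bseq convergentI by blast
  then obtain K where K: "K > 0" "\<And>n. norm (inverse (d n)) \<le> K" unfolding Bseq_def by blast
  have bK: "norm (b n) \<le> K * norm (a n)" for n
    using K(2)[of n] K(1) mult_left_mono[OF K(2)[of n], of "norm (a n)"]
    by (simp add: b_def norm_mult norm_divide divide_inverse norm_inverse mult.commute)
  have sb: "summable (\<lambda>n. b n * w ^ n)" if w: "w \<in> ball 0 R" for w
  proof -
    have nw: "norm w < R" using w by simp
    \<comment> \<open>A point of modulus strictly between |w| and R: convergence of the series of g
      at x gives absolute convergence at w.\<close>
    define x :: complex where "x = of_real ((norm w + R) / 2)"
    have nx: "norm x = (norm w + R) / 2" 
    proof -
      have "0 \<le> norm w + R" using nw order.trans[OF norm_ge_zero[of w] less_imp_le[OF nw]] by (simp add: add_nonneg_nonneg)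
      then show ?thesis unfolding x_def norm_of_real by simp
    qed
    have x: "x \<in> ball 0 R" "norm w < norm x"
      using nw nx by auto
    have "summable (\<lambda>n. norm (a n * w ^ n))"
      by (rule powser_insidea[OF _ x(2)]) (use a[OF x(1)] sums_summable in blast)
    then have "summable (\<lambda>n. K * norm (a n * w ^ n))" by (rule summable_mult)
    then show ?thesis
    proof (rule summable_comparison_test'[where N = 0])
      fix n show "norm (b n * w ^ n) \<le> K * norm (a n * w ^ n)"
        using mult_right_mono[OF bK[of n], of "norm (w ^ n)"] by (simp add: norm_mult mult.assoc)
    qed
  qed
  define v where "v w = (\<Sum>n. b n * w ^ n)" for w
  have v: "(\<lambda>n. b n * w ^ n) sums v w" if "w \<in> ball 0 R" for w
    using sb[OF that] by (simp add: v_def summable_sums)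
  show ?thesis
  proof
    show "v holomorphic_on ball 0 R"
      by (rule power_series_holomorphic[of 0 R b]) (simp add: v)
    fix w :: complex assume w: "w \<in> ball 0 R"
    have "norm (of_real \<kappa> * w) \<le> 1 * norm w" unfolding norm_mult using \<kappa> by (intro mult_right_mono) auto
    then have kw: "of_real \<kappa> * w \<in> ball 0 R" using w by simp
    have "(\<lambda>n. b n * w ^ n - t * (b n * (of_real \<kappa> * w) ^ n)) sums (v w - t * v (of_real \<kappa> * w))"
      by (intro sums_diff sums_mult v w kw)
    moreover have "(\<lambda>n. a n * w ^ n - (if n = 0 then a 0 else 0)) sums (g w - a 0)"
      by (intro sums_diff a w) (rule sums_single[of 0 "\<lambda>_. a 0"])
    moreover have "(\<lambda>n. b n * w ^ n - t * (b n * (of_real \<kappa> * w) ^ n)) = (\<lambda>n. a n * w ^ n - (if n = 0 then a 0 else 0))"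
    proof
      fix n show "b n * w ^ n - t * (b n * (of_real \<kappa> * w) ^ n) = a n * w ^ n - (if n = 0 then a 0 else 0)"
      proof (cases "n = 0")
        case False
        have "b n * w ^ n - t * (b n * (of_real \<kappa> * w) ^ n) = (b n * d n) * w ^ n"
          by (simp add: d_def algebra_simps power_mult_distrib)
        also have "b n * d n = a n" using d0[of n] False by (simp add: b_def)
        finally show ?thesis using False by simp
      qed (simp add: b_def)
    qed
    ultimately show "v w - t * v (of_real \<kappa> * w) = g w + (- a 0)" using sums_unique2 by fastforce
  qed
qed

text \<open>The conjugated summand satisfies the same equation with \<open>cnj t\<close> in place of
  t. As \<kappa> is real, conjugation preserves the absence of resonance.\<close>

lemma dilation_equation:
  fixes \<kappa> R :: real and t :: complex
  assumes g: "hol_plus_cnj (ball 0 R) g" and \<kappa>: "0 < \<kappa>" "\<kappa> < 1"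
    and nz: "\<And>n. n \<ge> 1 \<Longrightarrow> t * of_real (\<kappa> ^ n) \<noteq> 1"
  obtains v c where "hol_plus_cnj (ball 0 R) v"
    "\<And>w. w \<in> ball 0 R \<Longrightarrow> v w - t * v (of_real \<kappa> * w) = g w + c"
proof -
  obtain g1 g2 where g12: "g1 holomorphic_on ball 0 R" "g2 holomorphic_on ball 0 R"
    "\<forall>z\<in>ball 0 R. g z = g1 z + cnj (g2 z)" using g unfolding hol_plus_cnj_def by blast
  have nz': "cnj t * of_real (\<kappa> ^ n) \<noteq> 1" if "n \<ge> 1" for n
    using nz[OF that] by (metis complex_cnj_complex_of_real complex_cnj_mult complex_cnj_one complex_cnj_cnj)
  obtain v1 c1 where v1: "v1 holomorphic_on ball 0 R"
    "\<And>w. w \<in> ball 0 R \<Longrightarrow> v1 w - t * v1 (of_real \<kappa> * w) = g1 w + c1"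
    using dilation_equation_holomorphic[OF g12(1) \<kappa> nz] by blast
  obtain v2 c2 where v2: "v2 holomorphic_on ball 0 R"
    "\<And>w. w \<in> ball 0 R \<Longrightarrow> v2 w - cnj t * v2 (of_real \<kappa> * w) = g2 w + c2"
    using dilation_equation_holomorphic[OF g12(2) \<kappa> nz'] by blast
  show ?thesis
  proof
    show "hol_plus_cnj (ball 0 R) (\<lambda>z. v1 z + cnj (v2 z))"
      by (rule hol_plus_cnjI[OF v1(1) v2(1)]) simp
    fix w :: complex assume w: "w \<in> ball 0 R"
    have "v1 w + cnj (v2 w) - t * (v1 (of_real \<kappa> * w) + cnj (v2 (of_real \<kappa> * w)))
       = (v1 w - t * v1 (of_real \<kappa> * w)) + cnj (v2 w - cnj t * v2 (of_real \<kappa> * w))"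
      by (simp add: algebra_simps)
    also have "\<dots> = g w + (c1 + cnj c2)" using v1(2)[OF w] v2(2)[OF w] g12(3) w by simp
    finally show "v1 w + cnj (v2 w) - t * (v1 (of_real \<kappa> * w) + cnj (v2 (of_real \<kappa> * w))) = g w + (c1 + cnj c2)" .
  qed
qed


section \<open>The two disks\<close>

lemma harmonic_on_cong:
  assumes "open S" "harmonic_on S f" "\<And>x. x \<in> S \<Longrightarrow> g x = f x"
  shows "harmonic_on S g"
proof -
  have p: "partial_deriv b g x = partial_deriv b f x" if "x \<in> S" for b x
    by (rule partial_deriv_cong[OF assms(1) that assms(3)])
  have q: "partial_deriv b' (partial_deriv b g) x = partial_deriv b' (partial_deriv b f) x" if "x \<in> S" for b b' x
    by (rule partial_deriv_cong[OF assms(1) that p])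
  have d: "g differentiable (at x)" if "x \<in> S" "f differentiable (at x)" for x
    by (rule differentiable_cong_open[OF assms(1) that(1) _ that(2)]) (simp add: assms(3))
  have d': "partial_deriv b g differentiable (at x)" if "x \<in> S" "partial_deriv b f differentiable (at x)" for b x
    by (rule differentiable_cong_open[OF assms(1) that(1) _ that(2)]) (simp add: p)
  have c: "continuous_on S (partial_deriv b' (partial_deriv b g)) \<longleftrightarrow> continuous_on S (partial_deriv b' (partial_deriv b f))" for b b'
    by (rule continuous_on_cong) (simp_all add: q)
  show ?thesis using assms(2) d d' unfolding harmonic_on_def C2_on_def by (auto simp: c q)
qed

lemma harmonic_on_Un:
  assumes "open S" "open T" "harmonic_on S f" "harmonic_on T f"
  shows "harmonic_on (S \<union> T) f"
  using assms(3,4) continuous_on_open_Un[OF assms(1,2)] unfolding harmonic_on_def C2_on_def by blast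

lemma partial_deriv_cmult:
  assumes "u differentiable (at z)"
  shows "partial_deriv b (\<lambda>x. k * u x) z = k * partial_deriv b u z"
proof -
  have 1: "(u has_derivative frechet_derivative u (at z)) (at z)"
    using assms frechet_derivative_works by blast
  have "((\<lambda>x. k * u x) has_derivative (\<lambda>h. k * frechet_derivative u (at z) h)) (at z)"
    by (rule derivative_eq_intros 1 refl | simp)+
  from fun_cong[OF frechet_derivative_at[OF this, symmetric]] show ?thesis unfolding partial_deriv_def .
qed

lemma div_grad_locally_constant:
  assumes S: "open S" "x \<in> S" and u: "C2_on S u" and k: "\<And>y. y \<in> S \<Longrightarrow> \<gamma> y = k"
  shows "div_grad \<gamma> u x = k * (\<Sum>b\<in>Basis. partial_deriv b (partial_deriv b u) x)"
proof -
  have "partial_deriv b (\<lambda>y. \<gamma> y * partial_deriv b u y) x = k * partial_deriv b (partial_deriv b u) x"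
    if "b \<in> Basis" for b
  proof -
    have "partial_deriv b (\<lambda>y. \<gamma> y * partial_deriv b u y) x = partial_deriv b (\<lambda>y. k * partial_deriv b u y) x"
      by (rule partial_deriv_cong[OF S]) (simp add: k)
    then show ?thesis
      using partial_deriv_cmult[of "partial_deriv b u" x] u S(2) that unfolding C2_on_def by auto
  qed
  then show ?thesis by (simp add: div_grad_def sum_distrib_left)
qed

lemma bigo_inverse_norm_shift:
  fixes F :: "complex \<Rightarrow> complex"
  assumes "\<And>x. x \<noteq> b \<Longrightarrow> norm (F x) \<le> K / norm (x - b)"
  shows "F \<in> O[at_infinity](\<lambda>x. of_real (1 / norm x))"
proof (rule landau_o.bigI[of "2 * \<bar>K\<bar> + 1"])
  have "\<forall>\<^sub>F x in at_infinity. norm x \<ge> 2 * norm b + 1"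
    by (auto simp: eventually_at_infinity)
  then show "\<forall>\<^sub>F x in at_infinity. norm (F x) \<le> (2 * \<bar>K\<bar> + 1) * norm (of_real (1 / norm x) :: complex)"
  proof (rule eventually_mono)
    fix x :: complex assume x: "2 * norm b + 1 \<le> norm x"
    have "norm x \<le> norm (x - b) + norm b" using norm_triangle_sub[of x b] by simp
    then have n: "norm x / 2 \<le> norm (x - b)" "norm x > 0" using x norm_ge_zero[of b] by linarith+
    have "x \<noteq> b" using n by auto
    then have "norm (F x) \<le> \<bar>K\<bar> / norm (x - b)"
      using assms[of x] by (smt (verit) divide_right_mono norm_ge_zero)
    also have "\<dots> \<le> \<bar>K\<bar> / (norm x / 2)" using n by (intro divide_left_mono mult_pos_pos) auto
    also have "\<dots> \<le> (2 * \<bar>K\<bar> + 1) * (1 / norm x)" using n(2) by (simp add: field_simps)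
    finally show "norm (F x) \<le> (2 * \<bar>K\<bar> + 1) * norm (of_real (1 / norm x) :: complex)"
      by (simp only: norm_of_real) simp
  qed
qed auto

text \<open>Differentiability at p bounds \<phi> y - \<phi> p by a multiple of y - p for y near p,
  which transfers the rate at which T x approaches p.\<close>

lemma bigo_inverse_norm_compose:
  fixes \<phi> T :: "complex \<Rightarrow> complex"
  assumes \<phi>: "\<phi> differentiable (at p)" and T: "(\<lambda>x. T x - p) \<in> O[at_infinity](\<lambda>x. of_real (1 / norm x))"
  shows "(\<lambda>x. \<phi> (T x) - \<phi> p) \<in> O[at_infinity](\<lambda>x. of_real (1 / norm x))"
proof -
  obtain D where D: "(\<phi> has_derivative D) (at p)" using \<phi> unfolding differentiable_def by blast
  then have bl: "bounded_linear D" by (rule has_derivative_bounded_linear)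
  obtain B where B: "B > 0" "\<And>h. norm (D h) \<le> norm h * B" using bounded_linear.pos_bounded[OF bl] by blast
  obtain d where d: "d > 0" "\<And>y. norm (y - p) < d \<Longrightarrow> norm (\<phi> y - \<phi> p - D (y - p)) \<le> 1 * norm (y - p)"
    using D unfolding has_derivative_at_alt using zero_less_one by blast
  have lip: "norm (\<phi> y - \<phi> p) \<le> (B + 1) * norm (y - p)" if "norm (y - p) < d" for y
    using d(2)[OF that] B(2)[of "y - p"] norm_triangle_ineq2[of "\<phi> y - \<phi> p" "D (y - p)"]
    by (simp add: algebra_simps)
  obtain K where K: "K > 0" "\<forall>\<^sub>F x in at_infinity. norm (T x - p) \<le> K * norm (of_real (1 / norm x) :: complex)"
    using T by (rule landau_o.bigE)
  have "\<forall>\<^sub>F x::complex in at_infinity. norm x \<ge> K / d + 1" by (auto simp: eventually_at_infinity)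
  with K(2) have "\<forall>\<^sub>F x in at_infinity. norm (\<phi> (T x) - \<phi> p) \<le> ((B + 1) * K) * norm (of_real (1 / norm x) :: complex)"
  proof eventually_elim
    case (elim x)
    have Kd: "K / d > 0" using K d by simp
    then have "norm x > K / d" "norm x > 0" using elim(2) by linarith+
    then have "K * (1 / norm x) < d" using d by (simp add: field_simps)
    moreover have "norm (of_real (1 / norm x) :: complex) = 1 / norm x" unfolding norm_of_real by simp
    ultimately have "norm (T x - p) < d" using elim(1) by simp
    then have "norm (\<phi> (T x) - \<phi> p) \<le> (B + 1) * norm (T x - p)" by (rule lip)
    also have "\<dots> \<le> (B + 1) * (K * norm (of_real (1 / norm x) :: complex))"
      using elim(1) B by (intro mult_left_mono) auto
    finally show ?case by (simp add: mult.assoc)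
  qed
  then show ?thesis using B K by (intro landau_o.bigI[of "(B + 1) * K"]) auto
qed

lemma circle_refl_outside:
  assumes "r > 0" "z \<notin> ball c r"
  shows "circle_refl c r z \<in> cball c r"
proof -
  have n: "r \<le> norm (z - c)" using assms by (simp add: dist_norm norm_minus_commute)
  have "norm (of_real (r\<^sup>2) / cnj (z - c)) = r\<^sup>2 / norm (z - c)"
    by (simp only: norm_divide complex_mod_cnj norm_of_real) simp
  also have "\<dots> \<le> r\<^sup>2 / r" using n assms(1) by (intro divide_left_mono mult_pos_pos) auto
  also have "\<dots> = r" using assms(1) by (simp add: power2_eq_square)
  finally show ?thesis by (simp add: circle_refl_def dist_norm)
qed

text \<open>The relation between m, \<alpha> and r says (m - \<alpha>) (m + \<alpha>) = r^2: the
  foci \<alpha> and -\<alpha> are inverse points with respect to both circles. It replaces the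
  hyperbolic functions by polynomial identities; in the application m = \<alpha> coth \<xi>0 and r =
  \<alpha> / sinh \<xi>0.\<close>

locale two_disks =
  fixes \<alpha> m r :: real
  assumes alpha: "\<alpha> > 0" and r: "r > 0" and m: "m > 0" and m2: "m\<^sup>2 = \<alpha>\<^sup>2 + r\<^sup>2"
begin

abbreviation "DL \<equiv> ball (- of_real m :: complex) r"
abbreviation "DR \<equiv> ball (of_real m :: complex) r"
abbreviation "CL \<equiv> cball (- of_real m :: complex) r"
abbreviation "CR \<equiv> cball (of_real m :: complex) r"

text \<open>$L = e^{2\xi_0}$, so that the disks are $L|W|^2 < 1$ and $|W|^2 > L$.
  S2 is $|W| < L$ without the focus $\alpha$, where division by zero makes $W$ vanish.\<close>

definition L :: real where "L = (m + \<alpha>) / (m - \<alpha>)"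
definition W :: "complex \<Rightarrow> complex" where "W z = (z + of_real \<alpha>) / (z - of_real \<alpha>)"
definition "S2 = {z :: complex. norm (z + of_real \<alpha>) < L * norm (z - of_real \<alpha>)}"

lemma alpha_less: "\<alpha> < m" and r_less: "r < m"
proof -
  show "\<alpha> < m" by (rule power2_less_imp_less) (use m2 r m in auto)
  show "r < m" by (rule power2_less_imp_less) (use m2 alpha m in auto)
qed

lemma L_gt_1: "L > 1" using alpha_less alpha by (simp add: L_def)

text \<open>The circle of Apollonius in polynomial form: the comparison of |W|^2 with L is the sign
  of r^2 - |z - m|^2. No division occurs, so the focus \<alpha> is covered too.\<close>

lemma norm_identity_right:
  "(m - \<alpha>) * (norm (z + of_real \<alpha> :: complex))\<^sup>2 - (m + \<alpha>) * (norm (z - of_real \<alpha>))\<^sup>2 = 2 * \<alpha> * (r\<^sup>2 - (norm (z - of_real m))\<^sup>2)"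
  unfolding cmod_power2 using m2 by simp algebra

lemma norm_identity_left:
  "(m - \<alpha>) * (norm (z - of_real \<alpha> :: complex))\<^sup>2 - (m + \<alpha>) * (norm (z + of_real \<alpha>))\<^sup>2 = 2 * \<alpha> * (r\<^sup>2 - (norm (z + of_real m))\<^sup>2)"
  unfolding cmod_power2 using m2 by simp algebra

lemma DR_iff: "z \<in> DR \<longleftrightarrow> (m + \<alpha>) * (norm (z - of_real \<alpha>))\<^sup>2 < (m - \<alpha>) * (norm (z + of_real \<alpha>))\<^sup>2"
proof -
  have "z \<in> DR \<longleftrightarrow> (norm (z - of_real m))\<^sup>2 < r\<^sup>2"
    using r by (auto simp: dist_norm norm_minus_commute intro: power_strict_mono power2_less_imp_less)
  also have "\<dots> \<longleftrightarrow> 0 < 2 * \<alpha> * (r\<^sup>2 - (norm (z - of_real m))\<^sup>2)" using alpha by (simp add: zero_less_mult_iff)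
  finally show ?thesis unfolding norm_identity_right[symmetric] by simp
qed

lemma DL_iff: "z \<in> DL \<longleftrightarrow> (m + \<alpha>) * (norm (z + of_real \<alpha>))\<^sup>2 < (m - \<alpha>) * (norm (z - of_real \<alpha>))\<^sup>2"
proof -
  have "z \<in> DL \<longleftrightarrow> (norm (z + of_real m))\<^sup>2 < r\<^sup>2"
    using r by (auto simp: dist_norm norm_minus_commute intro: power_strict_mono power2_less_imp_less)
  also have "\<dots> \<longleftrightarrow> 0 < 2 * \<alpha> * (r\<^sup>2 - (norm (z + of_real m))\<^sup>2)" using alpha by (simp add: zero_less_mult_iff)
  finally show ?thesis unfolding norm_identity_left[symmetric] by simp
qed

lemma CL_CR_disjoint: "CL \<inter> CR = {}"
proof -
  have "dist (- of_real m :: complex) (of_real m) = 2 * m"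
    using m by (simp add: dist_norm)
  then show ?thesis using r_less by (intro disjoint_cballI) simp
qed

lemma alpha_in_DR: "of_real \<alpha> \<in> DR"
  unfolding DR_iff using alpha alpha_less by (simp add: norm_mult)

lemma minus_alpha_in_DL: "- of_real \<alpha> \<in> DL"
  unfolding DL_iff using alpha alpha_less by (simp add: norm_mult)

lemma open_S2: "open S2"
  unfolding S2_def by (intro open_Collect_less continuous_intros)

text \<open>Off the right disk |W|^2 \<le> L, and L < L^2 leaves room. So \<open>S2\<close> is an
  open set that reaches beyond the right circle into the disk, as needed to continue v2 across that
  circle.\<close>

lemma S2_supset: "- DR \<subseteq> S2"
proof
  fix z assume z: "z \<in> - DR"
  define a where "a = norm (z + of_real \<alpha>)"
  define b where "b = norm (z - of_real \<alpha>)"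
  have b: "b > 0" using z alpha_in_DR by (auto simp: b_def)
  have "(m - \<alpha>) * a\<^sup>2 \<le> (m + \<alpha>) * b\<^sup>2" using z DR_iff[of z] by (simp add: a_def b_def)
  then have "a\<^sup>2 \<le> L * b\<^sup>2" using alpha_less by (simp add: L_def field_simps)
  also have "\<dots> < L * (L * b\<^sup>2)" using b L_gt_1 by simp
  finally have "a\<^sup>2 < (L * b)\<^sup>2" by (simp add: power2_eq_square algebra_simps)
  then have "a < L * b" by (rule power2_less_imp_less) (use b L_gt_1 in simp)
  then show "z \<in> S2" by (simp add: S2_def a_def b_def)
qed

text \<open>The three points are the pole of W, the centre of the right circle and the point that
  the right reflection sends to the centre -m of the left circle. At the last two W has the values L
  and L^2, outside |W| < L.\<close>

lemma S2_neq: 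
  assumes "z \<in> S2"
  shows "z \<noteq> of_real \<alpha>" "z \<noteq> of_real m" "2 * of_real m * z \<noteq> of_real (\<alpha>\<^sup>2 + m\<^sup>2)"
proof -
  show "z \<noteq> of_real \<alpha>" using assms alpha by (auto simp: S2_def)
  have ml: "L * (m - \<alpha>) = m + \<alpha>" using alpha_less by (simp add: L_def)
  have re: "x + \<alpha> < L * \<bar>x - \<alpha>\<bar>" if "z = of_real x" for x
  proof -
    have "norm (z + of_real \<alpha>) = \<bar>x + \<alpha>\<bar>" "norm (z - of_real \<alpha>) = \<bar>x - \<alpha>\<bar>"
      unfolding that of_real_add[symmetric] of_real_diff[symmetric] norm_of_real by auto
    then show ?thesis using assms by (auto simp: S2_def)
  qed
  show "z \<noteq> of_real m" using re[of m] ml alpha_less by auto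
  show "2 * of_real m * z \<noteq> of_real (\<alpha>\<^sup>2 + m\<^sup>2)"
  proof
    assume "2 * of_real m * z = of_real (\<alpha>\<^sup>2 + m\<^sup>2)"
    then have "z = of_real ((\<alpha>\<^sup>2 + m\<^sup>2) / (2 * m))" using m by (simp add: field_simps)
    note * = re[OF this]
    have e: "(\<alpha>\<^sup>2 + m\<^sup>2) / (2 * m) + \<alpha> = (m + \<alpha>)\<^sup>2 / (2 * m)" "(\<alpha>\<^sup>2 + m\<^sup>2) / (2 * m) - \<alpha> = (m - \<alpha>)\<^sup>2 / (2 * m)"
      using m by (simp_all add: field_simps power2_eq_square)
    have "(m + \<alpha>)\<^sup>2 / (2 * m) < L * ((m - \<alpha>)\<^sup>2 / (2 * m))" using * m unfolding e by simp
    then have "(m + \<alpha>)\<^sup>2 < L * (m - \<alpha>)\<^sup>2" using m by (simp add: field_simps)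
    also have "L * (m - \<alpha>)\<^sup>2 = (m + \<alpha>) * (m - \<alpha>)" unfolding power2_eq_square mult.assoc[symmetric] ml ..
    also have "\<dots> \<le> (m + \<alpha>)\<^sup>2" unfolding power2_eq_square using alpha m by (intro mult_left_mono) auto
    finally show False by simp
  qed
qed

lemma W_holomorphic: "of_real \<alpha> \<notin> S \<Longrightarrow> W holomorphic_on S"
  unfolding W_def by (intro holomorphic_intros) auto

lemma W_S2: "W ` S2 \<subseteq> ball 0 L"
proof
  fix w assume "w \<in> W ` S2"
  then obtain z where z: "z \<in> S2" "w = W z" by blast
  have "norm (z - of_real \<alpha>) > 0" using S2_neq[OF z(1)] by simp
  then have "norm (W z) < L"
    using z(1) unfolding W_def norm_divide by (simp add: S2_def pos_divide_less_eq)
  then show "w \<in> ball 0 L" using z(2) by simp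
qed

text \<open>In the coordinate W the right reflection sends w to L / cnj w. Returning to z and
  clearing the denominator \<open>cnj (W z)\<close> gives a form that includes z = -\<alpha>, where
  W vanishes.\<close>

lemma refl_right_eq:
  assumes "z \<in> S2"
  shows "circle_refl (of_real m) r z = of_real \<alpha> * (of_real L + cnj (W z)) / (of_real L - cnj (W z))"
proof -
  define c where "c = cnj z"
  have n: "c \<noteq> of_real \<alpha>" "c \<noteq> of_real m"
    using S2_neq[OF assms] by (auto simp: c_def) (metis complex_cnj_cnj complex_cnj_complex_of_real)+
  have ma: "of_real m - of_real \<alpha> \<noteq> (0::complex)" using alpha_less by (metis less_irrefl of_real_diff of_real_eq_0_iff right_minus_eq)
  have a0: "of_real \<alpha> \<noteq> (0::complex)" using alpha by simp
  have r2: "of_real (r\<^sup>2) = (of_real m)\<^sup>2 - (of_real \<alpha> :: complex)\<^sup>2"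
    using m2 by (metis add_diff_cancel_left' of_real_diff of_real_power)
  define Q where "Q = (of_real m - of_real \<alpha>) * (c - of_real \<alpha>)"
  have Q: "Q \<noteq> 0" using n ma by (simp add: Q_def)
  have Lc: "of_real L = (of_real m + of_real \<alpha>) / (of_real m - of_real \<alpha> :: complex)" by (simp add: L_def)
  have cw: "cnj (W z) = (c + of_real \<alpha>) / (c - of_real \<alpha>)" by (simp add: W_def c_def)
  have 1: "of_real L + cnj (W z) = 2 * (of_real m * c - (of_real \<alpha>)\<^sup>2) / Q"
    unfolding Lc cw Q_def using ma n by (simp add: field_simps power2_eq_square)
  have 2: "of_real L - cnj (W z) = 2 * of_real \<alpha> * (c - of_real m) / Q"
    unfolding Lc cw Q_def using ma n by (simp add: field_simps power2_eq_square)
  have "of_real \<alpha> * (of_real L + cnj (W z)) / (of_real L - cnj (W z)) = (of_real m * c - (of_real \<alpha>)\<^sup>2) / (c - of_real m)"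
    unfolding 1 2 using Q a0 n by (simp add: field_simps)
  also have "\<dots> = of_real m + of_real (r\<^sup>2) / (c - of_real m)"
    unfolding r2 using n by (simp add: field_simps power2_eq_square)
  finally show ?thesis by (simp add: circle_refl_def c_def)
qed

definition mob :: "complex \<Rightarrow> complex" where "mob w = of_real \<alpha> * (w + 1) / (w - 1)"

lemma W_mob: "w \<noteq> 1 \<Longrightarrow> W (mob w) = w"
  using alpha by (simp add: W_def mob_def field_simps)

text \<open>Right reflection sends w to L / cnj w and left reflection sends w to 1 / (L cnj w);
  their composite is w / L^2. The computation is done in z, so that the zero of W needs no separate
  case.\<close>

lemma refl_refl_eq:
  assumes "z \<in> S2"
  shows "circle_refl (- of_real m) r (circle_refl (of_real m) r z) = mob (of_real (1 / L\<^sup>2) * W z)"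
    and "of_real (1 / L\<^sup>2) * W z \<noteq> 1"
proof -
  define a M :: complex where "a = of_real \<alpha>" and "M = of_real m"
  have n: "z \<noteq> a" "z \<noteq> M" "2 * M * z \<noteq> a\<^sup>2 + M\<^sup>2"
    using S2_neq[OF assms] by (auto simp: a_def M_def)
  have ma: "M - a \<noteq> 0" "M + a \<noteq> 0" 
    using alpha_less alpha by (auto simp: a_def M_def simp flip: of_real_diff of_real_add)
  have a0: "a \<noteq> 0" using alpha by (simp add: a_def)
  have r2: "of_real (r\<^sup>2) = M\<^sup>2 - a\<^sup>2"
    unfolding a_def M_def using m2 by (metis add_diff_cancel_left' of_real_diff of_real_power)
  \<comment> \<open>P / (z - M) is the conjugate of the distance vector from the left centre to the
    reflected point, so P = 0 exactly when the right reflection hits that centre.\<close>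
  define P where "P = 2 * M * z - (a\<^sup>2 + M\<^sup>2)"
  have P: "P \<noteq> 0" using n by (simp add: P_def)
  have Lc: "of_real (1 / L\<^sup>2) = (M - a)\<^sup>2 / (M + a)\<^sup>2" by (simp add: L_def a_def M_def power_divide)
  have w: "of_real (1 / L\<^sup>2) * W z = ((M - a)\<^sup>2 * (z + a)) / ((M + a)\<^sup>2 * (z - a))"
    unfolding Lc W_def a_def[symmetric] by simp
  define X Y where "X = (M - a)\<^sup>2 * (z + a)" and "Y = (M + a)\<^sup>2 * (z - a)"
  have Y: "Y \<noteq> 0" using n ma by (simp add: Y_def)
  have XY: "X - Y = - (2 * a * P)" "X + Y = 2 * ((M\<^sup>2 + a\<^sup>2) * z - 2 * M * a\<^sup>2)"
    unfolding X_def Y_def P_def by algebra+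
  have XY0: "X - Y \<noteq> 0" unfolding XY using P a0 by simp
  then show "of_real (1 / L\<^sup>2) * W z \<noteq> 1" unfolding w X_def[symmetric] Y_def[symmetric] using Y by (simp add: field_simps)
  have "mob (of_real (1 / L\<^sup>2) * W z) = a * (X / Y + 1) / (X / Y - 1)"
    unfolding w X_def Y_def mob_def a_def ..
  also have "X / Y + 1 = (X + Y) / Y" using Y by (simp add: field_simps)
  also have "X / Y - 1 = (X - Y) / Y" using Y by (simp add: field_simps)
  also have "a * ((X + Y) / Y) / ((X - Y) / Y) = a * (X + Y) / (X - Y)" using Y XY0 by simp
  also have "\<dots> = - ((M\<^sup>2 + a\<^sup>2) * z - 2 * M * a\<^sup>2) / P" unfolding XY using a0 P by (simp add: field_simps)
  finally have mob: "mob (of_real (1 / L\<^sup>2) * W z) = - ((M\<^sup>2 + a\<^sup>2) * z - 2 * M * a\<^sup>2) / P" .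
  have c1: "cnj (circle_refl M r z) = M + (M\<^sup>2 - a\<^sup>2) / (z - M)"
    using r2 by (simp add: circle_refl_def M_def a_def)
  have c2: "cnj (circle_refl M r z - (- M)) = P / (z - M)"
  proof -
    have "cnj (circle_refl M r z - (- M)) = cnj (circle_refl M r z) + M" by (simp add: M_def)
    then show ?thesis unfolding c1 P_def using n by (simp add: field_simps power2_eq_square)
  qed
  have "circle_refl (- M) r (circle_refl M r z) = - M + (M\<^sup>2 - a\<^sup>2) / (P / (z - M))"
    unfolding circle_refl_def[of "- M"] c2 r2 ..
  also have "\<dots> = (- M * P + (M\<^sup>2 - a\<^sup>2) * (z - M)) / P" using P n by (simp add: field_simps)
  also have "- M * P + (M\<^sup>2 - a\<^sup>2) * (z - M) = - ((M\<^sup>2 + a\<^sup>2) * z - 2 * M * a\<^sup>2)"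
    unfolding P_def by algebra
  finally show "circle_refl (- of_real m) r (circle_refl (of_real m) r z) = mob (of_real (1 / L\<^sup>2) * W z)"
    unfolding mob M_def .
qed

lemma balls_subset: "DL \<subseteq> CL" "DR \<subseteq> CR"
  by auto

lemma conductivity_DL:
  assumes "y \<in> DL"
  shows "conductivity DL DR k1 k2 y = k1"
proof -
  have "y \<notin> DR" using assms balls_subset CL_CR_disjoint by blast
  then show ?thesis using assms by (simp add: conductivity_def)
qed

lemma conductivity_DR:
  assumes "y \<in> DR"
  shows "conductivity DL DR k1 k2 y = k2"
proof -
  have "y \<notin> DL" using assms balls_subset CL_CR_disjoint by blast
  then show ?thesis using assms by (simp add: conductivity_def)
qed

lemma conductivity_exterior:
  assumes "y \<in> - (CL \<union> CR)"
  shows "conductivity DL DR k1 k2 y = 1"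
proof -
  have "y \<notin> DL" "y \<notin> DR" using assms balls_subset by blast+
  then show ?thesis by (simp add: conductivity_def)
qed

lemma pieces_decomposition: "- (frontier DL \<union> frontier DR) = DL \<union> DR \<union> - (CL \<union> CR)"
proof -
  have "frontier DL = CL - DL" "frontier DR = CR - DR" using r by auto
  moreover have "DL \<subseteq> CL" "DR \<subseteq> CR" by auto
  ultimately show ?thesis using CL_CR_disjoint by blast
qed

lemma harmonic_pieces_solve:
  assumes "harmonic_on DL u" "harmonic_on DR u" "harmonic_on (- (CL \<union> CR)) u"
    and "\<And>p. p \<in> frontier DL \<Longrightarrow> transmission_at DL (- of_real m) k1 u p"
    and "\<And>p. p \<in> frontier DR \<Longrightarrow> transmission_at DR (of_real m) k2 u p"
  shows "solves_conductivity_eq DL (- of_real m) k1 DR (of_real m) k2 u"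
proof -
  note e = pieces_decomposition
  have o: "open (- (CL \<union> CR))" by (intro open_Compl closed_Un closed_cball)
  have h: "harmonic_on (- (frontier DL \<union> frontier DR)) u"
    unfolding e by (intro harmonic_on_Un assms open_Un open_ball o)
  have g: "div_grad (conductivity DL DR k1 k2) u x = 0"
    if "open S" "harmonic_on S u" "\<And>y. y \<in> S \<Longrightarrow> conductivity DL DR k1 k2 y = k" "x \<in> S" for S x k
    using div_grad_locally_constant[of S x u "conductivity DL DR k1 k2" k] that unfolding harmonic_on_def by simp
  have "div_grad (conductivity DL DR k1 k2) u x = 0" if "x \<in> - (frontier DL \<union> frontier DR)" for x
    using that g[OF open_ball assms(1) conductivity_DL] g[OF open_ball assms(2) conductivity_DR] g[OF o assms(3) conductivity_exterior] unfolding e by blast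
  then show ?thesis using h assms(4,5) unfolding solves_conductivity_eq_def harmonic_on_def by blast
qed

end


context two_disks
begin

section \<open>Solvability away from resonance\<close>

lemma solvable:
  fixes k1 k2 :: complex
  assumes k: "k1 \<noteq> -1" "k2 \<noteq> -1"
    and nres: "\<And>n. n \<ge> 1 \<Longrightarrow> tau k1 * tau k2 * of_real ((1 / L\<^sup>2) ^ n) \<noteq> 1"
    and h: "hol_plus_cnj UNIV h"
  obtains u where "solves_conductivity_eq DL (- of_real m) k1 DR (of_real m) k2 u"
    "(\<lambda>x. u x - h x) \<in> O[at_infinity](\<lambda>x. of_real (1 / norm x))"
proof -
  define t1 t2 where "t1 = tau k1" and "t2 = tau k2"
  define \<kappa> where "\<kappa> = 1 / L\<^sup>2"
  have L1: "L > 1" by (rule L_gt_1)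
  have \<kappa>: "0 < \<kappa>" "\<kappa> < 1" using L1 by (auto simp: \<kappa>_def one_less_power)
  have \<kappa>L: "\<kappa> * L < 1" using L1 by (simp add: \<kappa>_def power2_eq_square)
  let ?rL = "circle_refl (- of_real m) r" and ?rR = "circle_refl (of_real m) r"
  \<comment> \<open>Chosen so that \<open>p (cnj (W z))\<close> is the right reflection of
    z.\<close>
  define p where "p w = of_real \<alpha> * (of_real L + w) / (of_real L - w)" for w :: complex
  have p: "p holomorphic_on ball 0 L"
    unfolding p_def by (intro holomorphic_intros) auto
  have c0: "cnj ` ball 0 L = ball 0 L"
    by (auto intro: image_eqI[of _ cnj "cnj _"])
  have g1: "hol_plus_cnj (ball 0 L) (\<lambda>w. h (p (cnj w)))"
    using hol_plus_cnj_compose_cnj[OF hol_plus_cnj_compose[OF h p subset_UNIV] open_ball] unfolding c0 .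
  have g2: "hol_plus_cnj (ball 0 L) (\<lambda>w. h (mob (of_real \<kappa> * w)))"
  proof (rule hol_plus_cnj_compose[OF h _ subset_UNIV])
    \<comment> \<open>The pole of \<open>mob\<close> stays away: on this disk \<kappa> |w| is at
      most \<kappa> L = 1 / L < 1.\<close>
    have "of_real \<kappa> * w \<noteq> 1" if "w \<in> ball 0 L" for w :: complex
    proof
      assume "of_real \<kappa> * w = 1"
      then have "\<kappa> * norm w = 1" using \<kappa> by (metis abs_of_pos norm_mult norm_of_real norm_one)
      moreover have "\<kappa> * norm w \<le> \<kappa> * L" using that \<kappa> by (intro mult_left_mono) auto
      ultimately show False using \<kappa>L by linarith
    qed
    then show "(\<lambda>w. mob (of_real \<kappa> * w)) holomorphic_on ball 0 L"
      unfolding mob_def by (intro holomorphic_intros) auto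
  qed
  \<comment> \<open>Insert v1 = - t1 (h + v2) o R1 into v2 = - t2 (h + v1) o R2 + c: the terms in h
    are - t2 h o R2 + t1 t2 h o R1 o R2, and g is their sum written in the coordinate w.\<close>
  define g where "g w = (- t2) * h (p (cnj w)) + (t1 * t2) * h (mob (of_real \<kappa> * w))" for w
  have g: "hol_plus_cnj (ball 0 L) g"
    unfolding g_def by (intro hol_plus_cnj_add hol_plus_cnj_cmult g1 g2)
  have nz: "\<And>n. n \<ge> 1 \<Longrightarrow> t1 * t2 * of_real (\<kappa> ^ n) \<noteq> 1"
    using nres by (simp add: t1_def t2_def \<kappa>_def)
  obtain V c where V: "hol_plus_cnj (ball 0 L) V"
    "\<And>w. w \<in> ball 0 L \<Longrightarrow> V w - t1 * t2 * V (of_real \<kappa> * w) = g w + c"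
    using dilation_equation[OF g \<kappa> nz] by blast
  define v2 where "v2 z = V (W z)" for z
  have v2: "hol_plus_cnj S2 v2"
    unfolding v2_def
    by (rule hol_plus_cnj_compose[OF V(1) W_holomorphic W_S2]) (use S2_neq(1) in blast)
  define G1 where "G1 z = h z + v2 z" for z
  have G1: "hol_plus_cnj S2 G1"
    unfolding G1_def by (intro hol_plus_cnj_add v2 hol_plus_cnj_subset[OF h]) auto
  define v1 where "v1 z = (- t1) * G1 (?rL z)" for z
  \<comment> \<open>The centre has to be removed by hand: \<open>circle_refl\<close> fixes it and it
    lies in \<open>S2\<close>, so the preimage alone would contain it.\<close>
  define S1 where "S1 = - {- of_real m} \<inter> ?rL -` S2"
  have oS1: "open S1"
    unfolding S1_def
  proof (rule continuous_open_preimage[OF _ _ open_S2])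
    show "continuous_on (- {- of_real m}) ?rL"
      unfolding circle_refl_def[abs_def] by (intro continuous_intros) (use complex_cnj_cancel_iff[of _ "- of_real m"] in \<open>auto simp: add_eq_0_iff2\<close>)
  qed auto
  have v1: "hol_plus_cnj S1 v1"
    unfolding v1_def by (intro hol_plus_cnj_cmult hol_plus_cnj_circle_refl[OF G1 open_S2]) (auto simp: S1_def)
  define G2 where "G2 z = h z + v1 z" for z
  have G2: "hol_plus_cnj S1 G2"
    unfolding G2_def by (intro hol_plus_cnj_add v1 hol_plus_cnj_subset[OF h]) auto
  have S1_supset: "- DL \<subseteq> S1"
  proof
    fix z assume z: "z \<in> - DL"
    have "?rL z \<in> CL" using circle_refl_outside[OF r] z by blast
    then have "?rL z \<notin> CR" using CL_CR_disjoint by blast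
    then have "?rL z \<notin> DR" using ball_subset_cball by blast
    then show "z \<in> S1" using S2_supset z r by (auto simp: S1_def)
  qed
  \<comment> \<open>The dilation equation pulled back along W, read as the circle theorem at the
    right circle.\<close>
  have key: "v2 z = - t2 * G2 (?rR z) + c" if z: "z \<in> S2" for z
  proof -
    have w: "W z \<in> ball 0 L" using W_S2 z by blast
    have "W (mob (of_real \<kappa> * W z)) = of_real \<kappa> * W z"
      using W_mob refl_refl_eq(2)[OF z] unfolding \<kappa>_def by blast
    then have "v2 (?rL (?rR z)) = V (of_real \<kappa> * W z)"
      using refl_refl_eq(1)[OF z] by (simp add: v2_def \<kappa>_def)
    moreover have "?rR z = p (cnj (W z))" using refl_right_eq[OF z] by (simp add: p_def)
    moreover have "?rL (?rR z) = mob (of_real \<kappa> * W z)" using refl_refl_eq(1)[OF z] by (simp add: \<kappa>_def)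
    moreover have "v2 z = t1 * t2 * V (of_real \<kappa> * W z) + g (W z) + c"
      using V(2)[OF w] by (simp add: v2_def algebra_simps)
    ultimately show ?thesis
      by (simp add: G2_def v1_def G1_def g_def algebra_simps)
  qed
  \<comment> \<open>At infinity W tends to 1 and the left reflection tends to the centre -m, so v1 +
    v2 tends to -C; adding C gives the required decay.\<close>
  define C where "C = - (V 1 + (- t1) * G1 (- of_real m))"
  define H where "H z = h z + v1 z + v2 z + C" for z
  have H: "hol_plus_cnj (S1 \<inter> S2) H"
    unfolding H_def
    by (intro hol_plus_cnj_add hol_plus_cnj_const hol_plus_cnj_subset[OF v1] hol_plus_cnj_subset[OF v2] hol_plus_cnj_subset[OF h]) auto
  \<comment> \<open>The right disk carries c + C instead of C: outside, H equals G2 - t2 G2 o R2 +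
    (c + C), because v2 satisfies its equation only up to c.\<close>
  define u where "u z = (if z \<in> DL then (1 - t1) * G1 z + C else if z \<in> DR then (1 - t2) * G2 z + (c + C) else H z)" for z
  have sub: "DL \<subseteq> CL" "DR \<subseteq> CR" by auto
  have disj: "CL \<inter> CR = {}" by (rule CL_CR_disjoint)
  have DLS: "DL \<subseteq> S2" "DR \<subseteq> S1" using S2_supset S1_supset sub disj by blast+
  have ES: "- (CL \<union> CR) \<subseteq> S1 \<inter> S2" using S2_supset S1_supset sub by blast
  have oE: "open (- (CL \<union> CR))" by (intro open_Compl closed_Un closed_cball)
  have "solves_conductivity_eq DL (- of_real m) k1 DR (of_real m) k2 u"
  proof (rule harmonic_pieces_solve)
    have "hol_plus_cnj DL (\<lambda>z. (1 - t1) * G1 z + C)"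
      by (intro hol_plus_cnj_add hol_plus_cnj_cmult hol_plus_cnj_const hol_plus_cnj_subset[OF G1 DLS(1)])
    from harmonic_on_cong[OF open_ball hol_plus_cnj_harmonic[OF open_ball this]]
    show "harmonic_on DL u" by (simp add: u_def)
    have "hol_plus_cnj DR (\<lambda>z. (1 - t2) * G2 z + (c + C))"
      by (intro hol_plus_cnj_add hol_plus_cnj_cmult hol_plus_cnj_const hol_plus_cnj_subset[OF G2 DLS(2)])
    from hol_plus_cnj_harmonic[OF open_ball this]
    show "harmonic_on DR u"
    proof (rule harmonic_on_cong[OF open_ball])
      fix x assume x: "x \<in> DR"
      then have "x \<notin> DL" using sub disj by blast
      then show "u x = (1 - t2) * G2 x + (c + C)" using x unfolding u_def by presburger
    qed
    from hol_plus_cnj_harmonic[OF oE hol_plus_cnj_subset[OF H ES]]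
    show "harmonic_on (- (CL \<union> CR)) u"
    proof (rule harmonic_on_cong[OF oE])
      fix x assume x: "x \<in> - (CL \<union> CR)"
      then have "x \<notin> DL" "x \<notin> DR" using sub by blast+
      then show "u x = H x" unfolding u_def by presburger
    qed
  next
    fix q assume "q \<in> frontier DL"
    then have q: "dist (- of_real m) q = r" using r by simp
    have qC: "q \<in> CL" "q \<notin> DL" using q by auto
    then have "q \<notin> CR" using disj by blast
    then have qT: "q \<in> S1 \<inter> S2 \<inter> - CR" using qC S1_supset S2_supset sub by blast
    show "transmission_at DL (- of_real m) k1 u q"
    proof (rule transmission_at_reflection[OF q r _ qT _ _ _ _ _ k(1)])
      \<comment> \<open>The other closed disk is taken out of the neighbourhood, so that every point
        outside CL is exterior to both disks and u = H there.\<close>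
      show "open (S1 \<inter> S2 \<inter> - CR)" by (intro open_Int oS1 open_S2) auto
      show "hol_plus_cnj (S1 \<inter> S2 \<inter> - CR) G1" by (rule hol_plus_cnj_subset[OF G1]) auto
      show "hol_plus_cnj (S1 \<inter> S2 \<inter> - CR) H" by (rule hol_plus_cnj_subset[OF H]) auto
      show "H z = G1 z - tau k1 * G1 (?rL z) + C" for z
        by (simp add: H_def G1_def v1_def t1_def)
      show "u z = H z" if "z \<in> S1 \<inter> S2 \<inter> - CR" "z \<notin> CL" for z
      proof -
        have "z \<notin> DL" "z \<notin> DR" using that sub by blast+
        then show ?thesis unfolding u_def by presburger
      qed
      show "u z = (1 - tau k1) * G1 z + C" if "z \<in> DL" for z
        using that unfolding u_def t1_def by presburger
    qed
  next
    fix q assume "q \<in> frontier DR"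
    then have q: "dist (of_real m) q = r" using r by simp
    have qC: "q \<in> CR" "q \<notin> DR" using q by auto
    then have "q \<notin> CL" using disj by blast
    then have qT: "q \<in> S1 \<inter> S2 \<inter> - CL" using qC S1_supset S2_supset sub by blast
    show "transmission_at DR (of_real m) k2 u q"
    proof (rule transmission_at_reflection[OF q r _ qT _ _ _ _ _ k(2)])
      show "open (S1 \<inter> S2 \<inter> - CL)" by (intro open_Int oS1 open_S2) auto
      show "hol_plus_cnj (S1 \<inter> S2 \<inter> - CL) G2" by (rule hol_plus_cnj_subset[OF G2]) auto
      show "hol_plus_cnj (S1 \<inter> S2 \<inter> - CL) H" by (rule hol_plus_cnj_subset[OF H]) auto
      show "H z = G2 z - tau k2 * G2 (?rR z) + (c + C)" if "z \<in> S1 \<inter> S2 \<inter> - CL" for z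
        using key[of z] that by (simp add: H_def G2_def t2_def)
      show "u z = H z" if "z \<in> S1 \<inter> S2 \<inter> - CL" "z \<notin> CR" for z
      proof -
        have "z \<notin> DL" "z \<notin> DR" using that sub by blast+
        then show ?thesis unfolding u_def by presburger
      qed
      show "u z = (1 - tau k2) * G2 z + (c + C)" if "z \<in> DR" for z
      proof -
        have "z \<notin> DL" using that sub disj by blast
        then show ?thesis using that unfolding u_def t2_def by presburger
      qed
    qed
  qed
  moreover have "(\<lambda>x. u x - h x) \<in> O[at_infinity](\<lambda>x. of_real (1 / norm x))"
  proof -
    have V1: "V differentiable (at 1)"
      by (rule hol_plus_cnj_differentiable[OF open_ball V(1)]) (use L1 in simp)
    have "(\<lambda>x. W x - 1) \<in> O[at_infinity](\<lambda>x. of_real (1 / norm x))"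
    proof (rule bigo_inverse_norm_shift)
      fix x :: complex assume x: "x \<noteq> of_real \<alpha>"
      then have "W x - 1 = of_real (2 * \<alpha>) / (x - of_real \<alpha>)" by (simp add: W_def field_simps)
      then show "norm (W x - 1) \<le> (2 * \<alpha>) / norm (x - of_real \<alpha>)"
        unfolding norm_divide norm_of_real using alpha by (metis norm_divide norm_of_real abs_of_pos zero_less_mult_iff zero_less_numeral order_refl)
    qed
    then have 1: "(\<lambda>x. V (W x) - V 1) \<in> O[at_infinity](\<lambda>x. of_real (1 / norm x))"
      by (rule bigo_inverse_norm_compose[OF V1])
    have "- of_real m \<in> CL" using r by simp
    then have mS2: "- of_real m \<in> S2" using S2_supset sub disj by blast
    have "(\<lambda>x. ?rL x - (- of_real m)) \<in> O[at_infinity](\<lambda>x. of_real (1 / norm x))"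
    proof (rule bigo_inverse_norm_shift)
      fix x show "norm (?rL x - (- of_real m)) \<le> r\<^sup>2 / norm (x - (- of_real m))"
        unfolding circle_refl_def by (simp add: norm_divide norm_power flip: complex_cnj_diff complex_cnj_add)
    qed
    then have 2: "(\<lambda>x. G1 (?rL x) - G1 (- of_real m)) \<in> O[at_infinity](\<lambda>x. of_real (1 / norm x))"
      by (rule bigo_inverse_norm_compose[OF hol_plus_cnj_differentiable[OF open_S2 G1 mS2]])
    have 3: "(\<lambda>x. (V (W x) - V 1) + (- t1) * (G1 (?rL x) - G1 (- of_real m))) \<in> O[at_infinity](\<lambda>x. of_real (1 / norm x))"
    proof (rule sum_in_bigo(1)[OF 1])
      show "(\<lambda>x. (- t1) * (G1 (?rL x) - G1 (- of_real m))) \<in> O[at_infinity](\<lambda>x. of_real (1 / norm x))"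
        using 2 by (cases "t1 = 0") simp_all
    qed
    have "bounded (CL \<union> CR)" by simp
    then obtain B where B: "\<And>x. x \<in> CL \<union> CR \<Longrightarrow> norm x \<le> B" unfolding bounded_iff by blast
    have "\<forall>\<^sub>F x in at_infinity. u x - h x = (V (W x) - V 1) + (- t1) * (G1 (?rL x) - G1 (- of_real m))"
      unfolding eventually_at_infinity
    proof (intro exI allI impI)
      fix x :: complex assume x: "B + 1 \<le> norm x"
      then have "x \<notin> CL \<union> CR" using B[of x] by linarith
      then have "x \<notin> DL" "x \<notin> DR" using sub by blast+
      then have "u x = H x" unfolding u_def by presburger
      then show "u x - h x = (V (W x) - V 1) + (- t1) * (G1 (?rL x) - G1 (- of_real m))"
        by (simp add: H_def C_def v1_def v2_def algebra_simps)
    qed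
    from landau_o.big.in_cong[OF this] 3 show ?thesis by blast
  qed
  ultimately show ?thesis using that by blast
qed

end


section \<open>Green's formula on circles and the boundary flux\<close>

text \<open>Continuity of l along C is not assumed; it follows from the unrestricted limits. For y
  in C near x, l y is a limit of values f w that are already within e / 2 of l x.\<close>

lemma continuous_on_boundary_extension:
  fixes f :: "'a::metric_space \<Rightarrow> 'b::metric_space"
  assumes S: "open S" "continuous_on S f" and C: "C \<subseteq> closure S" "C \<inter> S = {}"
    and lim: "\<And>p. p \<in> C \<Longrightarrow> (f \<longlongrightarrow> l p) (at p within S)"
  shows "continuous_on (S \<union> C) (\<lambda>z. if z \<in> S then f z else l z)"
proof -
  let ?g = "\<lambda>z. if z \<in> S then f z else l z"
  have "continuous (at x within S \<union> C) ?g" if x: "x \<in> S \<union> C" for x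
  proof (cases "x \<in> S")
    case True
    have "continuous (at x) f" using S True continuous_on_eq_continuous_at by blast
    then have "isCont ?g x"
      unfolding isCont_def using True
      by (auto intro: Lim_transform_within_open[OF _ S(1) True])
    then show ?thesis by (rule continuous_at_imp_continuous_within)
  next
    case False
    then have xC: "x \<in> C" using x by blast
    show ?thesis unfolding continuous_within_eps_delta
    proof (intro allI impI)
      fix e :: real assume e: "e > 0"
      from lim[OF xC] e obtain d where d: "d > 0" "\<And>y. y \<in> S \<Longrightarrow> y \<noteq> x \<Longrightarrow> dist y x < d \<Longrightarrow> dist (f y) (l x) < e / 2"
        unfolding Lim_within by (metis half_gt_zero zero_less_dist_iff)
      have "dist (?g y) (?g x) < e" if y: "y \<in> S \<union> C" "dist y x < d" for y
      proof (cases "y \<in> S")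
        case True
        then show ?thesis using d(2)[OF True _ y(2)] False e by (cases "y = x") auto
      next
        case yS: False
        then have yC: "y \<in> C" using y by blast
        have nt: "at y within S \<noteq> bot"
          using C yC yS trivial_limit_within not_trivial_limit_within closure_def by (metis DiffE Un_iff insert_Diff_single islimpt_in_closure subsetD Diff_empty Diff_insert0)
        have "\<forall>\<^sub>F w in at y within S. dist (f w) (l x) \<le> e / 2"
          unfolding eventually_at
        proof (intro exI[of _ "d - dist y x"] conjI ballI impI)
          show "0 < d - dist y x" using y by simp
          fix w assume w: "w \<in> S" "w \<noteq> y \<and> dist w y < d - dist y x"
          then have "dist w x < d" using dist_triangle[of w x y] by simp
          moreover have "w \<noteq> x" using w False by blast
          ultimately show "dist (f w) (l x) \<le> e / 2" using d(2)[OF w(1)] by fastforce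
        qed
        then have "dist (l y) (l x) \<le> e / 2"
          using tendsto_le[OF nt tendsto_const tendsto_dist[OF lim[OF yC] tendsto_const]] by blast
        then show ?thesis using yS False e by simp
      qed
      then show "\<exists>d>0. \<forall>y\<in>S \<union> C. dist y x < d \<longrightarrow> dist (?g y) (?g x) < e" using d(1) by blast
    qed
  qed
  then show ?thesis by (simp add: continuous_on_eq_continuous_within)
qed

text \<open>Allows the radius to tend to that of a boundary circle under the integral; the closed
  annulus includes the boundary values supplied by the previous extension.\<close>

lemma continuous_on_circle_integral:
  fixes F :: "complex \<Rightarrow> complex"
  assumes "continuous_on {z. a \<le> norm (z - c) \<and> norm (z - c) \<le> b} F" "0 \<le> a"
  shows "continuous_on {a..b} (\<lambda>\<rho>. integral {0..1} (\<lambda>t. F (circlepath c \<rho> t)))"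
proof -
  have n: "norm (circlepath c \<rho> t - c) = \<bar>\<rho>\<bar>" for \<rho> t
    by (simp add: circlepath norm_mult)
  have "continuous_on ({a..b} \<times> cbox 0 1) (\<lambda>(\<rho>, t). F (circlepath c \<rho> t))"
    unfolding case_prod_unfold
  proof (rule continuous_on_compose2[OF assms(1)])
    show "continuous_on ({a..b} \<times> cbox 0 1) (\<lambda>x. circlepath c (fst x) (snd x))"
      unfolding circlepath by (intro continuous_intros)
    show "(\<lambda>x. circlepath c (fst x) (snd x)) ` ({a..b} \<times> cbox 0 1) \<subseteq> {z. a \<le> norm (z - c) \<and> norm (z - c) \<le> b}"
      using assms(2) by (auto simp: n)
  qed
  from integral_continuous_on_param[OF this] show ?thesis by simp
qed

lemma harmonic_on_has_derivative:
  assumes "harmonic_on S u" "z \<in> S"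
  shows "(u has_derivative (\<lambda>h. dz u z * h + cnj (dz (\<lambda>x. cnj (u x)) z * h))) (at z)"
  by (rule has_derivative_dz) (use assms in \<open>auto simp: harmonic_on_def C2_on_def\<close>)

lemma normal_deriv_dz:
  assumes "harmonic_on S u" "z \<in> S"
  shows "normal_deriv c u z = dz u z * sgn (z - c) + cnj (dz (\<lambda>x. cnj (u x)) z * sgn (z - c))"
  unfolding normal_deriv_def
  by (rule frechet_derivative_dz) (use assms in \<open>auto simp: harmonic_on_def C2_on_def\<close>)

lemma continuous_on_normal_deriv:
  assumes "open S" "harmonic_on S u" "X \<subseteq> S" "c \<notin> X"
  shows "continuous_on X (normal_deriv c u)"
proof -
  have "continuous_on X (dz u)" "continuous_on X (dz (\<lambda>x. cnj (u x)))"
    using harmonic_on_dz_holomorphic assms harmonic_on_cnj holomorphic_on_imp_continuous_on continuous_on_subset by metis+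
  moreover have "continuous_on X (\<lambda>z. sgn (z - c))"
    unfolding sgn_div_norm by (intro continuous_intros) (use assms(4) in auto)
  ultimately have "continuous_on X (\<lambda>z. dz u z * sgn (z - c) + cnj (dz (\<lambda>x. cnj (u x)) z * sgn (z - c)))"
    by (intro continuous_intros) (use assms(4) in auto)
  then show ?thesis
    by (rule continuous_on_eq) (use normal_deriv_dz[OF assms(2)] assms(3) in auto)
qed

lemma harmonic_on_continuous_on: "harmonic_on S u \<Longrightarrow> continuous_on S u"
  by (meson C2_on_def differentiable_imp_continuous_on differentiable_at_imp_differentiable_on harmonic_on_def)

text \<open>A and B stand for u_z and the conjugate of u_zbar. On the circle \<gamma>' = 2 pi \<i>
  \<rho> e, so conjugating \<gamma>' changes the sign of the factor in front of cnj e. This sign is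
  the difference between the normal derivative and the tangential one, and it leaves only the term
  in f u_z. The constant \<i> / (pi \<rho>) is -2 / (2 pi \<i> \<rho>).\<close>

lemma circle_green_holomorphic:
  fixes c :: complex
  assumes \<rho>: "\<rho> > 0"
    and u: "\<And>z. z \<in> sphere c \<rho> \<Longrightarrow> (u has_derivative (\<lambda>h. A z * h + cnj (B z * h))) (at z)"
    and f: "\<And>z. z \<in> sphere c \<rho> \<Longrightarrow> (f has_field_derivative f' z) (at z)"
    and A: "continuous_on (sphere c \<rho>) A"
  defines "e \<equiv> \<lambda>z. sgn (z - c)"
  shows "((\<lambda>t. (\<lambda>z. u z * (f' z * e z) - f z * (A z * e z + cnj (B z * e z))) (circlepath c \<rho> t)) has_integral
     \<i> / (pi * \<rho>) * contour_integral (circlepath c \<rho>) (\<lambda>z. f z * A z)) {0..1}"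
proof -
  let ?\<gamma> = "circlepath c \<rho>"
  define E where "E t = exp (2 * of_real pi * \<i> * of_real t)" for t :: real
  define \<gamma>' where "\<gamma>' t = 2 * pi * \<i> * \<rho> * E t" for t
  have \<gamma>: "(?\<gamma> has_vector_derivative \<gamma>' t) (at t within X)" for t X
    unfolding \<gamma>'_def E_def by (rule has_vector_derivative_circlepath)
  have s: "?\<gamma> t \<in> sphere c \<rho>" for t
    using \<rho> by (simp add: circlepath dist_norm norm_mult)
  have nE: "norm (E t) = 1" for t by (simp add: E_def)
  have eE: "e (?\<gamma> t) = E t" for t
  proof -
    have "?\<gamma> t - c = of_real \<rho> * E t" by (simp add: circlepath E_def)
    then show ?thesis using \<rho> nE[of t] by (simp add: e_def sgn_mult sgn_of_real) (simp add: sgn_div_norm)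
  qed
  have "continuous_on (sphere c \<rho>) f"
    by (rule continuous_at_imp_continuous_on) (use f DERIV_isCont in blast)
  then have "continuous_on (path_image ?\<gamma>) (\<lambda>z. f z * A z)"
    using A \<rho> by (simp add: continuous_on_mult)
  then have "(\<lambda>z. f z * A z) contour_integrable_on ?\<gamma>"
    by (rule contour_integrable_continuous_circlepath)
  then have "((\<lambda>z. f z * A z) has_contour_integral contour_integral ?\<gamma> (\<lambda>z. f z * A z)) ?\<gamma>"
    by (rule has_contour_integral_integral)
  then have 1: "((\<lambda>t. f (?\<gamma> t) * A (?\<gamma> t) * \<gamma>' t) has_integral contour_integral ?\<gamma> (\<lambda>z. f z * A z)) {0..1}"
    unfolding has_contour_integral_def
    by (rule has_integral_cong[THEN iffD1, rotated]) (simp add: vector_derivative_circlepath01 \<gamma>'_def E_def)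
  \<comment> \<open>The Green integrand differs from $-2 f A\,dz$ only by the exact differential of $u f$.\<close>
  define P where "P t = u (?\<gamma> t) * (f' (?\<gamma> t) * \<gamma>' t) + f (?\<gamma> t) * (A (?\<gamma> t) * \<gamma>' t + cnj (B (?\<gamma> t) * \<gamma>' t))" for t
  have "((\<lambda>t. u (?\<gamma> t) * f (?\<gamma> t)) has_vector_derivative P t) (at t within {0..1})" for t
  proof -
    have a: "((\<lambda>t. f (?\<gamma> t)) has_vector_derivative f' (?\<gamma> t) * \<gamma>' t) (at t within {0..1})"
      using field_vector_diff_chain_within[OF \<gamma> has_field_derivative_at_within[OF f[OF s]]]
      by (simp add: o_def mult.commute)
    have b: "((\<lambda>t. u (?\<gamma> t)) has_vector_derivative (A (?\<gamma> t) * \<gamma>' t + cnj (B (?\<gamma> t) * \<gamma>' t))) (at t within {0..1})"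
    proof -
      have "((\<lambda>t. u (?\<gamma> t)) has_derivative (\<lambda>h. A (?\<gamma> t) * (h *\<^sub>R \<gamma>' t) + cnj (B (?\<gamma> t) * (h *\<^sub>R \<gamma>' t)))) (at t within {0..1})"
        by (rule has_derivative_compose[OF \<gamma>[unfolded has_vector_derivative_def] u[OF s]])
      then show ?thesis
        unfolding has_vector_derivative_def by (simp add: scaleR_right_distrib)
    qed
    show ?thesis
      using has_vector_derivative_mult[OF b a] unfolding P_def by (simp add: mult.commute)
  qed
  then have "(P has_integral (u (?\<gamma> 1) * f (?\<gamma> 1) - u (?\<gamma> 0) * f (?\<gamma> 0))) {0..1}"
    by (intro fundamental_theorem_of_calculus) auto
  moreover have "?\<gamma> 1 = ?\<gamma> 0" by (simp add: circlepath)
  ultimately have 2: "(P has_integral 0) {0..1}" by simp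
  from has_integral_mult_right[OF has_integral_diff[OF 2 has_integral_mult_right[OF 1, of 2]], of "1 / (2 * pi * \<i> * \<rho>)"]
  have "((\<lambda>t. 1 / (2 * pi * \<i> * \<rho>) * (P t - 2 * (f (?\<gamma> t) * A (?\<gamma> t) * \<gamma>' t))) has_integral
     1 / (2 * pi * \<i> * \<rho>) * (0 - 2 * contour_integral ?\<gamma> (\<lambda>z. f z * A z))) {0..1}" .
  moreover have "1 / (2 * pi * \<i> * \<rho>) * (0 - 2 * contour_integral ?\<gamma> (\<lambda>z. f z * A z)) =
      \<i> / (pi * \<rho>) * contour_integral ?\<gamma> (\<lambda>z. f z * A z)"
    using \<rho> by (simp add: field_simps)
  moreover have "1 / (2 * pi * \<i> * \<rho>) * (P t - 2 * (f (?\<gamma> t) * A (?\<gamma> t) * \<gamma>' t)) =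
     (\<lambda>z. u z * (f' z * e z) - f z * (A z * e z + cnj (B z * e z))) (?\<gamma> t)" for t
    unfolding eE P_def \<gamma>'_def using \<rho> by (simp add: field_simps)
  ultimately show ?thesis by simp
qed

text \<open>The integrand is linear in \<phi>: f is paired with u, and g with cnj u followed by
  conjugation. Conjugating \<i> / (pi \<rho>) produces the minus sign.\<close>

lemma circle_green:
  assumes S: "open S" "sphere c \<rho> \<subseteq> S" and \<rho>: "\<rho> > 0"
    and u: "harmonic_on S u"
    and fg: "f holomorphic_on S" "g holomorphic_on S" "\<And>z. z \<in> S \<Longrightarrow> \<phi> z = f z + cnj (g z)"
  shows "integral {0..1} (\<lambda>t. (\<lambda>z. u z * normal_deriv c \<phi> z - \<phi> z * normal_deriv c u z) (circlepath c \<rho> t)) =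
     \<i> / (pi * \<rho>) * (contour_integral (circlepath c \<rho>) (\<lambda>z. f z * dz u z)
       - cnj (contour_integral (circlepath c \<rho>) (\<lambda>z. g z * dz (\<lambda>x. cnj (u x)) z)))"
proof -
  let ?v = "\<lambda>x. cnj (u x)"
  let ?e = "\<lambda>z. sgn (z - c)"
  have v: "harmonic_on S ?v" by (rule harmonic_on_cnj[OF S(1) u])
  have sph: "circlepath c \<rho> t \<in> sphere c \<rho>" for t
    using \<rho> by (simp add: circlepath dist_norm norm_mult)
  have der: "(f has_field_derivative deriv f z) (at z)" "(g has_field_derivative deriv g z) (at z)" if "z \<in> sphere c \<rho>" for z
    using fg S that holomorphic_derivI by blast+
  have con: "continuous_on (sphere c \<rho>) (dz u)" "continuous_on (sphere c \<rho>) (dz ?v)"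
    using harmonic_on_dz_holomorphic[OF S(1)] u v S(2) holomorphic_on_imp_continuous_on continuous_on_subset by blast+
  have uz: "(u has_derivative (\<lambda>h. dz u z * h + cnj (dz ?v z * h))) (at z)" if "z \<in> sphere c \<rho>" for z
    using harmonic_on_has_derivative[OF u] that S(2) by blast
  have vz: "(?v has_derivative (\<lambda>h. dz ?v z * h + cnj (dz u z * h))) (at z)" if "z \<in> sphere c \<rho>" for z
    using harmonic_on_has_derivative[OF v, of z] that S(2) by auto
  have 1: "((\<lambda>t. (\<lambda>z. u z * (deriv f z * ?e z) - f z * (dz u z * ?e z + cnj (dz ?v z * ?e z))) (circlepath c \<rho> t)) has_integral
     \<i> / (pi * \<rho>) * contour_integral (circlepath c \<rho>) (\<lambda>z. f z * dz u z)) {0..1}"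
    by (rule circle_green_holomorphic[OF \<rho> uz der(1) con(1)])
  have "((\<lambda>t. (\<lambda>z. ?v z * (deriv g z * ?e z) - g z * (dz ?v z * ?e z + cnj (dz u z * ?e z))) (circlepath c \<rho> t)) has_integral
     \<i> / (pi * \<rho>) * contour_integral (circlepath c \<rho>) (\<lambda>z. g z * dz ?v z)) {0..1}"
    by (rule circle_green_holomorphic[OF \<rho> vz der(2) con(2)])
  from has_integral_cnj[THEN iffD2, OF this]
  have 2: "((\<lambda>t. cnj ((\<lambda>z. ?v z * (deriv g z * ?e z) - g z * (dz ?v z * ?e z + cnj (dz u z * ?e z))) (circlepath c \<rho> t))) has_integral
     cnj (\<i> / (pi * \<rho>) * contour_integral (circlepath c \<rho>) (\<lambda>z. g z * dz ?v z))) {0..1}"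
    by (simp add: o_def)
  have nu: "normal_deriv c u z = dz u z * ?e z + cnj (dz ?v z * ?e z)" if "z \<in> sphere c \<rho>" for z
    using normal_deriv_dz[OF u] that S(2) by blast
  have n\<phi>: "normal_deriv c \<phi> z = deriv f z * ?e z + cnj (deriv g z * ?e z)" if "z \<in> sphere c \<rho>" for z
  proof -
    have z: "z \<in> S" using that S(2) by blast
    show ?thesis
      unfolding normal_deriv_def
      by (rule fun_cong[OF frechet_derivative_at[OF hol_plus_cnj_has_derivative[OF S(1) fg z], symmetric]])
  qed
  have "(\<lambda>z. u z * normal_deriv c \<phi> z - \<phi> z * normal_deriv c u z) z =
      (\<lambda>z. u z * (deriv f z * ?e z) - f z * (dz u z * ?e z + cnj (dz ?v z * ?e z))) z +
      cnj ((\<lambda>z. ?v z * (deriv g z * ?e z) - g z * (dz ?v z * ?e z + cnj (dz u z * ?e z))) z)"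
    if "z \<in> sphere c \<rho>" for z
    using that S(2) fg(3)[of z] by (simp add: nu[OF that] n\<phi>[OF that] subset_iff algebra_simps)
  from this[OF sph] has_integral_add[OF 1 2]
  have "((\<lambda>t. (\<lambda>z. u z * normal_deriv c \<phi> z - \<phi> z * normal_deriv c u z) (circlepath c \<rho> t)) has_integral
     (\<i> / (pi * \<rho>) * contour_integral (circlepath c \<rho>) (\<lambda>z. f z * dz u z)
      + cnj (\<i> / (pi * \<rho>) * contour_integral (circlepath c \<rho>) (\<lambda>z. g z * dz ?v z)))) {0..1}"
    by simp
  from integral_unique[OF this] show ?thesis by (simp add: algebra_simps)
qed


lemma sphere_in_closure_annulus:
  fixes c :: complex
  assumes "0 < r" "r < R"
  shows "sphere c r \<subseteq> closure (ball c R - cball c r)"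
proof
  fix p assume p: "p \<in> sphere c r"
  then have np: "norm (p - c) = r" by (simp add: dist_norm norm_minus_commute)
  show "p \<in> closure (ball c R - cball c r)"
    unfolding closure_approachable
  proof (intro allI impI)
    fix e :: real assume e: "e > 0"
    define s where "s = min (e / (2 * r)) ((R - r) / (2 * r))"
    have "s * r \<le> (R - r) / (2 * r) * r" "s * r \<le> e / (2 * r) * r"
      using assms by (intro mult_right_mono; simp add: s_def)+
    then have s: "s > 0" "s * r < R - r" "s * r < e"
      using assms e by (auto simp: s_def)
    define y where "y = p + s *\<^sub>R (p - c)"
    have "y - c = (1 + s) *\<^sub>R (p - c)" by (simp add: y_def algebra_simps)
    then have "norm (y - c) = (1 + s) * r" using s np by simp
    then have "r < norm (y - c)" "norm (y - c) < R" using s assms by (auto simp: algebra_simps)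
    moreover have "dist y p < e" using s np by (simp add: y_def dist_norm)
    ultimately show "\<exists>y\<in>ball c R - cball c r. dist y p < e"
      by (intro bexI[of _ y]) (auto simp: dist_norm norm_minus_commute)
  qed
qed

text \<open>For $k = 0$ the function $u$ need not be harmonic inside, but then both outer normal
  derivatives vanish on the circle.\<close>

lemma boundary_flux_tendsto_0:
  fixes c :: complex
  assumes r: "0 < r" "r < R" and k: "k \<noteq> -1"
    and uo: "harmonic_on (ball c R - cball c r) u"
    and ui: "k \<noteq> 0 \<Longrightarrow> harmonic_on (ball c r) u"
    and tr: "\<And>p. p \<in> sphere c r \<Longrightarrow> transmission_at (ball c r) c k u p"
    and G: "hol_plus_cnj (ball c R) G"
    and T: "open T" "T \<subseteq> ball c R" "ball c R - ball c r \<subseteq> T"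
    and fg: "f holomorphic_on T" "g holomorphic_on T" "\<And>z. z \<in> T \<Longrightarrow> \<phi> z = f z + cnj (g z)"
    and \<phi>G: "\<And>z. z \<in> T \<Longrightarrow> \<phi> z = G z - tau k * G (circle_refl c r z)"
  shows "((\<lambda>\<rho>. contour_integral (circlepath c \<rho>) (\<lambda>z. f z * dz u z)
       - cnj (contour_integral (circlepath c \<rho>) (\<lambda>z. g z * dz (\<lambda>x. cnj (u x)) z))) \<longlongrightarrow> 0) (at_right r)"
proof -
  define t where "t = tau k"
  define E where "E = ball c R - cball c r"
  let ?n = "normal_deriv c"
  let ?I = "\<lambda>F \<rho>. integral {0..1} (\<lambda>t. F (circlepath c \<rho> t))"
  have oE: "open E" by (simp add: E_def open_Diff)
  have ET: "E \<subseteq> T" "sphere c r \<subseteq> T" using T(3) r by (auto simp: E_def)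
  have cl: "closure (ball c r) = cball c r" using r by simp
  have "\<forall>p\<in>sphere c r. \<exists>l d di. (u \<longlongrightarrow> l) (at p within - closure (ball c r)) \<and> (u \<longlongrightarrow> l) (at p within ball c r) \<and>
     (?n u \<longlongrightarrow> d) (at p within - closure (ball c r)) \<and> (?n u \<longlongrightarrow> di) (at p within ball c r) \<and> d = k * di"
    using tr unfolding transmission_at_def by blast
  then obtain l d di where ldd: "\<And>p. p \<in> sphere c r \<Longrightarrow> (u \<longlongrightarrow> l p) (at p within - closure (ball c r))"
     "\<And>p. p \<in> sphere c r \<Longrightarrow> (u \<longlongrightarrow> l p) (at p within ball c r)"
     "\<And>p. p \<in> sphere c r \<Longrightarrow> (?n u \<longlongrightarrow> d p) (at p within - closure (ball c r))"
     "\<And>p. p \<in> sphere c r \<Longrightarrow> (?n u \<longlongrightarrow> di p) (at p within ball c r)"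
     "\<And>p. p \<in> sphere c r \<Longrightarrow> d p = k * di p"
    by metis
  have Esub: "E \<subseteq> - closure (ball c r)" unfolding cl by (auto simp: E_def)
  have circ: "circlepath c \<rho> t \<in> sphere c \<rho>" if "\<rho> > 0" for \<rho> t
    using that by (simp add: circlepath dist_norm norm_mult)
  have \<phi>T: "hol_plus_cnj T \<phi>" using fg hol_plus_cnjI by blast
  have \<phi>h: "harmonic_on T \<phi>" by (rule hol_plus_cnj_harmonic[OF T(1) \<phi>T])
  have Gh: "harmonic_on (ball c R) G" by (rule hol_plus_cnj_harmonic[OF open_ball G])
  \<comment> \<open>The Green integrand of u and \<phi>, extended to the circle by the outer limits
    of u and of its normal derivative.\<close>
  define Fo where "Fo z = (if z \<in> E then u z else l z) * ?n \<phi> z - \<phi> z * (if z \<in> E then ?n u z else d z)" for z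
  define R' where "R' = (r + R) / 2"
  have R': "r < R'" "R' < R" using r by (auto simp: R'_def)
  have ann: "{z. r \<le> norm (z - c) \<and> norm (z - c) \<le> R'} \<subseteq> E \<union> sphere c r"
    using R' by (auto simp: E_def dist_norm norm_minus_commute)
  have cE: "c \<notin> E" "c \<notin> sphere c r" using r by (auto simp: E_def)
  have conFo: "continuous_on (E \<union> sphere c r) Fo"
    unfolding Fo_def
  proof (intro continuous_on_diff continuous_on_mult)
    have dis: "sphere c r \<inter> E = {}" by (auto simp: E_def)
    have cls: "sphere c r \<subseteq> closure E" unfolding E_def by (rule sphere_in_closure_annulus[OF r])
    show "continuous_on (E \<union> sphere c r) (\<lambda>z. if z \<in> E then u z else l z)"
      by (rule continuous_on_boundary_extension[OF oE _ cls dis])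
         (use uo harmonic_on_continuous_on E_def ldd(1) tendsto_within_subset[OF _ Esub] in blast)+
    have "continuous_on E (?n u)"
      by (rule continuous_on_normal_deriv[OF oE _ subset_refl cE(1)]) (use uo E_def in simp)
    then show "continuous_on (E \<union> sphere c r) (\<lambda>z. if z \<in> E then ?n u z else d z)"
      by (rule continuous_on_boundary_extension[OF oE _ cls dis])
         (use ldd(3) tendsto_within_subset[OF _ Esub] in blast)
    show "continuous_on (E \<union> sphere c r) (?n \<phi>)"
      by (rule continuous_on_normal_deriv[OF T(1) \<phi>h]) (use ET cE in auto)
    show "continuous_on (E \<union> sphere c r) \<phi>"
      using continuous_on_subset[OF harmonic_on_continuous_on[OF \<phi>h]] ET by blast
  qed
  have "continuous_on {r..R'} (?I Fo)"
    by (rule continuous_on_circle_integral[OF continuous_on_subset[OF conFo ann]]) (use r in simp)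
  then have "(?I Fo \<longlongrightarrow> ?I Fo r) (at r within {r..R'})"
    unfolding continuous_on_def using R' by auto
  then have limo: "(?I Fo \<longlongrightarrow> ?I Fo r) (at_right r)"
    using at_within_Icc_at_right[OF R'(1)] by simp
  have n\<phi>: "\<phi> p = (1 - t) * G p" "?n \<phi> p = k * (1 - t) * ?n G p" if p: "p \<in> sphere c r" for p
  proof -
    have d: "dist c p = r" using p by simp
    have pT: "p \<in> T" using p ET by blast
    show "\<phi> p = (1 - t) * G p"
      using \<phi>G[OF pT] circle_refl_fixed[OF d r(1)] by (simp add: t_def algebra_simps)
    have "k + 1 \<noteq> 0" using k by (simp add: add_eq_0_iff2)
    then have kt: "1 + t = k * (1 - t)" by (simp add: t_def tau_def field_simps)
    have "?n \<phi> p = (1 + t) * ?n G p"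
      unfolding normal_deriv_def
      by (rule frechet_derivative_reflected[OF d r(1) T(1) pT hol_plus_cnj_subset[OF G T(2)], where C = 0])
         (simp add: \<phi>G t_def)
    then show "?n \<phi> p = k * (1 - t) * ?n G p" unfolding kt .
  qed
  have zero: "?I Fo r = 0"
  proof -
    define Fi where "Fi z = (if z \<in> ball c r then u z else l z) * ?n G z - G z * (if z \<in> ball c r then ?n u z else di z)" for z
    \<comment> \<open>On the circle \<phi> has value (1 - t) G and normal derivative k (1 - t) times
      that of G, while d = k di for u. Hence the outer integrand is a multiple of the inner one
      formed with G.\<close>
    have FoFi: "Fo p = k * (1 - t) * Fi p" if p: "p \<in> sphere c r" for p
    proof -
      have "p \<notin> E" "p \<notin> ball c r" using p by (auto simp: E_def)
      then have fo: "Fo p = l p * ?n \<phi> p - \<phi> p * d p" and fi: "Fi p = l p * ?n G p - G p * di p"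
        unfolding Fo_def Fi_def by presburger+
      show ?thesis unfolding fo fi n\<phi>[OF p] ldd(5)[OF p] by (simp add: algebra_simps)
    qed
    have "?I Fo r = ?I (\<lambda>p. k * (1 - t) * Fi p) r"
      by (rule integral_cong) (rule FoFi[OF circ[OF r(1)]])
    then have e: "?I Fo r = k * (1 - t) * ?I Fi r" by simp
    show ?thesis
    proof (cases "k = 0")
      case True then show ?thesis using e by simp
    next
      case False
      have ui': "harmonic_on (ball c r) u" using ui False by blast
      let ?A = "{z. r / 2 \<le> norm (z - c) \<and> norm (z - c) \<le> r}"
      have bR: "ball c r \<subseteq> ball c R" "ball c r \<union> sphere c r \<subseteq> ball c R" using r by auto
      have A: "?A \<subseteq> ball c r \<union> sphere c r" "c \<notin> ?A" "?A \<subseteq> ball c R"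
        using r by (auto simp: dist_norm norm_minus_commute)
      \<comment> \<open>The direction \<open>sgn (z - c)\<close> is discontinuous at the centre, so
        the normal derivative is extended from the punctured disk.\<close>
      let ?P = "ball c r - {c}"
      have oP: "open ?P" by (simp add: open_delete)
      have clP: "sphere c r \<subseteq> closure ?P"
      proof -
        have "insert c ?P = ball c r" using r by auto
        then have "closure (ball c r) = insert c (closure ?P)" by (metis closure_insert)
        then have "sphere c r \<subseteq> insert c (closure ?P)" using cl sphere_cball by metis
        then show ?thesis using cE(2) by blast
      qed
      have conFi: "continuous_on ?A Fi"
        unfolding Fi_def
      proof (intro continuous_on_diff continuous_on_mult)
        have 1: "continuous_on (ball c r \<union> sphere c r) (\<lambda>z. if z \<in> ball c r then u z else l z)"
          by (rule continuous_on_boundary_extension[OF open_ball harmonic_on_continuous_on[OF ui']])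
             (use ldd(2) cl in auto)
        then show "continuous_on ?A (\<lambda>z. if z \<in> ball c r then u z else l z)"
          using A(1) by (rule continuous_on_subset)
        have 2: "continuous_on ?P (?n u)"
          by (rule continuous_on_normal_deriv[OF open_ball ui']) auto
        have "(?n u \<longlongrightarrow> di p) (at p within ?P)" if "p \<in> sphere c r" for p
          by (rule tendsto_within_subset[OF ldd(4)[OF that]]) auto
        then have "continuous_on (?P \<union> sphere c r) (\<lambda>z. if z \<in> ?P then ?n u z else di z)"
          by (intro continuous_on_boundary_extension[OF oP 2 clP]) auto
        then have "continuous_on ?A (\<lambda>z. if z \<in> ?P then ?n u z else di z)"
          by (rule continuous_on_subset) (use A in auto)
        then show "continuous_on ?A (\<lambda>z. if z \<in> ball c r then ?n u z else di z)"
          by (rule continuous_on_eq) (use A(2) in auto)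
        show "continuous_on ?A (?n G)"
          by (rule continuous_on_normal_deriv[OF open_ball Gh A(3,2)])
        show "continuous_on ?A G"
          by (rule continuous_on_subset[OF harmonic_on_continuous_on[OF Gh] A(3)])
      qed
      have r2: "r / 2 < r" using r by simp
      have "continuous_on {r / 2..r} (?I Fi)"
        by (rule continuous_on_circle_integral[OF conFi]) (use r in simp)
      then have "(?I Fi \<longlongrightarrow> ?I Fi r) (at r within {r / 2..r})"
        unfolding continuous_on_def using r by auto
      then have "(?I Fi \<longlongrightarrow> ?I Fi r) (at_left r)"
        using at_within_Icc_at_left[OF r2] by simp
      \<comment> \<open>On circles inside the disk Green's formula leaves integrals of products of
        functions holomorphic in the whole disk, which vanish by Cauchy's theorem.\<close>
      moreover have "(?I Fi \<longlongrightarrow> 0) (at_left r)"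
      proof (rule Lim_transform_eventually[OF tendsto_const])
        obtain fG gG where fgG: "fG holomorphic_on ball c R" "gG holomorphic_on ball c R"
          "\<And>z. z \<in> ball c R \<Longrightarrow> G z = fG z + cnj (gG z)"
          using G unfolding hol_plus_cnj_def by blast
        have "0 = ?I Fi \<rho>" if \<rho>: "r / 2 < \<rho>" "\<rho> < r" for \<rho>
        proof -
          have \<rho>0: "\<rho> > 0" using \<rho> r by linarith
          have sp: "sphere c \<rho> \<subseteq> ball c r" using \<rho> by auto
          have "?I Fi \<rho> = ?I (\<lambda>z. u z * ?n G z - G z * ?n u z) \<rho>"
          proof (rule integral_cong)
            fix s :: real
            have "circlepath c \<rho> s \<in> ball c r" using circ[OF \<rho>0] sp by blast
            then show "Fi (circlepath c \<rho> s) = (\<lambda>z. u z * ?n G z - G z * ?n u z) (circlepath c \<rho> s)"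
              unfolding Fi_def by presburger
          qed
          also have "\<dots> = \<i> / (pi * \<rho>) * (contour_integral (circlepath c \<rho>) (\<lambda>z. fG z * dz u z)
             - cnj (contour_integral (circlepath c \<rho>) (\<lambda>z. gG z * dz (\<lambda>x. cnj (u x)) z)))"
            by (rule circle_green[OF open_ball sp \<rho>0 ui'])
               (use fgG bR holomorphic_on_subset in auto)
          also have "contour_integral (circlepath c \<rho>) (\<lambda>z. fG z * dz u z) = 0"
          proof (rule contour_integral_unique[OF Cauchy_theorem_convex_simple[of _ "ball c r"]])
            show "(\<lambda>z. fG z * dz u z) holomorphic_on ball c r"
              using holomorphic_on_subset[OF fgG(1) bR(1)] harmonic_on_dz_holomorphic[OF open_ball ui']
              by (rule holomorphic_on_mult)
          qed (use sp \<rho>0 in auto)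
          also have "contour_integral (circlepath c \<rho>) (\<lambda>z. gG z * dz (\<lambda>x. cnj (u x)) z) = 0"
          proof (rule contour_integral_unique[OF Cauchy_theorem_convex_simple[of _ "ball c r"]])
            show "(\<lambda>z. gG z * dz (\<lambda>x. cnj (u x)) z) holomorphic_on ball c r"
              using holomorphic_on_subset[OF fgG(2) bR(1)] harmonic_on_dz_holomorphic[OF open_ball harmonic_on_cnj[OF open_ball ui']]
              by (rule holomorphic_on_mult)
          qed (use sp \<rho>0 in auto)
          finally show ?thesis by simp
        qed
        then show "\<forall>\<^sub>F \<rho> in at_left r. 0 = ?I Fi \<rho>"
          unfolding eventually_at_left_field using r2 by blast
      qed
      ultimately have "?I Fi r = 0" using tendsto_unique[OF trivial_limit_at_left_real] by blast
      then show ?thesis using e by simp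
    qed
  qed
  let ?\<Phi> = "\<lambda>\<rho>. contour_integral (circlepath c \<rho>) (\<lambda>z. f z * dz u z)
       - cnj (contour_integral (circlepath c \<rho>) (\<lambda>z. g z * dz (\<lambda>x. cnj (u x)) z))"
  \<comment> \<open>The factor pi \<rho> / \<i> undoes the constant \<i> / (pi \<rho>) of
    \<open>circle_green\<close>.\<close>
  have "((\<lambda>\<rho>. (pi * of_real \<rho> / \<i>) * ?I Fo \<rho>) \<longlongrightarrow> (pi * of_real r / \<i>) * 0) (at_right r)"
    using limo unfolding zero by (intro tendsto_intros) auto
  then have "((\<lambda>\<rho>. (pi * of_real \<rho> / \<i>) * ?I Fo \<rho>) \<longlongrightarrow> 0) (at_right r)" by simp
  then show ?thesis
  proof (rule Lim_transform_eventually)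
    have "(pi * of_real \<rho> / \<i>) * ?I Fo \<rho> = ?\<Phi> \<rho>" if \<rho>: "r < \<rho>" "\<rho> < R" for \<rho>
    proof -
      have \<rho>0: "\<rho> > 0" using \<rho> r by linarith
      have sp: "sphere c \<rho> \<subseteq> E" using \<rho> by (auto simp: E_def)
      have "?I Fo \<rho> = ?I (\<lambda>z. u z * ?n \<phi> z - \<phi> z * ?n u z) \<rho>"
      proof (rule integral_cong)
        fix s :: real
        have "circlepath c \<rho> s \<in> E" using circ[OF \<rho>0] sp by blast
        then show "Fo (circlepath c \<rho> s) = (\<lambda>z. u z * ?n \<phi> z - \<phi> z * ?n u z) (circlepath c \<rho> s)"
          unfolding Fo_def by presburger
      qed
      also have "\<dots> = \<i> / (pi * \<rho>) * ?\<Phi> \<rho>"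
        by (rule circle_green[OF oE sp \<rho>0 uo[folded E_def]])
           (use fg ET holomorphic_on_subset in auto)
      finally show ?thesis using \<rho>0 by simp
    qed
    then show "\<forall>\<^sub>F \<rho> in at_right r. (pi * of_real \<rho> / \<i>) * ?I Fo \<rho> = ?\<Phi> \<rho>"
      unfolding eventually_at_right_field using r(2) by blast
  qed
qed

section \<open>Deformation of contours and behaviour at infinity\<close>

lemma Cauchy_theorem_two_cycles:
  assumes S: "open S" "connected S" and f: "f holomorphic_on S"
    and v: "valid_path a" "valid_path b" "valid_path c"
    and loop: "pathfinish a = pathstart a" "pathfinish b = pathstart b" "pathfinish c = pathstart c"
    and im: "path_image a \<subseteq> S" "path_image b \<subseteq> S" "path_image c \<subseteq> S"
    and wn: "\<And>w. w \<notin> S \<Longrightarrow> winding_number a w = winding_number b w + winding_number c w"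
  shows "contour_integral a f = contour_integral b f + contour_integral c f"
proof -
  have conn: "\<exists>g. valid_path g \<and> path_image g \<subseteq> S \<and> pathstart g = x \<and> pathfinish g = y" if "x \<in> S" "y \<in> S" for x y
    using connected_open_polynomial_connected[OF S that] valid_path_polynomial_function by blast
  have st: "pathstart a \<in> S" "pathstart b \<in> S" "pathstart c \<in> S" using im pathstart_in_path_image by blast+
  obtain p where p: "valid_path p" "path_image p \<subseteq> S" "pathstart p = pathstart a" "pathfinish p = pathstart b"
    using conn[OF st(1,2)] by blast
  obtain q where q: "valid_path q" "path_image q \<subseteq> S" "pathstart q = pathstart a" "pathfinish q = pathstart c"
    using conn[OF st(1,3)] by blast
  \<comment> \<open>The single loop l1 runs through a, p, b reversed, p reversed, q, c reversed, q
    reversed. The connecting paths cancel in winding numbers and integrals, so the homology form of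
    Cauchy's theorem applies to l1.\<close>
  define l6 where "l6 = reversepath c +++ reversepath q"
  define l5 where "l5 = q +++ l6"
  define l4 where "l4 = reversepath p +++ l5"
  define l3 where "l3 = reversepath b +++ l4"
  define l2 where "l2 = p +++ l3"
  define l1 where "l1 = a +++ l2"
  note defs = l1_def l2_def l3_def l4_def l5_def l6_def
  have vl: "valid_path l6" "valid_path l5" "valid_path l4" "valid_path l3" "valid_path l2" "valid_path l1"
    using v p q loop by (auto simp: defs intro!: valid_path_join)
  have iml: "path_image l6 \<subseteq> S" "path_image l5 \<subseteq> S" "path_image l4 \<subseteq> S" "path_image l3 \<subseteq> S" "path_image l2 \<subseteq> S" "path_image l1 \<subseteq> S"
    using im p q loop by (auto simp: defs path_image_join)
  have ends: "pathstart l6 = pathstart c" "pathstart l5 = pathstart a" "pathstart l4 = pathstart b" "pathstart l3 = pathstart b" "pathstart l2 = pathstart a" "pathstart l1 = pathstart a" "pathfinish l1 = pathstart a"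
    using p q loop by (auto simp: defs)
  have wj: "winding_number (x +++ y) w = winding_number x w + winding_number y w"
    if "valid_path x" "valid_path y" "path_image x \<subseteq> S" "path_image y \<subseteq> S" "pathfinish x = pathstart y" "w \<notin> S" for x y w
    by (rule winding_number_join) (use that valid_path_imp_path in auto)
  have wr: "winding_number (reversepath x) w = - winding_number x w" if "valid_path x" "path_image x \<subseteq> S" "w \<notin> S" for x w
    by (rule winding_number_reversepath) (use that valid_path_imp_path in auto)
  have ij: "contour_integral (x +++ y) f = contour_integral x f + contour_integral y f"
    if "valid_path x" "valid_path y" "path_image x \<subseteq> S" "path_image y \<subseteq> S" for x y
    using contour_integral_join[of f x y] contour_integrable_holomorphic_simple[OF f S(1)] that by blast
  have "winding_number l1 w = 0" if w: "w \<notin> S" for w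
  proof -
    have "winding_number l1 w = winding_number a w + winding_number l2 w"
      unfolding l1_def by (rule wj) (use v vl im iml ends loop w in auto)
    also have "winding_number l2 w = winding_number p w + winding_number l3 w"
      unfolding l2_def by (rule wj) (use p vl im iml ends loop w in auto)
    also have "winding_number l3 w = winding_number (reversepath b) w + winding_number l4 w"
      unfolding l3_def by (rule wj) (use v vl im iml ends loop w in auto)
    also have "winding_number l4 w = winding_number (reversepath p) w + winding_number l5 w"
      unfolding l4_def by (rule wj) (use p vl im iml ends loop w in auto)
    also have "winding_number l5 w = winding_number q w + winding_number l6 w"
      unfolding l5_def by (rule wj) (use q vl im iml ends loop w in auto)
    also have "winding_number l6 w = winding_number (reversepath c) w + winding_number (reversepath q) w"
      unfolding l6_def by (rule wj) (use v q vl im iml ends loop w in auto)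
    finally show ?thesis using wn[OF w] wr[OF v(2) im(2) w] wr[OF v(3) im(3) w] wr[OF p(1,2) w] wr[OF q(1,2) w] by simp
  qed
  then have "(f has_contour_integral 0) l1"
    by (intro Cauchy_theorem_global[OF S(1) f vl(6) _ iml(6)]) (simp_all add: ends)
  then have "0 = contour_integral l1 f" using contour_integral_unique by metis
  also have "\<dots> = contour_integral a f + contour_integral l2 f"
    unfolding l1_def by (rule ij) (use v vl im iml in auto)
  also have "contour_integral l2 f = contour_integral p f + contour_integral l3 f"
    unfolding l2_def by (rule ij) (use p vl im iml in auto)
  also have "contour_integral l3 f = contour_integral (reversepath b) f + contour_integral l4 f"
    unfolding l3_def by (rule ij) (use v vl im iml in auto)
  also have "contour_integral l4 f = contour_integral (reversepath p) f + contour_integral l5 f"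
    unfolding l4_def by (rule ij) (use p vl im iml in auto)
  also have "contour_integral l5 f = contour_integral q f + contour_integral l6 f"
    unfolding l5_def by (rule ij) (use q vl im iml in auto)
  also have "contour_integral l6 f = contour_integral (reversepath c) f + contour_integral (reversepath q) f"
    unfolding l6_def by (rule ij) (use v q vl im iml in auto)
  finally have "0 = contour_integral a f + (contour_integral p f + (- contour_integral b f
      + (- contour_integral p f + (contour_integral q f + (- contour_integral c f + - contour_integral q f)))))"
    unfolding contour_integral_reversepath[OF v(2)] contour_integral_reversepath[OF v(3)]
      contour_integral_reversepath[OF p(1)] contour_integral_reversepath[OF q(1)] .
  then show ?thesis by algebra
qed

text \<open>Since \<psi> - l / z is o(1 / z), its integral over a circle of radius M tends to 0 as M
  grows, whereas K does not depend on M.\<close>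

lemma contour_integral_at_infinity:
  fixes \<psi> :: "complex \<Rightarrow> complex"
  assumes lim: "((\<lambda>z. z * \<psi> z) \<longlongrightarrow> l) at_infinity"
    and int: "\<And>M. M > B \<Longrightarrow> (\<psi> has_contour_integral K) (circlepath 0 M)"
  shows "K = 2 * of_real pi * \<i> * l"
proof -
  have le: "norm (K - 2 * of_real pi * \<i> * l) \<le> e" if e: "e > 0" for e
  proof -
    define e' where "e' = e / (2 * pi)"
    have e': "e' > 0" using e by (simp add: e'_def)
    obtain N where N: "\<And>z. norm z \<ge> N \<Longrightarrow> dist (z * \<psi> z) l < e'"
      using tendstoD[OF lim e'] unfolding eventually_at_infinity by blast
    define M where "M = max (max N (B + 1)) 1"
    have M: "M > B" "M \<ge> N" "M > 0" by (auto simp: M_def)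
    have "((\<lambda>z. 1 / (z - 0)) has_contour_integral 2 * of_real pi * \<i>) (circlepath 0 M)"
    proof -
      have "continuous_on (path_image (circlepath 0 M)) (\<lambda>z::complex. 1 / (z - 0))"
        using M(3) by (intro continuous_intros) auto
      from has_contour_integral_integral[OF contour_integrable_continuous_circlepath[OF this]]
      show ?thesis unfolding contour_integral_circlepath[OF M(3)] .
    qed
    from has_contour_integral_diff[OF int[OF M(1)] has_contour_integral_lmul[OF this, of l]]
    have "((\<lambda>z. \<psi> z - l * (1 / (z - 0))) has_contour_integral K - l * (2 * of_real pi * \<i>)) (circlepath 0 M)" .
    then have "norm (K - l * (2 * of_real pi * \<i>)) \<le> (e' / M) * (2 * pi * M)"
    proof (rule has_contour_integral_bound_circlepath)
      show "0 \<le> e' / M" "0 < M" using e' M by auto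
      fix z :: complex assume z: "norm (z - 0) = M"
      have "z \<noteq> 0" using z M by auto
      then have "\<psi> z - l * (1 / (z - 0)) = (z * \<psi> z - l) / z" by (simp add: field_simps)
      moreover have "norm (z * \<psi> z - l) \<le> e'" using N[of z] z M by (simp add: dist_norm)
      ultimately show "norm (\<psi> z - l * (1 / (z - 0))) \<le> e' / M"
        using z M by (simp add: norm_divide divide_right_mono)
    qed
    also have "(e' / M) * (2 * pi * M) = e" using M by (simp add: e'_def)
    finally show ?thesis by (simp add: mult.commute)
  qed
  have "norm (K - 2 * of_real pi * \<i> * l) \<le> 0"
    by (rule field_le_epsilon) (simp only: add_0 le)
  then show ?thesis by simp
qed

text \<open>On the circle, $\bar G\,dz/(z-z_0)^2$ is a multiple of the conjugate of $G\,dz$, so only the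
  holomorphic part of v contributes to Cauchy's formula.\<close>

lemma dz_bound:
  assumes v: "harmonic_on (ball z0 R) v" and \<rho>: "0 < \<rho>" "\<rho> < R"
    and B: "\<And>z. z \<in> sphere z0 \<rho> \<Longrightarrow> norm (v z) \<le> B" "B \<ge> 0"
  shows "norm (dz v z0) \<le> B / \<rho>"
proof -
  obtain F G where FG: "F holomorphic_on ball z0 R" "G holomorphic_on ball z0 R"
    "\<And>z. z \<in> ball z0 R \<Longrightarrow> v z = F z + cnj (G z)"
    using harmonic_on_convex_imp_hol_plus_cnj[OF open_ball convex_ball v] unfolding hol_plus_cnj_def by blast
  have z0: "z0 \<in> ball z0 R" using \<rho> by simp
  have pd: "partial_deriv b v z0 = deriv F z0 * b + cnj (deriv G z0 * b)" for b
    by (rule hol_plus_cnj_partial_deriv[OF open_ball FG z0])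
  have dz: "dz v z0 = deriv F z0"
    unfolding dz_def pd by (simp add: field_simps)
  have sub: "cball z0 \<rho> \<subseteq> ball z0 R" "ball z0 \<rho> \<subseteq> ball z0 R" "sphere z0 \<rho> \<subseteq> ball z0 R" using \<rho> by auto
  let ?\<gamma> = "circlepath z0 \<rho>"
  have nz: "z - z0 \<noteq> 0" if "z \<in> sphere z0 \<rho>" for z using that \<rho> by auto
  have 1: "((\<lambda>z. F z / (z - z0)\<^sup>2) has_contour_integral (2 * pi * \<i>) * deriv F z0) ?\<gamma>"
  proof -
    have "contour_integral ?\<gamma> (\<lambda>z. F z / (z - z0)\<^sup>2) = (2 * pi * \<i>) * deriv F z0"
      by (rule Cauchy_contour_integral_circlepath_2)
         (use \<rho> holomorphic_on_subset[OF FG(1)] holomorphic_on_imp_continuous_on sub in auto)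
    moreover have "(\<lambda>z. F z / (z - z0)\<^sup>2) contour_integrable_on ?\<gamma>"
      by (rule contour_integrable_continuous_circlepath, intro continuous_intros)
         (use \<rho> nz continuous_on_subset[OF holomorphic_on_imp_continuous_on[OF FG(1)] sub(3)] in auto)
    ultimately show ?thesis using has_contour_integral_integral by metis
  qed
  have "(G has_contour_integral 0) ?\<gamma>"
    by (rule Cauchy_theorem_convex_simple[OF FG(2)]) (use sub \<rho> in auto)
  then have g: "((\<lambda>t. G (?\<gamma> t) * vector_derivative ?\<gamma> (at t within {0..1})) has_integral 0) {0..1}"
    unfolding has_contour_integral_def .
  have 2: "((\<lambda>z. cnj (G z) / (z - z0)\<^sup>2) has_contour_integral 0) ?\<gamma>"
  proof -
    from has_integral_cnj[THEN iffD2, OF g]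
    have "((\<lambda>t. cnj (G (?\<gamma> t) * vector_derivative ?\<gamma> (at t within {0..1}))) has_integral 0) {0..1}"
      by (simp add: o_def)
    \<comment> \<open>With cnj E = 1 / E on the unit circle, \<gamma>' / (\<gamma> - z0)^2 equals -
      cnj \<gamma>' / \<rho>^2.\<close>
    from has_integral_mult_right[OF this, of "- 1 / of_real (\<rho>\<^sup>2)"]
    have "((\<lambda>t. - 1 / of_real (\<rho>\<^sup>2) * cnj (G (?\<gamma> t) * vector_derivative ?\<gamma> (at t within {0..1}))) has_integral 0) {0..1}"
      by simp
    then show ?thesis
      unfolding has_contour_integral_def
    proof (rule has_integral_cong[THEN iffD1, rotated])
      fix t :: real assume t: "t \<in> {0..1}"
      define E where "E = exp (2 * of_real pi * \<i> * of_real t)"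
      have E: "E * cnj E = 1" "E \<noteq> 0" by (auto simp: E_def complex_norm_square[symmetric])
      have d: "vector_derivative ?\<gamma> (at t within {0..1}) = 2 * pi * \<i> * \<rho> * E"
        using vector_derivative_circlepath01 t by (simp add: E_def)
      have g: "?\<gamma> t - z0 = \<rho> * E" by (simp add: circlepath E_def)
      have ce: "cnj E = 1 / E" using E by (simp add: field_simps)
      show "- 1 / of_real (\<rho>\<^sup>2) * cnj (G (?\<gamma> t) * vector_derivative ?\<gamma> (at t within {0..1})) =
        cnj (G (?\<gamma> t)) / (?\<gamma> t - z0)\<^sup>2 * vector_derivative ?\<gamma> (at t within {0..1})"
        unfolding d g complex_cnj_mult ce using \<rho> E by (simp add: field_simps power2_eq_square)
    qed
  qed
  have "((\<lambda>z. v z / (z - z0)\<^sup>2) has_contour_integral (2 * pi * \<i>) * deriv F z0 + 0) ?\<gamma>"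
  proof (rule has_contour_integral_eq[OF has_contour_integral_add[OF 1 2]])
    fix z assume "z \<in> path_image ?\<gamma>"
    then have "z \<in> ball z0 R" using sub \<rho> by auto
    then show "F z / (z - z0)\<^sup>2 + cnj (G z) / (z - z0)\<^sup>2 = v z / (z - z0)\<^sup>2"
      using FG(3) by (simp add: add_divide_distrib)
  qed
  then have "norm ((2 * pi * \<i>) * deriv F z0 + 0) \<le> (B / \<rho>\<^sup>2) * (2 * pi * \<rho>)"
  proof (rule has_contour_integral_bound_circlepath)
    show "0 \<le> B / \<rho>\<^sup>2" "0 < \<rho>" using B \<rho> by auto
    fix z assume "norm (z - z0) = \<rho>"
    then show "norm (v z / (z - z0)\<^sup>2) \<le> B / \<rho>\<^sup>2"
      using B(1)[of z] \<rho> by (simp add: norm_divide norm_power dist_norm norm_minus_commute divide_right_mono)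
  qed
  then have "2 * pi * norm (deriv F z0) \<le> 2 * pi * (B / \<rho>)"
    using \<rho> by (simp add: norm_mult power2_eq_square field_simps)
  then show ?thesis unfolding dz by (rule mult_left_le_imp_le) simp
qed


section \<open>Non-solvability at resonance\<close>

lemma dz_diff_ident:
  assumes "u differentiable (at z)"
  shows "dz u z = 1 + dz (\<lambda>x. u x - x) z"
    and "dz (\<lambda>x. cnj (u x)) z = dz (\<lambda>x. cnj (u x - x)) z"
proof -
  have D: "(u has_derivative frechet_derivative u (at z)) (at z)"
    using assms frechet_derivative_works by blast
  have D1: "((\<lambda>x. u x - x) has_derivative (\<lambda>h. frechet_derivative u (at z) h - h)) (at z)"
    by (rule derivative_eq_intros D refl)+
  have p: "partial_deriv b (\<lambda>x. u x - x) z = partial_deriv b u z - b" for b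
    unfolding partial_deriv_def by (rule fun_cong[OF frechet_derivative_at[OF D1, symmetric]])
  have d: "(\<lambda>x. u x - x) differentiable (at z)" using D1 unfolding differentiable_def by blast
  show "dz u z = 1 + dz (\<lambda>x. u x - x) z"
    unfolding dz_def p by (simp add: field_simps)
  show "dz (\<lambda>x. cnj (u x)) z = dz (\<lambda>x. cnj (u x - x)) z"
    unfolding dz_def partial_deriv_cnj[OF assms] partial_deriv_cnj[OF d] p by (simp add: field_simps)
qed

lemma harmonic_on_subset: "harmonic_on S u \<Longrightarrow> T \<subseteq> S \<Longrightarrow> harmonic_on T u"
  unfolding harmonic_on_def C2_on_def by (meson continuous_on_subset subset_iff)

text \<open>Disks of radius proportional to |z| stay in the far region. On the circle of radius |z|
  / 4 about z, v is at most 4 K / |z|, and \<open>dz_bound\<close> divides by |z| / 4; so the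
  derivative is O(|z|^(-2)), with constant 16 K.\<close>

lemma dz_decay:
  assumes v: "harmonic_on {z. norm z > N} v"
    and O: "v \<in> O[at_infinity](\<lambda>x. of_real (1 / norm x))"
  shows "((\<lambda>z. z * dz v z) \<longlongrightarrow> 0) at_infinity"
proof -
  obtain K where K: "K > 0" "\<forall>\<^sub>F x in at_infinity. norm (v x) \<le> K * norm (of_real (1 / norm x) :: complex)"
    using O by (rule landau_o.bigE)
  then obtain M where M: "\<And>x. norm x \<ge> M \<Longrightarrow> norm (v x) \<le> K * norm (of_real (1 / norm x) :: complex)"
    unfolding eventually_at_infinity by blast
  define P where "P = max (max M N) 1 + 1"
  have P: "P > M" "P > N" "P > 0" by (auto simp: P_def)
  have bd: "norm (z * dz v z) \<le> 16 * K * norm (inverse z)" if z: "norm z \<ge> 2 * P" for z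
  proof -
    have nz: "norm z > 0" using z P by linarith
    have far: "norm w > norm z / 4" "norm w > N" "norm w \<ge> M" if "dist z w \<le> norm z / 2" for w
    proof -
      have "norm z \<le> norm w + dist z w" by (simp add: dist_norm norm_triangle_sub)
      then have "norm z / 2 \<le> norm w" using that by linarith
      then show "norm w > norm z / 4" "norm w > N" "norm w \<ge> M" using z P nz by linarith+
    qed
    have h: "harmonic_on (ball z (norm z / 2)) v"
      by (rule harmonic_on_subset[OF v]) (use far(2) in \<open>auto intro: less_imp_le\<close>)
    have "norm (dz v z) \<le> (4 * K / norm z) / (norm z / 4)"
    proof (rule dz_bound[OF h])
      show "0 < norm z / 4" "norm z / 4 < norm z / 2" using nz by auto
      show "0 \<le> 4 * K / norm z" using K nz by simp
      fix w assume w: "w \<in> sphere z (norm z / 4)"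
      then have "dist z w = norm z / 4" by simp
      then have w2: "dist z w \<le> norm z / 2" using nz by linarith
      have "norm (v w) \<le> K * norm (of_real (1 / norm w) :: complex)" using M far(3)[OF w2] by blast
      also have "\<dots> = K / norm w" unfolding norm_of_real by simp
      also have "\<dots> \<le> K / (norm z / 4)"
        using far(1)[OF w2] K(1) nz by (intro divide_left_mono mult_pos_pos) linarith+
      finally show "norm (v w) \<le> 4 * K / norm z" by (simp add: mult.commute)
    qed
    then have "norm z * norm (dz v z) \<le> norm z * ((4 * K / norm z) / (norm z / 4))"
      by (rule mult_left_mono) simp
    also have "\<dots> = 16 * K * norm (inverse z)" unfolding norm_inverse using nz by (simp add: field_simps)
    finally show ?thesis by (simp add: norm_mult)
  qed
  have "((\<lambda>z::complex. 16 * K * norm (inverse z)) \<longlongrightarrow> 16 * K * norm (0::complex)) at_infinity"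
    by (intro tendsto_intros tendsto_inverse_0)
  then have "((\<lambda>z::complex. 16 * K * norm (inverse z)) \<longlongrightarrow> 0) at_infinity" by simp
  then show ?thesis
    by (rule Lim_null_comparison[rotated]) (use bd in \<open>auto simp: eventually_at_infinity\<close>)
qed

lemma circle_refl_uminus: "circle_refl (- c) r (- z) = - circle_refl c r z"
proof -
  have "cnj (- z - - c) = - cnj (z - c)" by simp
  then show ?thesis unfolding circle_refl_def by (simp only: divide_minus_right) simp
qed

context two_disks
begin

text \<open>The closed disk CR is approached from outside: removing from - CL the open balls of
  radius \<rho> about m gives connected sets for r < \<rho> < m. They share the point \<i> m, and
  their union is the exterior.\<close>

lemma connected_exterior: "connected (- (CL \<union> CR))"
proof -
  have cL: "connected (- CL)"
    by (rule connected_complement_bounded_convex) auto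
  have far: "dist (- of_real m :: complex) (of_real m) = 2 * m" using m by (simp add: dist_norm)
  define \<F> where "\<F> = (\<lambda>\<rho>. - CL - ball (of_real m) \<rho>) ` {r<..<m}"
  have "connected X" if XF: "X \<in> \<F>" for X
  proof -
    obtain \<rho> where "\<rho> \<in> {r<..<m}" and X: "X = - CL - ball (of_real m) \<rho>"
      using XF unfolding \<F>_def by blast
    then have \<rho>: "r < \<rho>" "\<rho> < m" by auto
    have "CL \<inter> cball (of_real m) \<rho> = {}"
      using \<rho> r_less far by (intro disjoint_cballI) simp
    then show ?thesis unfolding X by (intro connected_diff_ball cL) auto
  qed
  moreover have "\<Inter>\<F> \<noteq> {}"
  proof -
    have "dist (of_real x :: complex) (\<i> * of_real m) \<ge> m" for x
      using abs_Im_le_cmod[of "of_real x - \<i> * of_real m"] m by (simp add: dist_norm)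
    from this[of m] this[of "- m"] have "\<i> * of_real m \<in> \<Inter>\<F>"
      using r_less by (auto simp: \<F>_def)
    then show ?thesis by blast
  qed
  ultimately have "connected (\<Union>\<F>)" by (rule connected_Union)
  moreover have "\<Union>\<F> = - (CL \<union> CR)"
  proof
    show "\<Union>\<F> \<subseteq> - (CL \<union> CR)" by (auto simp: \<F>_def)
    show "- (CL \<union> CR) \<subseteq> \<Union>\<F>"
    proof
      fix z :: complex assume z: "z \<in> - (CL \<union> CR)"
      define \<rho> where "\<rho> = min (dist (of_real m) z) ((r + m) / 2)"
      have "r < \<rho>" "\<rho> < m" "\<rho> \<le> dist (of_real m) z" using z r_less by (auto simp: \<rho>_def min_less_iff_disj)
      then have "z \<in> - CL - ball (of_real m) \<rho>" "\<rho> \<in> {r<..<m}" using z by auto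
      then show "z \<in> \<Union>\<F>" unfolding \<F>_def by blast
    qed
  qed
  ultimately show ?thesis by simp
qed

text \<open>A point of the disks has winding number 1 about the large circle and about exactly one
  small circle. The bound \<rho> < m separates each small circle from the other disk, and M > 2 m
  makes the large circle enclose both.\<close>

lemma Cauchy_exterior:
  assumes f: "f holomorphic_on - (CL \<union> CR)" and \<rho>: "r < \<rho>" "\<rho> < m" and M: "M > 2 * m"
  shows "contour_integral (circlepath 0 M) f =
    contour_integral (circlepath (- of_real m) \<rho>) f + contour_integral (circlepath (of_real m) \<rho>) f"
proof -
  have far: "dist (- of_real m :: complex) (of_real m) = 2 * m" using m by (simp add: dist_norm)
  have n: "norm (of_real m :: complex) = m" using m by simp
  have tri: "2 * m \<le> dist (- of_real m) z + dist (of_real m) z" for z :: complex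
    using dist_triangle[of "- of_real m :: complex" "of_real m" z] far by (simp add: dist_commute)
  have tri0: "norm z \<le> m + dist (- of_real m) z" "norm z \<le> m + dist (of_real m) z" for z :: complex
    using dist_triangle2[of z 0 "- of_real m"] dist_triangle2[of z 0 "of_real m"] n
      norm_triangle_sub[of z "- of_real m"] norm_triangle_sub[of z "of_real m"]
    by (simp_all add: dist_norm norm_minus_commute)
  have M0: "M > 0" "\<rho> > 0" using M m \<rho> r by linarith+
  show ?thesis
  proof (rule Cauchy_theorem_two_cycles[OF _ connected_exterior f])
    show "open (- (CL \<union> CR))" by (intro open_Compl closed_Un closed_cball)
    show "path_image (circlepath 0 M) \<subseteq> - (CL \<union> CR)"
    proof
      fix z assume "z \<in> path_image (circlepath 0 M)"
      then have "norm z = M" using M0 by simp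
      then show "z \<in> - (CL \<union> CR)" using tri0[of z] M \<rho> by auto
    qed
    show "path_image (circlepath (- of_real m) \<rho>) \<subseteq> - (CL \<union> CR)"
    proof
      fix z assume "z \<in> path_image (circlepath (- of_real m) \<rho>)"
      then have "dist (- of_real m) z = \<rho>" using M0 by simp
      then show "z \<in> - (CL \<union> CR)" using tri[of z] \<rho> r_less by auto
    qed
    show "path_image (circlepath (of_real m) \<rho>) \<subseteq> - (CL \<union> CR)"
    proof
      fix z assume "z \<in> path_image (circlepath (of_real m) \<rho>)"
      then have "dist (of_real m) z = \<rho>" using M0 by simp
      then show "z \<in> - (CL \<union> CR)" using tri[of z] \<rho> r_less by auto
    qed
    fix w :: complex assume "w \<notin> - (CL \<union> CR)"
    then consider "w \<in> CL" | "w \<in> CR" by blast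
    then show "winding_number (circlepath 0 M) w =
      winding_number (circlepath (- of_real m) \<rho>) w + winding_number (circlepath (of_real m) \<rho>) w"
    proof cases
      case 1
      have d: "dist (- of_real m) w \<le> r" using 1 by simp
      have "winding_number (circlepath 0 M) w = 1"
        by (rule winding_number_circlepath) (use d tri0(1)[of w] M r_less in simp)
      moreover have "winding_number (circlepath (- of_real m) \<rho>) w = 1"
        by (rule winding_number_circlepath) (use d \<rho> in \<open>simp only: dist_norm norm_minus_commute[of w]\<close>)
      moreover have "winding_number (circlepath (of_real m) \<rho>) w = 0"
        by (rule winding_number_zero_outside[OF _ convex_cball[of "of_real m" \<rho>]])
           (use d tri[of w] \<rho> r_less M0 in auto)
      ultimately show ?thesis by simp
    next
      case 2
      have d: "dist (of_real m) w \<le> r" using 2 by simp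
      have "winding_number (circlepath 0 M) w = 1"
        by (rule winding_number_circlepath) (use d tri0(2)[of w] M r_less in simp)
      moreover have "winding_number (circlepath (of_real m) \<rho>) w = 1"
        by (rule winding_number_circlepath) (use d \<rho> in \<open>simp only: dist_norm norm_minus_commute[of w]\<close>)
      moreover have "winding_number (circlepath (- of_real m) \<rho>) w = 0"
        by (rule winding_number_zero_outside[OF _ convex_cball[of "- of_real m" \<rho>]])
           (use d tri[of w] \<rho> r_less M0 in auto)
      ultimately show ?thesis by simp
    qed
  qed auto
qed

lemma W_refl_right:
  assumes "z \<noteq> of_real \<alpha>" "z \<noteq> - of_real \<alpha>" "z \<noteq> of_real m"
  shows "W (circle_refl (of_real m) r z) = of_real L / cnj (W z)"
proof -
  define a M c :: complex where "a = of_real \<alpha>" and "M = of_real m" and "c = cnj z"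
  have n: "c \<noteq> a" "c \<noteq> - a" "c \<noteq> M"
    using assms unfolding a_def M_def c_def
    by (metis complex_cnj_cnj complex_cnj_complex_of_real complex_cnj_minus)+
  have ma: "M - a \<noteq> 0" using alpha_less by (auto simp: a_def M_def simp flip: of_real_diff)
  have r2: "of_real (r\<^sup>2) = M\<^sup>2 - a\<^sup>2"
    unfolding a_def M_def using m2 by (metis add_diff_cancel_left' of_real_diff of_real_power)
  have e: "circle_refl (of_real m) r z = (M * c - a\<^sup>2) / (c - M)"
  proof -
    have "circle_refl (of_real m) r z = M + (M\<^sup>2 - a\<^sup>2) / (c - M)"
      unfolding circle_refl_def r2 by (simp add: M_def c_def)
    also have "\<dots> = (M * c - a\<^sup>2) / (c - M)" using n by (simp add: field_simps power2_eq_square)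
    finally show ?thesis .
  qed
  have "(M * c - a\<^sup>2) / (c - M) + a = (M + a) * (c - a) / (c - M)"
    "(M * c - a\<^sup>2) / (c - M) - a = (M - a) * (c + a) / (c - M)"
    using n by (simp_all add: field_simps power2_eq_square)
  then have "W (circle_refl (of_real m) r z) = ((M + a) * (c - a) / (c - M)) / ((M - a) * (c + a) / (c - M))"
    unfolding W_def e a_def by simp
  also have "\<dots> = ((M + a) / (M - a)) * ((c - a) / (c + a))" using n by simp
  also have "\<dots> = of_real L / cnj (W z)" by (simp add: L_def W_def a_def M_def c_def)
  finally show ?thesis .
qed

text \<open>The symmetry z to -z exchanges the two disks and inverts W; it carries the formula for
  the right reflection over to the left one.\<close>

lemma W_uminus: "W (- z) = inverse (W z)"
proof -
  have "- z + of_real \<alpha> = - (z - of_real \<alpha>)" "- z - of_real \<alpha> = - (z + of_real \<alpha>)" by simp_all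
  then show ?thesis unfolding W_def by (simp only: minus_divide_divide inverse_divide)
qed

lemma W_refl_left:
  assumes "z \<noteq> of_real \<alpha>" "z \<noteq> - of_real \<alpha>" "z \<noteq> - of_real m"
  shows "W (circle_refl (- of_real m) r z) = 1 / (of_real L * cnj (W z))"
proof -
  have "circle_refl (- of_real m) r z = - circle_refl (of_real m) r (- z)"
    using circle_refl_uminus[of "of_real m" r "- z"] by simp
  then have "W (circle_refl (- of_real m) r z) = inverse (of_real L / cnj (W (- z)))"
  proof -
    have "- z \<noteq> of_real \<alpha>" "- z \<noteq> - of_real \<alpha>" "- z \<noteq> of_real m"
      using assms by (metis add.inverse_inverse)+
    from W_refl_right[OF this] show ?thesis
      unfolding \<open>circle_refl (- of_real m) r z = - circle_refl (of_real m) r (- z)\<close> W_uminus by simp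
  qed
  then show ?thesis by (simp add: W_uminus field_simps)
qed

text \<open>W - 1 = 2 \<alpha> / (z - \<alpha>), and W^n - 1 is this times a sum of n powers of W,
  each tending to 1.\<close>

lemma W_power_limit: "((\<lambda>z. z * (W z ^ n - 1)) \<longlongrightarrow> of_real (2 * \<alpha> * real n)) at_infinity"
proof -
  have "filterlim (\<lambda>z::complex. - of_real \<alpha> + z) at_infinity at_infinity"
    by (intro tendsto_add_filterlim_at_infinity[OF tendsto_const] filterlim_ident)
  then have "((\<lambda>z. inverse (- of_real \<alpha> + z)) \<longlongrightarrow> (0::complex)) at_infinity"
    by (rule filterlim_compose[OF tendsto_inverse_0])
  then have i: "((\<lambda>z. inverse (z - of_real \<alpha>)) \<longlongrightarrow> (0::complex)) at_infinity" by simp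
  define I where "I z = inverse (z - of_real \<alpha>)" for z :: complex
  have ev: "\<forall>\<^sub>F z in at_infinity. z \<noteq> (of_real \<alpha> :: complex)"
    unfolding eventually_at_infinity using alpha by (intro exI[of _ "\<alpha> + 1"]) auto
  have "((\<lambda>z. (1 + of_real \<alpha> * I z) * of_real (2 * \<alpha>) * (\<Sum>i<n. (1 + of_real (2 * \<alpha>) * I z) ^ i)) \<longlongrightarrow>
     (1 + of_real \<alpha> * 0) * of_real (2 * \<alpha>) * (\<Sum>i<n. (1 + of_real (2 * \<alpha>) * 0) ^ i)) at_infinity"
    using i unfolding I_def[symmetric] by (intro tendsto_intros)
  then have "((\<lambda>z. (1 + of_real \<alpha> * I z) * of_real (2 * \<alpha>) * (\<Sum>i<n. (1 + of_real (2 * \<alpha>) * I z) ^ i)) \<longlongrightarrow>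
     of_real (2 * \<alpha> * real n)) at_infinity" by simp
  then show ?thesis
  proof (rule Lim_transform_eventually)
    show "\<forall>\<^sub>F z in at_infinity. (1 + of_real \<alpha> * I z) * of_real (2 * \<alpha>) * (\<Sum>i<n. (1 + of_real (2 * \<alpha>) * I z) ^ i) = z * (W z ^ n - 1)"
    proof (rule eventually_mono[OF ev])
      fix z :: complex assume z: "z \<noteq> of_real \<alpha>"
      then have zI: "z * I z = 1 + of_real \<alpha> * I z" by (simp add: I_def field_simps)
      have W: "W z = 1 + of_real (2 * \<alpha>) * I z" using z by (simp add: W_def I_def field_simps)
      have "z * (W z ^ n - 1) = z * ((W z - 1) * (\<Sum>i<n. W z ^ i))" by (simp only: power_diff_1_eq)
      also have "\<dots> = (z * I z) * of_real (2 * \<alpha>) * (\<Sum>i<n. W z ^ i)" unfolding W by (simp add: algebra_simps)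
      finally show "(1 + of_real \<alpha> * I z) * of_real (2 * \<alpha>) * (\<Sum>i<n. (1 + of_real (2 * \<alpha>) * I z) ^ i) = z * (W z ^ n - 1)"
        unfolding zI unfolding W ..
    qed
  qed
qed

lemma W_limit: "((\<lambda>z. W z) \<longlongrightarrow> 1) at_infinity"
proof -
  have "((\<lambda>z. inverse z * (z * (W z ^ 1 - 1)) + 1) \<longlongrightarrow> 0 * of_real (2 * \<alpha> * real 1) + 1) at_infinity"
    by (intro tendsto_add tendsto_mult tendsto_inverse_0 W_power_limit tendsto_const)
  then have "((\<lambda>z. inverse z * (z * (W z ^ 1 - 1)) + 1) \<longlongrightarrow> 1) at_infinity" by simp
  then show ?thesis
  proof (rule Lim_transform_eventually)
    show "\<forall>\<^sub>F z in at_infinity. inverse z * (z * (W z ^ 1 - 1)) + 1 = W z"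
      unfolding eventually_at_infinity
    proof (intro exI[of _ 1] allI impI)
      fix z :: complex assume "1 \<le> norm z"
      then have "z \<noteq> 0" by auto
      then show "inverse z * (z * (W z ^ 1 - 1)) + 1 = W z" by (simp add: field_simps)
    qed
  qed
qed

end


lemma harmonic_on_diff_ident:
  assumes "open S" "harmonic_on S u"
  shows "harmonic_on S (\<lambda>x. u x - x)"
proof -
  have u: "\<And>z. z \<in> S \<Longrightarrow> u differentiable (at z)"
    "\<And>z b. z \<in> S \<Longrightarrow> b \<in> Basis \<Longrightarrow> partial_deriv b u differentiable (at z)"
    using assms unfolding harmonic_on_def C2_on_def by auto
  have p1: "partial_deriv b (\<lambda>x. u x - x) z = partial_deriv b u z - b" if "z \<in> S" for z b
  proof -
    have D: "(u has_derivative frechet_derivative u (at z)) (at z)"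
      using u(1)[OF that] frechet_derivative_works by blast
    have "((\<lambda>x. u x - x) has_derivative (\<lambda>h. frechet_derivative u (at z) h - h)) (at z)"
      by (rule derivative_eq_intros D refl)+
    from fun_cong[OF frechet_derivative_at[OF this, symmetric]] show ?thesis unfolding partial_deriv_def .
  qed
  have d: "(\<lambda>x. f x - k) differentiable (at z)" if "f differentiable (at z)" for f :: "complex \<Rightarrow> complex" and z k
    using that by (intro differentiable_diff) auto
  have p2: "partial_deriv b' (partial_deriv b (\<lambda>x. u x - x)) z = partial_deriv b' (partial_deriv b u) z"
    if "z \<in> S" "b \<in> Basis" for z b b'
  proof -
    have D: "(partial_deriv b u has_derivative frechet_derivative (partial_deriv b u) (at z)) (at z)"
      using u(2)[OF that] frechet_derivative_works by blast
    have "((\<lambda>x. partial_deriv b u x - b) has_derivative frechet_derivative (partial_deriv b u) (at z)) (at z)"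
      using has_derivative_diff[OF D has_derivative_const] by simp
    from fun_cong[OF frechet_derivative_at[OF this, symmetric]]
    have "partial_deriv b' (\<lambda>x. partial_deriv b u x - b) z = partial_deriv b' (partial_deriv b u) z"
      unfolding partial_deriv_def .
    with partial_deriv_cong[OF assms(1) that(1) p1] show ?thesis by (rule trans)
  qed
  have s: "(\<Sum>b\<in>Basis. partial_deriv b (partial_deriv b (\<lambda>x. u x - x)) z) = 0" if "z \<in> S" for z
  proof -
    have "(\<Sum>b\<in>Basis. partial_deriv b (partial_deriv b (\<lambda>x. u x - x)) z) = (\<Sum>b\<in>Basis. partial_deriv b (partial_deriv b u) z)"
      using p2[OF that] by (intro sum.cong) auto
    then show ?thesis using assms(2) that by (simp add: harmonic_on_def)
  qed
  have c: "continuous_on S (partial_deriv b' (partial_deriv b (\<lambda>x. u x - x)))" if "b \<in> Basis" "b' \<in> Basis" for b b'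
  proof (rule continuous_on_eq)
    show "continuous_on S (partial_deriv b' (partial_deriv b u))"
      using assms(2) that by (simp add: harmonic_on_def C2_on_def)
  qed (simp add: p2 that)
  have e: "partial_deriv b (\<lambda>x. u x - x) differentiable (at z)" if "z \<in> S" "b \<in> Basis" for z b
    by (rule differentiable_cong_open[OF assms(1) that(1) _ d[OF u(2)[OF that]]]) (simp add: p1)
  have f: "(\<lambda>x. u x - x) differentiable (at z)" if "z \<in> S" for z
    by (rule differentiable_diff[OF u(1)[OF that]]) auto
  show ?thesis
    unfolding harmonic_on_def C2_on_def using s c e f by blast
qed

lemma solves_conductivity_eq_harmonic:
  assumes "solves_conductivity_eq D1 c1 k1 D2 c2 k2 u"
    and S: "open S" "S \<subseteq> - (frontier D1 \<union> frontier D2)"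
    and k: "\<And>y. y \<in> S \<Longrightarrow> conductivity D1 D2 k1 k2 y = k" "k \<noteq> 0"
  shows "harmonic_on S u"
proof -
  have C2: "C2_on S u"
    using assms(1) S(2) unfolding solves_conductivity_eq_def C2_on_def
    by (meson continuous_on_subset subsetD)
  have "(\<Sum>b\<in>Basis. partial_deriv b (partial_deriv b u) x) = 0" if "x \<in> S" for x
  proof -
    have "div_grad (conductivity D1 D2 k1 k2) u x = 0"
      using assms(1) S(2) that unfolding solves_conductivity_eq_def by blast
    then show ?thesis
      using div_grad_locally_constant[OF S(1) that C2 k(1)] k(2) by simp
  qed
  then show ?thesis using C2 by (simp add: harmonic_on_def)
qed

context two_disks
begin

lemma not_solvable_ident:
  assumes k: "k1 \<noteq> -1" "k2 \<noteq> -1" and n: "n \<ge> 1"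
    and res: "tau k1 * tau k2 * of_real ((1 / L\<^sup>2) ^ n) = 1"
    and sol: "solves_conductivity_eq DL (- of_real m) k1 DR (of_real m) k2 u"
    and O: "(\<lambda>x. u x - x) \<in> O[at_infinity](\<lambda>x. of_real (1 / norm x))"
  shows False
proof -
  define \<Omega> where "\<Omega> = - (CL \<union> CR)"
  let ?uc = "\<lambda>x. cnj (u x)"
  have o\<Omega>: "open \<Omega>" unfolding \<Omega>_def by (intro open_Compl closed_Un closed_cball)
  have u: "harmonic_on \<Omega> u"
    by (rule solves_conductivity_eq_harmonic[OF sol o\<Omega>, where k = 1])
       (use pieces_decomposition conductivity_exterior in \<open>auto simp: \<Omega>_def\<close>)
  have uL: "harmonic_on DL u" if "k1 \<noteq> 0"
    by (rule solves_conductivity_eq_harmonic[OF sol open_ball _ conductivity_DL that])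
       (use pieces_decomposition in blast)
  have uR: "harmonic_on DR u" if "k2 \<noteq> 0"
    by (rule solves_conductivity_eq_harmonic[OF sol open_ball _ conductivity_DR that])
       (use pieces_decomposition in blast)
  have trL: "transmission_at DL (- of_real m) k1 u p" if "p \<in> sphere (- of_real m) r" for p
    using sol that r unfolding solves_conductivity_eq_def by simp
  have trR: "transmission_at DR (of_real m) k2 u p" if "p \<in> sphere (of_real m) r" for p
    using sol that r unfolding solves_conductivity_eq_def by simp
  have L0: "of_real L \<noteq> (0::complex)" using L_gt_1 by simp
  \<comment> \<open>Forced by the left circle: the left reflection turns W^n into (L cnj W)^(-n),
    and the circle theorem multiplies it by - tau k1.\<close>
  define Q where "Q = - tau k1 / of_real L ^ n"
  define f where "f z = W z ^ n" for z
  \<comment> \<open>Written as a quotient with denominator z + \<alpha>, so that holomorphy at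
    \<alpha>, the pole of W, is evident.\<close>
  define g where "g z = cnj Q * ((z - of_real \<alpha>) / (z + of_real \<alpha>)) ^ n" for z :: complex
  define \<phi> where "\<phi> z = f z + cnj (g z)" for z
  have gW: "g z = cnj Q * inverse (W z) ^ n" for z by (simp add: g_def W_def)
  have f: "f holomorphic_on S" if "of_real \<alpha> \<notin> S" for S
    unfolding f_def using W_holomorphic[OF that] by (intro holomorphic_intros)
  have g: "g holomorphic_on S" if "- of_real \<alpha> \<notin> S" for S
    unfolding g_def using that by (intro holomorphic_intros) (auto simp: add_eq_0_iff2)
  have far: "dist (- of_real m :: complex) (of_real m) = 2 * m" using m by (simp add: dist_norm)
  have dif: "dist (- of_real m :: complex) (of_real \<alpha>) > m" "dist (of_real m :: complex) (- of_real \<alpha>) > m"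
  proof -
    have "dist (- of_real m :: complex) (of_real \<alpha>) = \<bar>- m - \<alpha>\<bar>" "dist (of_real m :: complex) (- of_real \<alpha>) = \<bar>m + \<alpha>\<bar>"
      unfolding dist_norm of_real_minus[symmetric] of_real_diff[symmetric] norm_of_real by auto
    then show "dist (- of_real m :: complex) (of_real \<alpha>) > m" "dist (of_real m :: complex) (- of_real \<alpha>) > m"
      using alpha m by auto
  qed
  have tri: "2 * m \<le> dist (- of_real m) z + dist (of_real m) z" for z :: complex
    using dist_triangle[of "- of_real m :: complex" "of_real m" z] far by (simp add: dist_commute)
  let ?\<Phi> = "\<lambda>c \<rho>. contour_integral (circlepath c \<rho>) (\<lambda>z. f z * dz u z)
       - cnj (contour_integral (circlepath c \<rho>) (\<lambda>z. g z * dz ?uc z))"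
  \<comment> \<open>At the left circle f plays the role of G: its only pole \<alpha> lies outside
    the disk of radius m about -m. This disk also misses the right closed disk.\<close>
  have fluxL: "(?\<Phi> (- of_real m) \<longlongrightarrow> 0) (at_right r)"
  proof (rule boundary_flux_tendsto_0[OF r r_less k(1) _ uL trL])
    \<comment> \<open>The centre has to be removed because circle_refl fixes it (division by zero).\<close>
    let ?T = "ball (- of_real m) m - {- of_real \<alpha>, - of_real m}"
    show "harmonic_on (ball (- of_real m) m - CL) u"
    proof (rule harmonic_on_subset[OF u], rule subsetI)
      fix z :: complex assume "z \<in> ball (- of_real m) m - CL"
      then show "z \<in> \<Omega>" using tri[of z] r_less by (auto simp: \<Omega>_def)
    qed
    show "hol_plus_cnj (ball (- of_real m) m) f"
      by (rule hol_plus_cnjI[of f _ "\<lambda>_. 0"]) (use f dif in auto)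
    show "open ?T" by (intro open_Diff open_ball) auto
    show "ball (- of_real m) m - DL \<subseteq> ?T" using minus_alpha_in_DL r by auto
    show "f holomorphic_on ?T" "g holomorphic_on ?T" by (intro f g; use dif in simp)+
    fix z :: complex assume z: "z \<in> ?T"
    show "\<phi> z = f z + cnj (g z)" by (simp add: \<phi>_def)
    have "z \<noteq> of_real \<alpha>" using z dif by auto
    then have "W (circle_refl (- of_real m) r z) = 1 / (of_real L * cnj (W z))"
      using z by (intro W_refl_left) auto
    then show "\<phi> z = f z - tau k1 * f (circle_refl (- of_real m) r z)"
      by (simp add: \<phi>_def f_def gW Q_def power_divide power_mult_distrib power_inverse divide_inverse)
  qed auto
  have fluxR: "(?\<Phi> (of_real m) \<longlongrightarrow> 0) (at_right r)"
  proof (rule boundary_flux_tendsto_0[OF r r_less k(2) _ uR trR])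
    let ?T = "ball (of_real m) m - {of_real \<alpha>, of_real m}"
    show "harmonic_on (ball (of_real m) m - CR) u"
    proof (rule harmonic_on_subset[OF u], rule subsetI)
      fix z :: complex assume "z \<in> ball (of_real m) m - CR"
      then show "z \<in> \<Omega>" using tri[of z] r_less by (auto simp: \<Omega>_def)
    qed
    show "hol_plus_cnj (ball (of_real m) m) (\<lambda>z. cnj (g z))"
      by (rule hol_plus_cnjI[of "\<lambda>_. 0" _ g]) (use g dif in auto)
    show "open ?T" by (intro open_Diff open_ball) auto
    show "ball (of_real m) m - DR \<subseteq> ?T" using alpha_in_DR r by auto
    show "f holomorphic_on ?T" "g holomorphic_on ?T" by (intro f g; use dif in simp)+
    fix z :: complex assume z: "z \<in> ?T"
    show "\<phi> z = f z + cnj (g z)" by (simp add: \<phi>_def)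
    have "z \<noteq> - of_real \<alpha>" using z dif by auto
    then have W: "W (circle_refl (of_real m) r z) = of_real L / cnj (W z)"
      using z by (intro W_refl_right) auto
    \<comment> \<open>Here resonance enters. With cnj g in the role of G, the reflected term is f
      with coefficient tau k1 tau k2 L^(-2n), which has to be 1.\<close>
    have "tau k2 * cnj (g (circle_refl (of_real m) r z)) = - (tau k1 * tau k2 * of_real ((1 / L\<^sup>2) ^ n)) * W z ^ n"
      unfolding gW W using L0 by (simp add: Q_def power_divide power_mult_distrib power_inverse field_simps power2_eq_square)
    then show "\<phi> z = cnj (g z) - tau k2 * cnj (g (circle_refl (of_real m) r z))"
      unfolding res by (simp add: \<phi>_def f_def)
  qed auto
  have aL: "of_real \<alpha> \<notin> \<Omega>" "- of_real \<alpha> \<notin> \<Omega>"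
    using alpha_in_DR minus_alpha_in_DL balls_subset unfolding \<Omega>_def by blast+
  have F: "(\<lambda>z. f z * dz u z) holomorphic_on \<Omega>" "(\<lambda>z. g z * dz ?uc z) holomorphic_on \<Omega>"
    by (intro holomorphic_on_mult f g aL harmonic_on_dz_holomorphic[OF o\<Omega>] harmonic_on_cnj[OF o\<Omega>] u)+
  have big: "z \<in> \<Omega>" if "norm z > 2 * m" for z
  proof -
    have "norm z \<le> m + dist (- of_real m) z" "norm z \<le> m + dist (of_real m) z"
      using norm_triangle_sub[of z "- of_real m"] norm_triangle_sub[of z "of_real m"] m
      by (simp_all add: dist_norm norm_minus_commute)
    then show ?thesis using that r_less by (auto simp: \<Omega>_def)
  qed
  define \<rho>0 where "\<rho>0 = (r + m) / 2"
  have \<rho>0: "r < \<rho>0" "\<rho>0 < m" using r_less by (auto simp: \<rho>0_def)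
  define K1 where "K1 = contour_integral (circlepath (- of_real m) \<rho>0) (\<lambda>z. f z * dz u z)
    + contour_integral (circlepath (of_real m) \<rho>0) (\<lambda>z. f z * dz u z)"
  define K2 where "K2 = contour_integral (circlepath (- of_real m) \<rho>0) (\<lambda>z. g z * dz ?uc z)
    + contour_integral (circlepath (of_real m) \<rho>0) (\<lambda>z. g z * dz ?uc z)"
  have M1: "contour_integral (circlepath 0 M) (\<lambda>z. f z * dz u z) = K1"
    "contour_integral (circlepath 0 M) (\<lambda>z. g z * dz ?uc z) = K2" if "M > 2 * m" for M
    using Cauchy_exterior[OF F(1)[unfolded \<Omega>_def] \<rho>0 that] Cauchy_exterior[OF F(2)[unfolded \<Omega>_def] \<rho>0 that]
    by (simp_all add: K1_def K2_def)
  have int: "\<psi> contour_integrable_on circlepath 0 M" if "\<psi> holomorphic_on \<Omega>" "M > 2 * m" for \<psi> M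
    by (rule contour_integrable_holomorphic_simple[OF that(1) o\<Omega>]) (use that(2) m big in auto)
  \<comment> \<open>The sum of the two fluxes is the same for all radii between r and m, so its
    limit 0 at r is its value.\<close>
  have K12: "K1 - cnj K2 = 0"
  proof -
    have sum: "K1 - cnj K2 = ?\<Phi> (- of_real m) \<rho> + ?\<Phi> (of_real m) \<rho>" if "r < \<rho>" "\<rho> < m" for \<rho>
    proof -
      define M where "M = 2 * m + 1"
      have M: "M > 2 * m" by (simp add: M_def)
      note K = trans[OF M1(1)[OF M, symmetric] Cauchy_exterior[OF F(1)[unfolded \<Omega>_def] that M]]
        trans[OF M1(2)[OF M, symmetric] Cauchy_exterior[OF F(2)[unfolded \<Omega>_def] that M]]
      show ?thesis unfolding K by simp
    qed
    have "((\<lambda>\<rho>. ?\<Phi> (- of_real m) \<rho> + ?\<Phi> (of_real m) \<rho>) \<longlongrightarrow> 0 + 0) (at_right r)"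
      by (rule tendsto_add[OF fluxL fluxR])
    moreover have "((\<lambda>\<rho>. ?\<Phi> (- of_real m) \<rho> + ?\<Phi> (of_real m) \<rho>) \<longlongrightarrow> K1 - cnj K2) (at_right r)"
    proof (rule Lim_transform_eventually[OF tendsto_const])
      show "\<forall>\<^sub>F \<rho> in at_right r. K1 - cnj K2 = ?\<Phi> (- of_real m) \<rho> + ?\<Phi> (of_real m) \<rho>"
        unfolding eventually_at_right_field using r_less sum by blast
    qed
    ultimately have "0 + 0 = K1 - cnj K2"
      by (rule tendsto_unique[OF trivial_limit_at_right_real])
    then show ?thesis by simp
  qed
  have v: "harmonic_on \<Omega> (\<lambda>x. u x - x)" by (rule harmonic_on_diff_ident[OF o\<Omega> u])
  have vN: "harmonic_on {z. norm z > 2 * m} (\<lambda>x. u x - x)" "harmonic_on {z. norm z > 2 * m} (\<lambda>x. cnj (u x - x))"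
    by (rule harmonic_on_subset[OF v] harmonic_on_subset[OF harmonic_on_cnj[OF o\<Omega> v]], use big in blast)+
  have dec1: "((\<lambda>z. z * dz (\<lambda>x. u x - x) z) \<longlongrightarrow> 0) at_infinity" by (rule dz_decay[OF vN(1) O])
  have "(\<lambda>x. cnj (u x - x)) \<in> O[at_infinity](\<lambda>x. of_real (1 / norm x))"
  proof -
    obtain K where "K > 0" "\<forall>\<^sub>F x in at_infinity. norm (u x - x) \<le> K * norm (of_real (1 / norm x) :: complex)"
      using O by (rule landau_o.bigE)
    then show ?thesis by (intro landau_o.bigI[of K]) (simp_all only: complex_mod_cnj)
  qed
  then have dec2: "((\<lambda>z. z * dz (\<lambda>x. cnj (u x - x)) z) \<longlongrightarrow> 0) at_infinity" by (rule dz_decay[OF vN(2)])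
  have ev: "\<forall>\<^sub>F z in at_infinity. z \<in> \<Omega>"
    unfolding eventually_at_infinity by (intro exI[of _ "2 * m + 1"]) (use big in auto)
  have diff: "u differentiable (at z)" if "z \<in> \<Omega>" for z
    using u that by (simp add: harmonic_on_def C2_on_def)
  \<comment> \<open>The datum z has no antiholomorphic part, so u_zbar comes from the decaying
    difference u - z alone and is o(1 / z), while g stays bounded.\<close>
  have "K2 = 2 * of_real pi * \<i> * 0"
  proof (rule contour_integral_at_infinity[where B = "2 * m" and \<psi> = "\<lambda>z. g z * dz ?uc z"])
    fix M assume M: "M > 2 * m"
    show "((\<lambda>z. g z * dz ?uc z) has_contour_integral K2) (circlepath 0 M)"
      using has_contour_integral_integral[OF int[OF F(2) M]] M1(2)[OF M] by simp
  next
    have "((\<lambda>z. (cnj Q * inverse (W z) ^ n) * (z * dz (\<lambda>x. cnj (u x - x)) z)) \<longlongrightarrow> (cnj Q * inverse 1 ^ n) * 0) at_infinity"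
      by (intro tendsto_mult tendsto_const tendsto_power tendsto_inverse W_limit dec2) simp
    then have "((\<lambda>z. (cnj Q * inverse (W z) ^ n) * (z * dz (\<lambda>x. cnj (u x - x)) z)) \<longlongrightarrow> 0) at_infinity" by simp
    then show "((\<lambda>z. z * (g z * dz ?uc z)) \<longlongrightarrow> 0) at_infinity"
    proof (rule Lim_transform_eventually)
      show "\<forall>\<^sub>F z in at_infinity. (cnj Q * inverse (W z) ^ n) * (z * dz (\<lambda>x. cnj (u x - x)) z) = z * (g z * dz ?uc z)"
        by (rule eventually_mono[OF ev]) (simp only: gW dz_diff_ident(2)[OF diff] mult_ac)
    qed
  qed
  \<comment> \<open>Both factors f and u_z tend to 1, so the constant 1 is subtracted first; it
    integrates to 0 over closed circles. The remainder is f - 1 plus f times an o(1 / z)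
    term.\<close>
  moreover have "K1 = 2 * of_real pi * \<i> * of_real (2 * \<alpha> * real n)"
  proof (rule contour_integral_at_infinity[where B = "2 * m" and \<psi> = "\<lambda>z. f z * dz u z - 1"])
    fix M assume M: "M > 2 * m"
    have "((\<lambda>z. 1) has_contour_integral 0) (circlepath 0 M)"
      by (rule Cauchy_theorem_convex_simple[of _ UNIV]) auto
    from has_contour_integral_diff[OF has_contour_integral_integral[OF int[OF F(1) M]] this]
    show "((\<lambda>z. f z * dz u z - 1) has_contour_integral K1) (circlepath 0 M)"
      using M1(1)[OF M] by simp
  next
    have "((\<lambda>z. z * (W z ^ n - 1) + W z ^ n * (z * dz (\<lambda>x. u x - x) z)) \<longlongrightarrow> of_real (2 * \<alpha> * real n) + 1 ^ n * 0) at_infinity"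
      by (intro tendsto_add tendsto_mult tendsto_power W_limit dec1 W_power_limit)
    then have "((\<lambda>z. z * (W z ^ n - 1) + W z ^ n * (z * dz (\<lambda>x. u x - x) z)) \<longlongrightarrow> of_real (2 * \<alpha> * real n)) at_infinity" by simp
    then show "((\<lambda>z. z * (f z * dz u z - 1)) \<longlongrightarrow> of_real (2 * \<alpha> * real n)) at_infinity"
    proof (rule Lim_transform_eventually)
      show "\<forall>\<^sub>F z in at_infinity. z * (W z ^ n - 1) + W z ^ n * (z * dz (\<lambda>x. u x - x) z) = z * (f z * dz u z - 1)"
      proof (rule eventually_mono[OF ev])
        fix z assume "z \<in> \<Omega>"
        from dz_diff_ident(1)[OF diff[OF this]]
        show "z * (W z ^ n - 1) + W z ^ n * (z * dz (\<lambda>x. u x - x) z) = z * (f z * dz u z - 1)"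
          by (simp add: f_def algebra_simps)
      qed
    qed
  qed
  ultimately have "2 * of_real pi * \<i> * of_real (2 * \<alpha> * real n) = (0::complex)" using K12 by simp
  then show False using n alpha by simp
qed

end

section \<open>Return to bipolar coordinates\<close>

theorem mainTheorem7:
  fixes \<alpha> \<xi>0 r :: real
    and c1 c2 k1 k2 \<tau> :: complex
    and D1 D2 :: "complex set"
  assumes "\<alpha> > 0" and "\<xi>0 > 0" and "r > 0"
    and "D1 = ball c1 r" and "D2 = ball c2 r"
    and "closure D1 \<inter> closure D2 = {}"
    and "D1 = bipolar_left \<alpha> \<xi>0" and "D2 = bipolar_right \<alpha> \<xi>0"
    and "k1 \<noteq> 1" and "k1 \<noteq> -1" and "k2 \<noteq> 1" and "k2 \<noteq> -1"
    and "\<tau> = tau k1 * tau k2"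
  shows
    "((\<forall>h. harmonic_on UNIV h \<longrightarrow>
         (\<exists>u. solves_conductivity_eq D1 c1 k1 D2 c2 k2 u \<and>
              (\<lambda>x. u x - h x) \<in> O[at_infinity](\<lambda>x. of_real (1 / norm x))))
      \<longleftrightarrow> (\<forall>n::nat. n \<ge> 1 \<longrightarrow> inverse \<tau> * of_real (exp (4 * real n * \<xi>0)) - 1 \<noteq> 0))
     \<and>
     ((\<forall>n::nat. n \<ge> 1 \<longrightarrow> inverse \<tau> * of_real (exp (4 * real n * \<xi>0)) - 1 \<noteq> 0)
      \<longleftrightarrow> (\<forall>n::nat. n \<ge> 1 \<longrightarrow> (\<forall>s \<in> {1, -1 :: real}.
             lam k1 * lam k2 \<noteq> of_real ((s * (1 / 2) * exp (- 2 * real n * \<xi>0))\<^sup>2))))"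
proof -
  note \<alpha> = assms(1) and \<xi> = assms(2)
  define m where "m = \<alpha> * cosh \<xi>0 / sinh \<xi>0"
  have s: "sinh \<xi>0 > 0" using \<xi> by simp
  \<comment> \<open>A nonempty ball determines its centre and radius, so the given c1, c2 and r are
    those of the bipolar disks.\<close>
  have c1: "c1 = - of_real m" and c2: "c2 = of_real m" and r: "r = \<alpha> / sinh \<xi>0"
    using bipolar_left_eq_ball[OF \<alpha> \<xi>] bipolar_right_eq_ball[OF \<alpha> \<xi>] assms(3-5,7,8) s \<alpha>
    by (auto simp: ball_eq_ball_iff m_def)
  interpret two_disks \<alpha> m r
  proof
    show "m > 0" using \<alpha> s by (simp add: m_def)
    show "m\<^sup>2 = \<alpha>\<^sup>2 + r\<^sup>2"
      using s by (simp add: m_def r power_divide power_mult_distrib cosh_square_eq field_simps)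
  qed (use assms in auto)
  \<comment> \<open>Because m + \<alpha> = r e^\<xi>0 and m - \<alpha> = r e^(-\<xi>0).\<close>
  have L: "L = exp (2 * \<xi>0)"
  proof -
    have a: "m + \<alpha> = \<alpha> / sinh \<xi>0 * exp \<xi>0"
      using s cosh_plus_sinh[of \<xi>0] by (simp add: m_def field_simps flip: cosh_plus_sinh)
    have b: "m - \<alpha> = \<alpha> / sinh \<xi>0 * exp (- \<xi>0)"
      using s by (simp add: m_def field_simps flip: cosh_minus_sinh)
    have "L = exp \<xi>0 / exp (- \<xi>0)" unfolding L_def a b using \<alpha> s by simp
    then show ?thesis by (simp add: exp_diff[symmetric])
  qed
  define E :: "nat \<Rightarrow> complex" where "E n = of_real (exp (4 * real n * \<xi>0))" for n
  have E0: "E n \<noteq> 0" for n by (simp add: E_def)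
  have \<kappa>: "of_real ((1 / L\<^sup>2) ^ n) = inverse (E n)" for n
  proof -
    have "(1 / L\<^sup>2) ^ n = inverse (exp (4 * real n * \<xi>0))"
      unfolding L by (simp add: power_divide inverse_eq_divide flip: exp_of_nat_mult power_mult)
    then show ?thesis by (simp add: E_def)
  qed
  have \<tau>0: "\<tau> \<noteq> 0" using assms(9-13) by (simp add: tau_def add_eq_0_iff2)
  have nonres: "inverse \<tau> * E n - 1 \<noteq> 0 \<longleftrightarrow> tau k1 * tau k2 * of_real ((1 / L\<^sup>2) ^ n) \<noteq> 1" for n
    unfolding \<kappa> assms(13)[symmetric] using \<tau>0 E0[of n] by (auto simp: field_simps)
  have lam: "lam k1 * lam k2 \<noteq> of_real ((s * (1 / 2) * exp (- 2 * real n * \<xi>0))\<^sup>2) \<longleftrightarrow> inverse \<tau> * E n - 1 \<noteq> 0"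
    if "s \<in> {1, - 1}" for s n
  proof -
    have e: "(s * (1 / 2) * exp (- 2 * real n * \<xi>0))\<^sup>2 = inverse (exp (4 * real n * \<xi>0)) / 4"
      using that by (auto simp: power_mult_distrib power2_eq_square field_simps simp flip: exp_minus exp_add)
    have em: "of_real ((s * (1 / 2) * exp (- 2 * real n * \<xi>0))\<^sup>2) = inverse (E n) / 4"
      unfolding e E_def by simp
    \<comment> \<open>By definition \<open>lam k\<close> is 1 / (2 tau k); the factor 1/4 matches
      the squared 1/2 on the other side, and both signs s give the same square.\<close>
    have el: "lam k1 * lam k2 = inverse \<tau> / 4"
      using assms(9-12) by (simp add: lam_def tau_def assms(13) field_simps)
    show ?thesis unfolding em el using E0[of n] \<tau>0 by (auto simp: field_simps)
  qed
  have "(\<forall>h. harmonic_on UNIV h \<longrightarrow>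
         (\<exists>u. solves_conductivity_eq D1 c1 k1 D2 c2 k2 u \<and>
              (\<lambda>x. u x - h x) \<in> O[at_infinity](\<lambda>x. of_real (1 / norm x))))
      \<longleftrightarrow> (\<forall>n::nat. n \<ge> 1 \<longrightarrow> inverse \<tau> * E n - 1 \<noteq> 0)" (is "?S \<longleftrightarrow> ?R")
  proof
    assume ?R
    then have nr: "tau k1 * tau k2 * of_real ((1 / L\<^sup>2) ^ n) \<noteq> 1" if "n \<ge> 1" for n using that nonres by blast
    show ?S
      unfolding assms(4,5) c1 c2
    proof (intro allI impI)
      fix h assume "harmonic_on UNIV h"
      then have h: "hol_plus_cnj UNIV h"
        by (rule harmonic_on_convex_imp_hol_plus_cnj[OF open_UNIV convex_UNIV])
      show "\<exists>u. solves_conductivity_eq DL (- of_real m) k1 DR (of_real m) k2 u \<and>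
          (\<lambda>x. u x - h x) \<in> O[at_infinity](\<lambda>x. of_real (1 / norm x))"
        by (rule solvable[OF assms(10,12) nr h]) blast+
    qed
  next
    assume S: ?S
    \<comment> \<open>Solvability is demanded for every harmonic h, so a single h without solution
      suffices; the identity works at every resonance.\<close>
    have "hol_plus_cnj UNIV (\<lambda>z. z)"
      by (rule hol_plus_cnjI[of "\<lambda>z. z" _ "\<lambda>_. 0"]) auto
    then have "harmonic_on UNIV (\<lambda>z. z)" by (rule hol_plus_cnj_harmonic[OF open_UNIV])
    then obtain u where "solves_conductivity_eq DL (- of_real m) k1 DR (of_real m) k2 u"
      "(\<lambda>x. u x - x) \<in> O[at_infinity](\<lambda>x. of_real (1 / norm x))"
      using S unfolding assms(4,5) c1 c2 by blast
    then show ?R using not_solvable_ident[OF assms(10,12)] nonres by blast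
  qed
  then show ?thesis using lam unfolding E_def by blast
qed

end
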